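(* Fix an integer $m\ge 0$. As $n\to\infty$, $$u(m,n)\sim\frac{1}{16\sqrt3\,n}e^{\pi\sqrt{\frac{2n}{3}}},\qquad u(m,n)-u(m+1,n)\sim\frac{\pi(2m+1)}{96\sqrt2\,n^{3/2}}e^{\pi\sqrt{\frac{2n}{3}}},$$ $$u(m,n)^2-u(m-1,n)u(m+1,n)\sim\frac{\pi}{768\sqrt6\,n^{5/2}}e^{2\pi\sqrt{\frac{2n}{3}}}.$$ In particular, for each fixed $m$, $u(m,n)^2>u(m-1,n)u(m+1,n)$ for all sufficiently large $n$.
   Context: A strongly unimodal sequence of size $n$ is a finite sequence of positive integers $\{a_j\}_{j=1}^s$ with $a_1<\dots<a_k>\dots>a_s$ for some $k$ and $\sum a_j=n$; its rank is $s-2k+1$; $u(m,n)$ ($m\in\mathbb Z$) is the number of such sequences of size $n$ and rank $m$. Note $u(-m,n)=u(m,n)$. *)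

theory Defs
  imports Complex_Main "HOL-Library.Landau_Symbols"
begin

unbundle asymp_equiv_syntax

(* The list a has entries a_1 = a!0, ..., a_s = a!(s-1).  The position k is counted
   from 1, so a_1 < ... < a_k is "take k a" and a_k > ... > a_s is "drop (k - 1) a":
   the two segments share the peak.  The bounds on k exclude the empty sequence. *)
definition strongly_unimodal_with_peak :: "nat \<Rightarrow> nat list \<Rightarrow> bool" where
  "strongly_unimodal_with_peak k a \<longleftrightarrow>
     (\<forall>x\<in>set a. 0 < x) \<and> 1 \<le> k \<and> k \<le> length a \<and>
     sorted_wrt (<) (take k a) \<and> sorted_wrt (>) (drop (k - 1) a)"

(* The peak position is unique (strongly_unimodal_peak_unique), so the existential
   over k just says that the rank s - 2k + 1 of a equals m. *)
definition unimodal_seqs :: "int \<Rightarrow> nat \<Rightarrow> nat list set" where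
  "unimodal_seqs m n =
     {a. sum_list a = n \<and>
         (\<exists>k. strongly_unimodal_with_peak k a \<and> int (length a) - 2 * int k + 1 = m)}"

definition u :: "int \<Rightarrow> nat \<Rightarrow> nat" where
  "u m n = card (unimodal_seqs m n)"

lemma strongly_unimodal_peak_unique:
  assumes "strongly_unimodal_with_peak k a" "strongly_unimodal_with_peak l a"
  shows "k = l"
proof -
  have False if k: "strongly_unimodal_with_peak k a" and l: "strongly_unimodal_with_peak l a"
    and "k < l" for k l
  proof -
    have "(take l a) ! (k - 1) < (take l a) ! k"
      using k l \<open>k < l\<close> unfolding strongly_unimodal_with_peak_def
      by (intro sorted_wrt_nth_less[where P = "(<)"]) auto
    moreover have "(drop (k - 1) a) ! 0 > (drop (k - 1) a) ! 1"
      using k l \<open>k < l\<close> unfolding strongly_unimodal_with_peak_def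
      by (intro sorted_wrt_nth_less[where P = "(>)"]) auto
    ultimately show False
      using k l \<open>k < l\<close> unfolding strongly_unimodal_with_peak_def by auto
  qed
  with assms show ?thesis
    by (meson linorder_neqE_nat)
qed

lemma finite_unimodal_seqs: "finite (unimodal_seqs m n)"
proof (rule finite_subset)
  have len: "length a \<le> sum_list a" if "\<forall>x\<in>set a. 0 < x" for a :: "nat list"
    using that by (induction a) (auto simp: Suc_le_eq add_strict_increasing)
  show "unimodal_seqs m n \<subseteq> {a. set a \<subseteq> {..n} \<and> length a \<le> n}"
    using len member_le_sum_list
    by (fastforce simp: unimodal_seqs_def strongly_unimodal_with_peak_def)
  show "finite {a. set a \<subseteq> {..n} \<and> length a \<le> n}"
    by (rule finite_lists_length_le) simp
qed

end

theory Submission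
  imports Defs "HOL-Complex_Analysis.Complex_Analysis" "HOL-Real_Asymp.Real_Asymp"
    "HOL-Probability.Probability"
begin

text \<open>Splitting a sequence at its peak expresses the generating function of the numbers \<open>u(m,n)\<close>
through the finite products \<open>(-zq)\<^sub>N (-q/z)\<^sub>N\<close>. Two consecutive coefficients of such a product add up to a
single Gaussian binomial coefficient, and summing over the peak with the \<open>q\<close>-binomial theorem turns
the generating function of \<open>u(m,n) + u(m+1,n)\<close> into \<open>1/(q)\<^sub>\<infinity>\<close> times a partial theta series. Hence
\<open>u(m,n)\<close> has the generating function \<open>f\<^sub>m(q)/(q)\<^sub>\<infinity>\<close>, where \<open>f\<^sub>m\<close> is an alternating double series of
powers of \<open>q\<close> with quadratic exponents. As \<open>q = e\<^bsup>-t\<^esup>\<close> tends to 1 in a cone around the real axis,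
\<open>f\<^sub>m = 1/4 - (m\<^sup>2 - 1) t/8 + O(t\<^bsup>3/2\<^esup>)\<close>, so that \<open>f\<^sub>m - f\<^bsub>m+1\<^esub>\<close> is asymptotic to \<open>(2m+1) t/8\<close>.
Multiplication by \<open>1/(q)\<^sub>\<infinity>\<close> is handled by the circle method at the radius \<open>e\<^bsup>-\<eta>\<^esup>\<close>,
\<open>\<eta> = \<pi>/\<surd>(6n)\<close>. The third asymptotic formula then follows from
\<open>u(m)\<^sup>2 - u(m-1) u(m+1) = u(m) (d(m) - d(m-1)) + d(m-1) d(m)\<close> with \<open>d(m) = u(m) - u(m+1)\<close>.\<close>

section \<open>Strongly unimodal sequences as pairs of finite sets\<close>

text \<open>The obstacle is that the double series f_m is a false theta series without a modular
  transformation. Near q = 1 about 1/t of its terms have size comparable to 1, so absolute values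
  bound it only by a multiple of 1/Re t; the constant 1/4 and the linear term come from cancellation
  alone. They are the Abel values of the formal series obtained by linearizing each exponential in
  t, and a truncated Euler transform in each summation variable makes this rigorous, with a
  remainder that Cauchy's estimates control. The linear term is essential: the leading terms of
  u(m,n) and u(m+1,n) coincide, so the difference is governed by it. For the last asymptotic formula
  no further term is required, since d(m-1) d(m) has smaller order and the coefficients 2m + 1 and
  2m - 1 of d(m) and d(m-1) differ. For 1/(q)_infinity modularity is avoided as well: its logarithm
  is a Lambert series, treated on the real axis by the trapezoidal rule and Stirling's formula, and
  off the axis only relative to the value at the real part of t.\<close>

definition peak_triples :: "int \<Rightarrow> nat \<Rightarrow> (nat \<times> nat set \<times> nat set) set" where
  "peak_triples m n = {(p, A, B). 1 \<le> p \<and> A \<subseteq> {1..<p} \<and> B \<subseteq> {1..<p} \<and>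
     \<Sum>A + \<Sum>B + p = n \<and> int (card B) - int (card A) = m}"

definition list_of_triple :: "nat \<times> nat set \<times> nat set \<Rightarrow> nat list" where
  "list_of_triple = (\<lambda>(p, A, B). sorted_list_of_set A @ p # rev (sorted_list_of_set B))"

lemma list_of_triple_unimodal:
  assumes "(p, A, B) \<in> peak_triples m n"
  shows "strongly_unimodal_with_peak (Suc (card A)) (list_of_triple (p, A, B))"
proof -
  from assms have A: "A \<subseteq> {1..<p}" and B: "B \<subseteq> {1..<p}" and p: "1 \<le> p"
    by (auto simp: peak_triples_def)
  have fin: "finite A" "finite B"
    using A B finite_subset by auto
  have 1: "take (Suc (card A)) (list_of_triple (p, A, B)) = sorted_list_of_set A @ [p]"
    unfolding list_of_triple_def by simp
  have 2: "drop (Suc (card A) - 1) (list_of_triple (p, A, B)) = p # rev (sorted_list_of_set B)"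
    unfolding list_of_triple_def by simp
  have 3: "sorted_wrt (<) (sorted_list_of_set A @ [p])"
    using A fin by (auto simp: sorted_wrt_append)
  have 4: "sorted_wrt (>) (p # rev (sorted_list_of_set B))"
    using B fin by (auto simp: sorted_wrt_rev)
  have 5: "\<forall>x\<in>set (list_of_triple (p, A, B)). 0 < x"
    using A B fin p by (force simp: list_of_triple_def)
  show ?thesis
    unfolding strongly_unimodal_with_peak_def 1 2 using 3 4 5
    by (simp add: list_of_triple_def)
qed

lemma list_of_triple_mem:
  assumes "x \<in> peak_triples m n"
  shows "list_of_triple x \<in> unimodal_seqs m n"
proof -
  obtain p A B where x: "x = (p, A, B)" by (cases x) auto
  from assms have A: "A \<subseteq> {1..<p}" and B: "B \<subseteq> {1..<p}" 
    and s: "\<Sum>A + \<Sum>B + p = n" and m: "int (card B) - int (card A) = m"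
    by (auto simp: peak_triples_def x)
  have fin: "finite A" "finite B"
    using A B finite_subset by auto
  have sl: "sum_list (sorted_list_of_set S) = \<Sum>S" if "finite S" for S :: "nat set"
    using that by (metis distinct_sorted_list_of_set list.map_ident set_sorted_list_of_set
        sum_list_distinct_conv_sum_set)
  have "sum_list (list_of_triple x) = n"
    using s fin by (simp add: x list_of_triple_def sl sum_list_rev)
  \<comment> \<open>The length is |A| + |B| + 1 and the peak position |A| + 1, so s - 2k + 1 = |B| -
    |A|.\<close>
  moreover have "int (length (list_of_triple x)) - 2 * int (Suc (card A)) + 1 = m"
    using m by (simp add: x list_of_triple_def)
  ultimately show ?thesis
    unfolding unimodal_seqs_def using list_of_triple_unimodal[OF assms[unfolded x]] x by blast
qed

lemma inj_list_of_triple: "inj_on list_of_triple (peak_triples m n)"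
proof (rule inj_onI)
  fix x y assume x: "x \<in> peak_triples m n" and y: "y \<in> peak_triples m n"
    and eq: "list_of_triple x = list_of_triple y"
  obtain p A B where x': "x = (p, A, B)" by (cases x) auto
  obtain p' A' B' where y': "y = (p', A', B')" by (cases y) auto
  have fin: "finite A" "finite B" "finite A'" "finite B'"
    using x y finite_subset unfolding peak_triples_def x' y' by auto
  \<comment> \<open>Uniqueness of the peak position fixes the length of the left part; only then
    does the equation between the appended lists split.\<close>
  have "Suc (card A) = Suc (card A')"
    using list_of_triple_unimodal x y eq strongly_unimodal_peak_unique unfolding x' y' by metis
  hence "length (sorted_list_of_set A) = length (sorted_list_of_set A')" by simp
  with eq have "sorted_list_of_set A = sorted_list_of_set A'" "p = p'"
     "rev (sorted_list_of_set B) = rev (sorted_list_of_set B')"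
    by (auto simp: x' y' list_of_triple_def)
  thus "x = y"
    using fin by (auto simp: x' y' dest: sorted_list_of_set_inject)
qed

lemma surj_list_of_triple:
  assumes "a \<in> unimodal_seqs m n"
  shows "a \<in> list_of_triple ` peak_triples m n"
proof -
  from assms obtain k where s: "sum_list a = n" and k: "strongly_unimodal_with_peak k a"
    and m: "int (length a) - 2 * int k + 1 = m"
    by (auto simp: unimodal_seqs_def)
  have k1: "1 \<le> k" "k \<le> length a" and pos: "\<forall>x\<in>set a. 0 < x"
    and inc: "sorted_wrt (<) (take k a)" and dec: "sorted_wrt (>) (drop (k - 1) a)"
    using k by (auto simp: strongly_unimodal_with_peak_def)
  define xs where "xs = take (k - 1) a"
  define p where "p = a ! (k - 1)"
  define ys where "ys = drop k a"
  have tk: "take k a = xs @ [p]"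
    using k1 take_Suc_conv_app_nth[of "k - 1" a] by (simp add: xs_def p_def)
  have dk: "drop (k - 1) a = p # ys"
    using k1 Cons_nth_drop_Suc[of "k - 1" a] by (simp add: ys_def p_def)
  have a: "a = xs @ p # ys"
    using dk unfolding xs_def by (metis append_take_drop_id)
  have xs: "sorted_wrt (<) xs" "\<forall>x\<in>set xs. x < p"
    using inc unfolding tk by (auto simp: sorted_wrt_append)
  have ys: "sorted_wrt (<) (rev ys)" "\<forall>x\<in>set ys. x < p"
    using dec unfolding dk by (auto simp: sorted_wrt_rev)
  have xs': "sorted_list_of_set (set xs) = xs"
    using xs by (simp add: strict_sorted_iff sorted_list_of_set.idem_if_sorted_distinct)
  have ys': "sorted_list_of_set (set ys) = rev ys"
    using sorted_list_of_set.idem_if_sorted_distinct[of "rev ys"] ys by (simp add: strict_sorted_iff)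
  have lx: "length xs = k - 1" using k1 by (simp add: xs_def)
  have ly: "length ys = length a - k" by (simp add: ys_def)
  have dist: "distinct xs" "distinct ys"
    using xs(1) ys(1) strict_sorted_iff distinct_rev by blast+
  have "(p, set xs, set ys) \<in> peak_triples m n"
  proof -
    have "sum_list a = \<Sum>(set xs) + \<Sum>(set ys) + p"
      using dist by (simp add: a sum_list_distinct_conv_sum_set[of _ id, simplified])
    moreover have "int (card (set ys)) - int (card (set xs)) = m"
      using dist m k1 lx ly by (simp add: distinct_card of_nat_diff)
    moreover have "set xs \<subseteq> {1..<p}" "set ys \<subseteq> {1..<p}" "1 \<le> p"
      using pos xs ys a by (auto simp: Suc_le_eq)
    ultimately show ?thesis using s by (simp add: peak_triples_def)
  qed
  moreover have "list_of_triple (p, set xs, set ys) = a"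
    by (simp add: list_of_triple_def xs' ys' a)
  ultimately show ?thesis by (metis imageI)
qed

lemma bij_list_of_triple: "bij_betw list_of_triple (peak_triples m n) (unimodal_seqs m n)"
  unfolding bij_betw_def
proof (intro conjI inj_list_of_triple equalityI subsetI)
  fix x assume "x \<in> list_of_triple ` peak_triples m n"
  thus "x \<in> unimodal_seqs m n" using list_of_triple_mem by auto
qed (rule surj_list_of_triple)

lemma u_eq_card_triples: "u m n = card (peak_triples m n)"
  unfolding u_def by (rule bij_betw_same_card[OF bij_list_of_triple, symmetric])

lemma finite_peak_triples: "finite (peak_triples m n)"
  by (simp add: bij_betw_finite[OF bij_list_of_triple] finite_unimodal_seqs)

text \<open>Exchanging the two sides of the peak. It supplies rank -1, which the case m = 0 of the
  last asymptotic formula involves.\<close>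

lemma u_minus: "u (- m) n = u m n"
proof -
  have "bij_betw (\<lambda>(p, A, B). (p, B, A)) (peak_triples (- m) n) (peak_triples m n)"
    by (rule bij_betw_byWitness[where f' = "\<lambda>(p, A, B). (p, B, A)"])
       (auto simp: peak_triples_def)
  thus ?thesis unfolding u_eq_card_triples by (rule bij_betw_same_card)
qed

text \<open>The coefficient of \<open>z\<^sup>m\<close> in \<open>(-zq)\<^sub>N (-q/z)\<^sub>N\<close>.\<close>
definition side_sum :: "'a::comm_ring_1 \<Rightarrow> nat \<Rightarrow> int \<Rightarrow> 'a" where
  "side_sum q N m = (\<Sum>A\<in>Pow {1..N}. \<Sum>B\<in>Pow {1..N}.
     if int (card B) - int (card A) = m then q ^ (\<Sum>A + \<Sum>B) else 0)"

lemma sum_Pow_insert: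
  fixes f :: "'b set \<Rightarrow> 'a::comm_monoid_add"
  assumes "finite S" "x \<notin> S"
  shows "(\<Sum>A\<in>Pow (insert x S). f A) = (\<Sum>A\<in>Pow S. f A + f (insert x A))"
proof -
  have "(\<Sum>A\<in>Pow (insert x S). f A) = (\<Sum>A\<in>Pow S. f A) + (\<Sum>A\<in>insert x ` Pow S. f A)"
    unfolding Pow_insert using assms by (intro sum.union_disjoint) auto
  also have "(\<Sum>A\<in>insert x ` Pow S. f A) = (\<Sum>A\<in>Pow S. f (insert x A))"
  proof (subst sum.reindex)
    show "inj_on (insert x) (Pow S)"
      using assms(2) by (intro inj_onI) (metis Diff_insert_absorb PowD subsetD)
  qed simp
  finally show ?thesis by (simp add: sum.distrib)
qed

text \<open>The new factors are (1 + z q^(N+1)) (1 + q^(N+1)/z): the part N + 1 lies in neither set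
  or in both (same rank), in B only (coming from m - 1), or in A only (coming from m + 1).\<close>

lemma side_sum_Suc:
  fixes q :: "'a::comm_ring_1"
  shows "side_sum q (Suc N) m = (1 + q ^ (2 * Suc N)) * side_sum q N m
     + q ^ Suc N * (side_sum q N (m - 1) + side_sum q N (m + 1))"
proof -
  define w where "w = (\<lambda>A B k. if int (card B) - int (card A) = k then q ^ (\<Sum>A + \<Sum>B) else 0)"
  define i where "i = insert (Suc N)"
  have S: "side_sum q M k = (\<Sum>A\<in>Pow {1..M}. \<Sum>B\<in>Pow {1..M}. w A B k)" for M k
    by (simp add: side_sum_def w_def)
  have ins: "{1..Suc N} = i {1..N}" by (auto simp: i_def)
  have fin: "finite A" "Suc N \<notin> A" if "A \<in> Pow {1..N}" for A
    using that finite_subset by auto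
  have *: "(\<Sum>B\<in>Pow {1..N}. w A B m + w A (i B) m) + (\<Sum>B\<in>Pow {1..N}. w (i A) B m + w (i A) (i B) m) =
     (\<Sum>B\<in>Pow {1..N}. (1 + q ^ (2 * Suc N)) * w A B m + q ^ Suc N * (w A B (m - 1) + w A B (m + 1)))"
    if A: "A \<in> Pow {1..N}" for A
    unfolding sum.distrib[symmetric]
  proof (rule sum.cong[OF refl])
    fix B assume B: "B \<in> Pow {1..N}"
    have p: "q ^ (2 * Suc N) = q ^ Suc N * q ^ Suc N"
      by (metis mult_2 power_add)
    show "w A B m + w A (i B) m + (w (i A) B m + w (i A) (i B) m) =
        (1 + q ^ (2 * Suc N)) * w A B m + q ^ Suc N * (w A B (m - 1) + w A B (m + 1))"
      unfolding p w_def i_def using fin[OF A] fin[OF B] by (auto simp: power_add algebra_simps)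
  qed
  have "side_sum q (Suc N) m = (\<Sum>A\<in>Pow {1..N}. \<Sum>B\<in>Pow {1..N}.
        (1 + q ^ (2 * Suc N)) * w A B m + q ^ Suc N * (w A B (m - 1) + w A B (m + 1)))"
    unfolding S ins i_def
    apply (subst sum_Pow_insert, simp, simp)
    apply (subst sum_Pow_insert, simp, simp)
    by (rule sum.cong[OF refl], rule *[unfolded i_def])
  thus ?thesis
    unfolding S by (simp add: sum.distrib sum_distrib_left distrib_left)
qed

section \<open>Pochhammer symbols and Gaussian binomial coefficients\<close>

definition qpoch :: "'a::comm_ring_1 \<Rightarrow> nat \<Rightarrow> 'a" where
  "qpoch q k = (\<Prod>i=1..k. 1 - q ^ i)"

lemma qpoch_0 [simp]: "qpoch q 0 = 1" by (simp add: qpoch_def)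

lemma qpoch_Suc: "qpoch q (Suc k) = qpoch q k * (1 - q ^ Suc k)" by (simp add: qpoch_def)

lemma one_minus_power_nonzero:
  fixes q :: "'a::real_normed_field"
  assumes "norm q < 1" "k > 0"
  shows "1 - q ^ k \<noteq> 0"
proof
  assume "1 - q ^ k = 0"
  hence "norm q ^ k = 1" by (metis norm_one norm_power right_minus_eq)
  moreover have "norm q ^ k < 1" using assms by (simp add: power_less_one_iff)
  ultimately show False by simp
qed

lemma qpoch_nonzero:
  fixes q :: "'a::real_normed_field"
  assumes "norm q < 1"
  shows "qpoch q k \<noteq> 0"
proof (induction k)
  case (Suc k)
  thus ?case using one_minus_power_nonzero[OF assms, of "Suc k"] by (simp only: qpoch_Suc mult_eq_0_iff) simp
qed simp

text \<open>The value 0 at negative indices makes the recurrence for Gaussian binomial coefficients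
  hold without boundary cases.\<close>
definition inv_qpoch :: "'a::real_normed_field \<Rightarrow> int \<Rightarrow> 'a" where
  "inv_qpoch q k = (if k < 0 then 0 else inverse (qpoch q (nat k)))"

text \<open>At k = 0 the factor 1 - q^0 vanishes, which makes the value 0 at index -1 consistent
  with the recurrence.\<close>

lemma inv_qpoch_diff_1:
  fixes q :: "'a::real_normed_field"
  assumes "norm q < 1" "q \<noteq> 0"
  shows "inv_qpoch q (k - 1) = (1 - q powi k) * inv_qpoch q k"
proof (cases "k \<le> 0")
  case True thus ?thesis by (auto simp: inv_qpoch_def)
next
  case False
  then obtain j where k: "k = int (Suc j)" by (metis gr0_conv_Suc not_le zero_less_imp_eq_int)
  show ?thesis
    using one_minus_power_nonzero[OF assms(1), of "Suc j"]
    unfolding k inv_qpoch_def by (simp add: qpoch_Suc power_int_def nat_add_distrib del: power_Suc)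
qed

text \<open>This is q^(m(m+1)/2) times the Gaussian binomial coefficient [2N+1 choose N-m]: the
  coefficient of z^m in (-zq)_N (-1/z)_(N+1) by the finite form of Jacobi's triple product. It is
  zero unless -N - 1 <= m <= N.\<close>

definition side_closed :: "'a::real_normed_field \<Rightarrow> nat \<Rightarrow> int \<Rightarrow> 'a" where
  "side_closed q N m = qpoch q (2 * N + 1) * inv_qpoch q (int N - m) * inv_qpoch q (int N + m + 1)
      * q powi (m * (m + 1) div 2)"

text \<open>All Pochhammer factors are pulled back to the indices N + 1 - m and N + m + 2 by
  \<open>inv_qpoch_diff_1\<close>, all powers of q to \<open>a\<close>, \<open>b\<close> and
  \<open>T\<close>. After the common product is taken out, an identity between polynomials in a, b
  and q remains.\<close>

lemma side_closed_Suc: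
  fixes q :: "'a::real_normed_field"
  assumes q: "norm q < 1" "q \<noteq> 0"
  shows "side_closed q (Suc N) m = (1 + q ^ (2 * Suc N)) * side_closed q N m
     + q ^ Suc N * (side_closed q N (m - 1) + side_closed q N (m + 1))"
proof -
  define a where "a = q powi (int (Suc N) - m)"
  define b where "b = q powi (int (Suc N) + m)"
  define \<alpha> where "\<alpha> = inv_qpoch q (int (Suc N) - m)"
  define \<beta> where "\<beta> = inv_qpoch q (int (Suc N) + m + 1)"
  define T where "T = q powi (m * (m + 1) div 2)"
  define R where "R = qpoch q (2 * N + 1)"
  have bq: "q powi (int (Suc N) + m + 1) = b * q"
    using q power_int_add[of q "int (Suc N) + m" 1] by (simp add: b_def)
  have aq: "q powi (int N - m) = a / q"
    using q power_int_diff[of q "int (Suc N) - m" 1] by (simp add: a_def)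
  have ab: "q ^ (2 * Suc N) = a * b"
  proof -
    have "a * b = q powi ((int (Suc N) - m) + (int (Suc N) + m))"
      unfolding a_def b_def using q by (subst power_int_add) auto
    also have "\<dots> = q powi int (2 * Suc N)" by simp
    finally show ?thesis by (simp only: power_int_of_nat)
  qed
  have i1: "inv_qpoch q (int N - m) = (1 - a) * \<alpha>"
    using inv_qpoch_diff_1[OF q, of "int (Suc N) - m"] by (simp add: a_def \<alpha>_def)
  have i2: "inv_qpoch q (int N - m - 1) = (1 - a / q) * (1 - a) * \<alpha>"
    using inv_qpoch_diff_1[OF q, of "int N - m"] unfolding i1 aq by (simp only: mult.assoc)
  have j1: "inv_qpoch q (int N + m + 1) = (1 - b * q) * \<beta>"
    using inv_qpoch_diff_1[OF q, of "int (Suc N) + m + 1"] unfolding bq by (simp add: \<beta>_def add_ac)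
  have j2: "inv_qpoch q (int N + m) = (1 - b) * (1 - b * q) * \<beta>"
    using inv_qpoch_diff_1[OF q, of "int (Suc N) + m"] j1 by (simp add: b_def add_ac mult.assoc)
  have padd: "q powi (i + j) = q powi i * q powi j" for i j
    using q by (simp add: power_int_add)
  have t1: "q ^ Suc N * q powi ((m - 1) * (m - 1 + 1) div 2) = T * a"
  proof -
    have "(m - 1) * (m - 1 + 1) = m * (m + 1) + (-m) * 2" by (simp add: algebra_simps)
    hence "(m - 1) * (m - 1 + 1) div 2 = m * (m + 1) div 2 - m" by (metis div_mult_self1 zero_neq_numeral add_uminus_conv_diff add.commute)
    hence e: "q ^ Suc N * q powi ((m - 1) * (m - 1 + 1) div 2) = q powi (int (Suc N) + (m * (m + 1) div 2 - m))"
      by (simp only: padd power_int_of_nat)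
    have "int (Suc N) + (m * (m + 1) div 2 - m) = m * (m + 1) div 2 + (int (Suc N) - m)" by simp
    thus ?thesis unfolding e T_def a_def by (simp only: padd)
  qed
  have t2: "q ^ Suc N * q powi ((m + 1) * (m + 1 + 1) div 2) = T * b * q"
  proof -
    have "(m + 1) * (m + 1 + 1) = m * (m + 1) + (m + 1) * 2" by (simp add: algebra_simps)
    hence "(m + 1) * (m + 1 + 1) div 2 = m * (m + 1) div 2 + m + 1" by simp
    hence e: "q ^ Suc N * q powi ((m + 1) * (m + 1 + 1) div 2) = q powi (int (Suc N) + (m * (m + 1) div 2 + m + 1))"
      by (simp only: padd power_int_of_nat)
    have "int (Suc N) + (m * (m + 1) div 2 + m + 1) = m * (m + 1) div 2 + (int (Suc N) + m) + 1" by simp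
    thus ?thesis unfolding e T_def b_def by (simp only: padd power_int_1_right)
  qed
  have R': "qpoch q (2 * Suc N + 1) = R * (1 - a * b) * (1 - a * b * q)"
    using ab unfolding R_def by (simp add: qpoch_Suc algebra_simps)
  have "(1 + q ^ (2 * Suc N)) * side_closed q N m
     + q ^ Suc N * (side_closed q N (m - 1) + side_closed q N (m + 1)) = 
     (1 + a * b) * (R * ((1 - a) * \<alpha>) * ((1 - b * q) * \<beta>) * T) +
     (R * \<alpha> * ((1 - b) * (1 - b * q) * \<beta>) * (q ^ Suc N * q powi ((m - 1) * (m - 1 + 1) div 2)) +
      R * ((1 - a / q) * (1 - a) * \<alpha>) * \<beta> * (q ^ Suc N * q powi ((m + 1) * (m + 1 + 1) div 2)))"
  proof -
    have e: "int N - (m - 1) = int (Suc N) - m" "int N + (m - 1) + 1 = int N + m"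
      "int N - (m + 1) = int N - m - 1" "int N + (m + 1) + 1 = int (Suc N) + m + 1" by auto
    show ?thesis
      unfolding side_closed_def ab e R_def[symmetric] T_def[symmetric] i1 j1 i2 j2 \<alpha>_def[symmetric] \<beta>_def[symmetric]
      by (simp only: distrib_left mult_ac)
  qed
  also have "\<dots> = R * \<alpha> * \<beta> * T * ((1 + a * b) * (1 - a) * (1 - b * q) + 
      a * (1 - b) * (1 - b * q) + (b * q) * (1 - a) * (1 - a / q))"
    unfolding t1 t2 by (simp only: distrib_left mult_ac add.assoc)
  also have "(1 + a * b) * (1 - a) * (1 - b * q) + 
      a * (1 - b) * (1 - b * q) + (b * q) * (1 - a) * (1 - a / q) = (1 - a * b) * (1 - a * b * q)"
    using q(2) by (simp add: divide_simps) (simp add: algebra_simps)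
  also have "R * \<alpha> * \<beta> * T * ((1 - a * b) * (1 - a * b * q)) = side_closed q (Suc N) m"
    unfolding side_closed_def R' \<alpha>_def \<beta>_def T_def by (simp add: algebra_simps)
  finally show ?thesis by simp
qed

lemma side_sum_0: "side_sum q 0 m = (if m = 0 then 1 else 0)"
  by (simp add: side_sum_def)

text \<open>Multiplying (-zq)_N (-q/z)_N by 1 + 1/z yields the product in the finite triple product
  identity, which is why neighbouring coefficients are added. The recurrence
  \<open>side_sum_Suc\<close> is linear and invariant under shifts of m, so the sum obeys the
  recurrence of \<open>side_closed\<close>.\<close>

theorem side_sum_add_closed:
  fixes q :: "'a::real_normed_field"
  assumes q: "norm q < 1" "q \<noteq> 0"
  shows "side_sum q N m + side_sum q N (m + 1) = side_closed q N m"
proof (induction N arbitrary: m)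
  case 0
  have q1: "qpoch q 1 = 1 - q" by (simp add: qpoch_def)
  have q1': "1 - q \<noteq> 0" using one_minus_power_nonzero[OF q(1), of 1] by simp
  \<comment> \<open>Both sides are 1 at m = 0 and at m = -1; otherwise one of the two
    \<open>inv_qpoch\<close> indices is negative.\<close>
  consider "m = 0" | "m = -1" | "m > 0" | "m < -1" by linarith
  thus ?case
    by cases (use q1 q1' in \<open>simp_all add: side_sum_0 side_closed_def inv_qpoch_def\<close>)
next
  case (Suc N)
  have "side_sum q (Suc N) m + side_sum q (Suc N) (m + 1) =
     (1 + q ^ (2 * Suc N)) * (side_sum q N m + side_sum q N (m + 1)) + 
     q ^ Suc N * ((side_sum q N (m - 1) + side_sum q N (m - 1 + 1)) + (side_sum q N (m + 1) + side_sum q N (m + 1 + 1)))"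
    unfolding side_sum_Suc by (simp add: algebra_simps)
  also have "\<dots> = side_closed q (Suc N) m"
    unfolding Suc.IH side_closed_Suc[OF q] ..
  finally show ?case .
qed

section \<open>Euler and partial theta identities\<close>

text \<open>Induction by the Pascal rule \<open>step\<close>. The coefficient is written with
  \<open>inv_qpoch\<close> at k - r so that it is 0 at r = k + 1 and the rule covers that boundary
  case.\<close>

theorem qbinomial_theorem:
  fixes q :: "'a::real_normed_field"
  assumes q: "norm q < 1" "q \<noteq> 0"
  shows "(\<Prod>i<k. 1 - x * q ^ i) =
    (\<Sum>r\<le>k. (-1) ^ r * q ^ (r * (r - 1) div 2) * qpoch q k * inverse (qpoch q r) * inv_qpoch q (int k - int r) * x ^ r)"
proof (induction k)
  case 0
  show ?case by (simp add: inv_qpoch_def)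
next
  case (Suc k)
  define b where "b = (\<lambda>k r. (-1) ^ r * q ^ (r * (r - 1) div 2) * qpoch q k * inverse (qpoch q r) * inv_qpoch q (int k - int r))"
  have tri: "Suc r * (Suc r - 1) div 2 = r * (r - 1) div 2 + r" for r :: nat
    by (cases r) (auto simp: algebra_simps)
  have step: "b (Suc k) (Suc r) = b k (Suc r) - q ^ k * b k r" if "r \<le> k" for r
  proof -
    define I where "I = inv_qpoch q (int k - int r)"
    define J where "J = inverse (qpoch q (Suc r))"
    define T where "T = q ^ (r * (r - 1) div 2)"
    define s where "s = q ^ (k - r)"
    have J': "inverse (qpoch q r) = (1 - q ^ Suc r) * J"
      using one_minus_power_nonzero[OF q(1), of "Suc r"] unfolding J_def qpoch_Suc inverse_mult_distrib by (simp del: power_Suc)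
    have I': "inv_qpoch q (int k - int (Suc r)) = (1 - s) * I"
    proof -
      have "q powi (int k - int r) = s"
        by (simp only: of_nat_diff[OF that, symmetric] power_int_of_nat s_def)
      thus ?thesis using inv_qpoch_diff_1[OF q, of "int k - int r"] by (simp add: I_def algebra_simps)
    qed
    have qk: "q ^ k = s * q ^ r" using that by (simp add: s_def flip: power_add)
    have l: "b (Suc k) (Suc r) = - ((-1) ^ r * (T * q ^ r) * (qpoch q k * (1 - q ^ Suc k)) * J * I)"
    proof -
      have i: "int (Suc k) - int (Suc r) = int k - int r" by simp
      have m1: "(-1 :: 'a) ^ Suc r = - ((-1) ^ r)" by simp
      show ?thesis unfolding b_def i tri m1 power_add qpoch_Suc[of q k] T_def J_def I_def by (simp del: power_Suc)
    qed
    have r1: "b k (Suc r) = - ((-1) ^ r * (T * q ^ r) * qpoch q k * J * ((1 - s) * I))"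
      unfolding b_def tri I' by (simp add: T_def J_def power_add)
    have r2: "b k r = (-1) ^ r * T * qpoch q k * ((1 - q ^ Suc r) * J) * I"
      unfolding b_def by (simp add: J' T_def I_def)
    show ?thesis unfolding l r1 r2 power_Suc qk by (simp add: algebra_simps)
  qed
  have IH: "(\<Prod>i<k. 1 - x * q ^ i) = (\<Sum>r\<le>k. b k r * x ^ r)"
    using Suc.IH by (simp add: b_def)
  have top: "b k (Suc k) = 0" by (simp add: b_def inv_qpoch_def)
  have bot: "b k 0 = 1" for k using qpoch_nonzero[OF q(1), of k] by (simp add: b_def inv_qpoch_def)
  have "(\<Prod>i<Suc k. 1 - x * q ^ i) = (\<Sum>r\<le>k. b k r * x ^ r) * (1 - x * q ^ k)"
    by (simp add: IH)
  also have "\<dots> = (\<Sum>r\<le>Suc k. b k r * x ^ r) - x * q ^ k * (\<Sum>r\<le>k. b k r * x ^ r)"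
    by (simp add: top algebra_simps)
  also have "(\<Sum>r\<le>Suc k. b k r * x ^ r) = 1 + (\<Sum>r\<le>k. b k (Suc r) * x ^ Suc r)"
    by (subst sum.atMost_Suc_shift) (simp add: bot)
  also have "1 + (\<Sum>r\<le>k. b k (Suc r) * x ^ Suc r) - x * q ^ k * (\<Sum>r\<le>k. b k r * x ^ r) =
     1 + (\<Sum>r\<le>k. (b k (Suc r) - q ^ k * b k r) * x ^ Suc r)"
    by (simp add: sum_subtractf sum_distrib_left algebra_simps)
  also have "\<dots> = 1 + (\<Sum>r\<le>k. b (Suc k) (Suc r) * x ^ Suc r)"
    using step by simp
  also have "\<dots> = (\<Sum>r\<le>Suc k. b (Suc k) r * x ^ r)"
    by (subst sum.atMost_Suc_shift) (simp add: bot)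
  finally show ?case by (simp add: b_def)
qed

text \<open>With x = r^i <= r one has 1/(1 - x) <= 1 + x/(1 - r) <= exp (x/(1 - r)), and the
  geometric series sums the exponents. The point is uniformity in k: one bound for all 1/(q)_k on a
  circle.\<close>

lemma qpoch_lower_bound:
  fixes r :: real
  assumes r: "0 \<le> r" "r < 1"
  shows "qpoch r k \<ge> exp (- r / (1 - r)\<^sup>2)"
proof -
  have 1: "exp (- (r ^ i / (1 - r))) \<le> 1 - r ^ i" if "i \<ge> 1" for i
  proof -
    have le: "r ^ i \<le> r" using r that power_decreasing[of 1 i r] by simp
    have pos: "1 - r ^ i > 0" using le r by simp
    have "1 / (1 - r ^ i) = 1 + r ^ i / (1 - r ^ i)" using pos by (simp add: field_simps)
    also have "\<dots> \<le> 1 + r ^ i / (1 - r)" using le r by (intro add_left_mono divide_left_mono) auto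
    also have "\<dots> \<le> exp (r ^ i / (1 - r))" by (rule exp_ge_add_one_self)
    finally show ?thesis using pos by (simp add: exp_minus field_simps)
  qed
  have "exp (- r / (1 - r)\<^sup>2) \<le> exp (- ((\<Sum>i=1..k. r ^ i) / (1 - r)))"
  proof -
    have "(\<Sum>i=1..k. r ^ i) \<le> r / (1 - r)"
    proof -
      have "(\<Sum>i=1..k. r ^ i) = r * (\<Sum>i<k. r ^ i)"
        by (induction k) (auto simp: algebra_simps)
      also have "(\<Sum>i<k. r ^ i) = (1 - r ^ k) / (1 - r)"
        using r by (subst geometric_sum) (auto simp: field_simps)
      also have "r * \<dots> \<le> r * (1 / (1 - r))"
        using r by (intro mult_left_mono divide_right_mono) auto
      finally show ?thesis by simp
    qed
    hence "(\<Sum>i=1..k. r ^ i) / (1 - r) \<le> r / (1 - r) / (1 - r)"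
      using r by (intro divide_right_mono) auto
    thus ?thesis by (simp add: power2_eq_square)
  qed
  also have "\<dots> = (\<Prod>i=1..k. exp (- (r ^ i / (1 - r))))"
    by (simp add: sum_divide_distrib sum_negf flip: exp_sum)
  also have "\<dots> \<le> qpoch r k"
    unfolding qpoch_def using 1 by (intro prod_mono) auto
  finally show ?thesis .
qed

lemma qpoch_le_1:
  fixes r :: real
  assumes "0 \<le> r" "r < 1"
  shows "qpoch r k \<le> 1" "qpoch r k \<ge> 0"
  unfolding qpoch_def using assms by (auto intro!: prod_le_1 prod_nonneg simp: power_le_one)

definition qpoch_const :: "real \<Rightarrow> real" where
  "qpoch_const r = exp (r / (1 - r)\<^sup>2)"

lemma qpoch_const_pos [simp]: "0 < qpoch_const r" "0 \<le> qpoch_const r"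
  by (simp_all add: qpoch_const_def)

lemma norm_inverse_qpoch_le:
  fixes q :: "'a::real_normed_field"
  assumes "norm q < 1"
  shows "norm (inverse (qpoch q k)) \<le> qpoch_const (norm q)"
proof -
  have "qpoch (norm q) k \<le> norm (qpoch q k)"
    unfolding qpoch_def prod_norm[symmetric]
  proof (rule prod_mono)
    fix i assume "i \<in> {1..k}"
    have "1 - norm q ^ i \<le> norm (1 - q ^ i)"
      using norm_triangle_ineq2[of 1 "q ^ i"] by (simp add: norm_power)
    thus "0 \<le> 1 - norm q ^ i \<and> 1 - norm q ^ i \<le> norm (1 - q ^ i)"
      using assms by (auto simp: power_le_one)
  qed
  hence "exp (- norm q / (1 - norm q)\<^sup>2) \<le> norm (qpoch q k)"
    using qpoch_lower_bound[of "norm q" k] assms by simp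
  hence "inverse (norm (qpoch q k)) \<le> inverse (exp (- norm q / (1 - norm q)\<^sup>2))"
    by (intro le_imp_inverse_le) auto
  thus ?thesis by (simp add: qpoch_const_def norm_inverse flip: exp_minus)
qed

section \<open>Euler's series and partial theta functions\<close>

definition partition_gf :: "complex \<Rightarrow> complex" where
  "partition_gf q = (\<Sum>k. q ^ k * inverse (qpoch q k))"

lemma summable_norm_euler:
  fixes q :: complex
  assumes q: "norm q < 1"
  shows "summable (\<lambda>k. norm (q ^ (Suc r * k) * inverse (qpoch q k)))"
proof (rule summable_comparison_test')
  show "summable (\<lambda>k. qpoch_const (norm q) * norm q ^ k)"
    using q by (intro summable_mult summable_geometric) simp
  fix k :: nat
  have "norm q ^ (Suc r * k) \<le> norm q ^ k" using q by (intro power_decreasing) auto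
  hence "norm q ^ (Suc r * k) * norm (inverse (qpoch q k)) \<le> norm q ^ k * qpoch_const (norm q)"
    by (intro mult_mono norm_inverse_qpoch_le q) auto
  thus "norm (norm (q ^ (Suc r * k) * inverse (qpoch q k))) \<le> qpoch_const (norm q) * norm q ^ k"
    by (simp add: norm_mult norm_power mult_ac)
qed

text \<open>With G(x) the sum of x^k/(q)_k this is G(qx) = (1 - x) G(x) at x = q^(r+1): the factor 1
  - q^k lowers the index of (q)_k, and the index shift produces the factor x.\<close>

lemma euler_sum_Suc:
  fixes q :: complex
  assumes q: "norm q < 1"
  shows "(\<Sum>k. q ^ (Suc (Suc r) * k) * inverse (qpoch q k)) =
    (1 - q ^ Suc r) * (\<Sum>k. q ^ (Suc r * k) * inverse (qpoch q k))"
proof -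
  define a where "a = (\<lambda>r k. q ^ (Suc r * k) * inverse (qpoch q k))"
  have sm: "summable (a r)" for r
    unfolding a_def by (rule summable_norm_cancel, rule summable_norm_euler[OF q])
  have "suminf (a r) - suminf (a (Suc r)) = (\<Sum>k. a r k - a (Suc r) k)"
    using sm by (simp add: suminf_diff)
  also have "\<dots> = (\<Sum>k. a r (Suc k) - a (Suc r) (Suc k))"
    using suminf_split_head[OF summable_diff[OF sm[of r] sm[of "Suc r"]]] by (simp add: a_def)
  also have "(\<lambda>k. a r (Suc k) - a (Suc r) (Suc k)) = (\<lambda>k. q ^ Suc r * a r k)"
  proof
    fix k
    have "a r (Suc k) - a (Suc r) (Suc k) = q ^ (Suc r * Suc k) * ((1 - q ^ Suc k) * inverse (qpoch q (Suc k)))"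
      by (simp add: a_def algebra_simps power_add)
    also have "(1 - q ^ Suc k) * inverse (qpoch q (Suc k)) = inverse (qpoch q k)"
      using one_minus_power_nonzero[OF q, of "Suc k"]
      unfolding qpoch_Suc inverse_mult_distrib by (simp del: power_Suc)
    finally have eq: "a r (Suc k) - a (Suc r) (Suc k) = q ^ (Suc r * Suc k) * inverse (qpoch q k)" .
    have "Suc r * Suc k = Suc r + Suc r * k" by simp
    thus "a r (Suc k) - a (Suc r) (Suc k) = q ^ Suc r * a r k"
      unfolding eq by (simp only: a_def power_add mult.assoc)
  qed
  also have "(\<Sum>k. q ^ Suc r * a r k) = q ^ Suc r * suminf (a r)"
    by (rule suminf_mult[OF sm])
  finally show ?thesis by (simp add: a_def algebra_simps)
qed

lemma euler_sum:
  fixes q :: complex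
  assumes q: "norm q < 1"
  shows "(\<Sum>k. q ^ (Suc r * k) * inverse (qpoch q k)) = qpoch q r * partition_gf q"
proof (induction r)
  case (Suc r)
  thus ?case by (simp add: euler_sum_Suc[OF q] qpoch_Suc del: power_Suc mult_Suc)
qed (simp add: partition_gf_def)

text \<open>The product is Euler's series at q^(r+1), where every term but the one at k = 0 tends to
  0. This identifies \<open>partition_gf\<close>, defined by the series because it arises in that
  form, with 1/(q)_infinity, and shows that it does not vanish.\<close>

lemma qpoch_partition_gf_tendsto:
  fixes q :: complex
  assumes q: "norm q < 1"
  shows "(\<lambda>r. qpoch q r * partition_gf q) \<longlonglongrightarrow> 1"
proof -
  define a where "a = (\<lambda>r k. q ^ (Suc r * k) * inverse (qpoch q k))"
  define B where "B = qpoch_const (norm q)"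
  have sm: "summable (\<lambda>k. norm (a r k))" for r
    unfolding a_def by (rule summable_norm_euler[OF q])
  have bound: "norm (qpoch q r * partition_gf q - 1) \<le> norm q ^ r * (B * (norm q / (1 - norm q)))" for r
  proof -
    have sm': "summable (\<lambda>k. norm (a r (Suc k)))" using sm[of r] by (subst summable_Suc_iff)
    have "qpoch q r * partition_gf q - 1 = (\<Sum>k. a r (Suc k))"
      using suminf_split_head[OF summable_norm_cancel[OF sm[of r]]] euler_sum[OF q, of r] by (simp add: a_def)
    also have "norm \<dots> \<le> (\<Sum>k. norm (a r (Suc k)))" by (rule summable_norm[OF sm'])
    also have "\<dots> \<le> (\<Sum>k. norm q ^ r * (B * norm q) * norm q ^ k)"
    proof (rule suminf_le[OF _ sm'])
      show "summable (\<lambda>k. norm q ^ r * (B * norm q) * norm q ^ k)"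
        using q by (intro summable_mult summable_geometric) simp
      fix k
      have "norm (a r (Suc k)) \<le> norm q ^ (r + Suc k) * B"
        unfolding a_def norm_mult norm_power B_def
        using q by (intro mult_mono norm_inverse_qpoch_le power_decreasing) auto
      thus "norm (a r (Suc k)) \<le> norm q ^ r * (B * norm q) * norm q ^ k"
        by (simp add: power_add mult_ac)
    qed
    also have "\<dots> = norm q ^ r * (B * (norm q / (1 - norm q)))"
      using q by (subst suminf_mult) (auto simp: suminf_geometric summable_geometric)
    finally show ?thesis .
  qed
  have "(\<lambda>r. norm q ^ r * (B * (norm q / (1 - norm q)))) \<longlonglongrightarrow> 0 * (B * (norm q / (1 - norm q)))"
    using q by (intro tendsto_mult_right LIMSEQ_power_zero) simp
  hence lim: "(\<lambda>r. norm q ^ r * (B * (norm q / (1 - norm q)))) \<longlonglongrightarrow> 0"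
    by (simp only: mult_zero_left)
  have "(\<lambda>r. qpoch q r * partition_gf q - 1) \<longlonglongrightarrow> 0"
    by (rule Lim_null_comparison[OF always_eventually lim]) (intro allI bound)
  thus ?thesis by (simp add: LIM_zero_iff)
qed

lemma qpoch_add:
  "qpoch q (n + k) = qpoch q n * (\<Prod>i<k. 1 - q ^ Suc n * q ^ i)"
  by (induction k) (auto simp: qpoch_Suc mult.assoc power_add)

text \<open>The summands are the exponents of the q-binomial coefficient, of the argument q^(k+M) to
  the power r at k = r, and of q^k; together they give a pentagonal exponent.\<close>

lemma tri_sum_eq: "r * (r - 1) div 2 + (r + M) * r + r = r * (3 * r + 1) div 2 + M * r" for r :: nat
proof -
  have "even (r * (r - 1))" "even (r * (3 * r + 1))" by auto
  then obtain a b where a: "r * (r - 1) = 2 * a" and b: "r * (3 * r + 1) = 2 * b" by (elim evenE)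
  have "r * (r - 1) + 2 * ((r + M) * r + r) = r * (3 * r + 1) + 2 * (M * r)"
    by (cases r) (auto simp: algebra_simps)
  thus ?thesis unfolding a b by simp
qed

text \<open>The product is expanded by the q-binomial theorem, whose (q)_k cancels the 1/(q)_k in
  front. After the substitution k = r + k' the sum over k' is Euler's series at q^(r+1), and its
  (q)_r cancels the remaining 1/(q)_r. Absolute summability of \<open>T\<close> justifies both
  orders of summation.\<close>

lemma partial_theta_has_sum:
  fixes q :: complex
  assumes q: "norm q < 1" "q \<noteq> 0"
  shows "((\<lambda>k. q ^ k * inverse (qpoch q k) * (\<Prod>i<k. 1 - q ^ (k + M) * q ^ i)) has_sum
      (partition_gf q * (\<Sum>r. (-1) ^ r * q ^ (r * (3 * r + 1) div 2 + M * r)))) UNIV"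
proof -
  define B where "B = qpoch_const (norm q)"
  define T where "T = (\<lambda>(r, k). (-1) ^ r * q ^ (r * (r - 1) div 2 + (r + k + M) * r + (r + k)) *
      inverse (qpoch q r) * inverse (qpoch q k))"
  define c where "c = (\<lambda>r. (-1) ^ r * q ^ (r * (3 * r + 1) div 2 + M * r))"
  have gsm: "(\<lambda>k. norm q ^ k) summable_on UNIV"
    using q by (intro summable_nonneg_imp_summable_on summable_geometric) auto
  have geo: "((\<lambda>k. norm q ^ k) has_sum (1 / (1 - norm q))) UNIV"
    using q by (intro norm_summable_imp_has_sum geometric_sums) (auto simp: summable_geometric)
  have Tsum: "T summable_on UNIV \<times> UNIV"
  proof (rule Infinite_Sum.abs_summable_summable, rule Infinite_Sum.abs_summable_on_comparison_test')
    show "(\<lambda>(r, k). (B * B) * (norm q ^ r * norm q ^ k)) summable_on UNIV \<times> UNIV"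
    proof (rule summable_on_SigmaI)
      show "((\<lambda>k. case (r, k) of (r, k) \<Rightarrow> (B * B) * (norm q ^ r * norm q ^ k)) has_sum 
          (B * B) * (norm q ^ r * (1 / (1 - norm q)))) UNIV" for r :: nat
        unfolding prod.case by (intro has_sum_cmult_right geo)
      show "(\<lambda>r. B * B * (norm q ^ r * (1 / (1 - norm q)))) summable_on UNIV"
        by (intro summable_on_cmult_right summable_on_cmult_left gsm)
    qed auto
    fix x :: "nat \<times> nat" assume "x \<in> UNIV \<times> UNIV"
    obtain r k where x: "x = (r, k)" by (cases x)
    have "norm (T x) = norm q ^ (r * (r - 1) div 2 + (r + k + M) * r + (r + k)) * 
        (norm (inverse (qpoch q r)) * norm (inverse (qpoch q k)))"
      by (simp add: x T_def norm_mult norm_power mult_ac)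
    also have "\<dots> \<le> norm q ^ (r + k) * (B * B)"
      unfolding B_def using q by (intro mult_mono norm_inverse_qpoch_le power_decreasing) auto
    finally show "norm (T x) \<le> (case x of (r, k) \<Rightarrow> B * B * (norm q ^ r * norm q ^ k))"
      by (simp add: x power_add mult_ac)
  qed
  have row: "((\<lambda>k. T (r, k)) has_sum partition_gf q * c r) UNIV" for r
  proof -
    have "((\<lambda>k. q ^ (Suc r * k) * inverse (qpoch q k)) has_sum (qpoch q r * partition_gf q)) UNIV"
      using norm_summable_imp_has_sum[OF summable_norm_euler[OF q(1), of r]]
        summable_sums[OF summable_norm_cancel[OF summable_norm_euler[OF q(1), of r]]]
      by (simp only: euler_sum[OF q(1)])
    hence "((\<lambda>k. ((-1) ^ r * q ^ (r * (r - 1) div 2 + (r + M) * r + r) * inverse (qpoch q r)) * 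
        (q ^ (Suc r * k) * inverse (qpoch q k))) has_sum 
        (((-1) ^ r * q ^ (r * (r - 1) div 2 + (r + M) * r + r) * inverse (qpoch q r)) * (qpoch q r * partition_gf q))) UNIV"
      by (rule has_sum_cmult_right)
    also have "((-1) ^ r * q ^ (r * (r - 1) div 2 + (r + M) * r + r) * inverse (qpoch q r)) * (qpoch q r * partition_gf q)
       = partition_gf q * c r"
      using qpoch_nonzero[OF q(1), of r] unfolding tri_sum_eq c_def by (simp add: field_simps)
    also have "(\<lambda>k. ((-1) ^ r * q ^ (r * (r - 1) div 2 + (r + M) * r + r) * inverse (qpoch q r)) * 
        (q ^ (Suc r * k) * inverse (qpoch q k))) = (\<lambda>k. T (r, k))"
    proof
      fix k
      have e: "r * (r - 1) div 2 + (r + k + M) * r + (r + k) = (r * (r - 1) div 2 + (r + M) * r + r) + Suc r * k"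
        by (simp add: algebra_simps)
      show "((-1) ^ r * q ^ (r * (r - 1) div 2 + (r + M) * r + r) * inverse (qpoch q r)) * 
        (q ^ (Suc r * k) * inverse (qpoch q k)) = T (r, k)"
        unfolding T_def prod.case e power_add[of q _ "Suc r * k"] by (simp only: mult_ac)
    qed
    finally show ?thesis .
  qed
  have csum: "summable c"
  proof (rule summable_norm_cancel, rule summable_comparison_test')
    show "summable (\<lambda>k. norm q ^ k)" using q by (intro summable_geometric) simp
    fix k :: nat
    have "k \<le> k * (3 * k + 1) div 2 + M * k" 
      using tri_sum_eq[of k M] by linarith
    thus "norm (norm (c k)) \<le> norm q ^ k"
      unfolding c_def using q by (auto simp: norm_mult norm_power intro!: power_decreasing)
  qed
  obtain S where S: "(T has_sum S) (UNIV \<times> UNIV)" using Tsum by (auto simp: summable_on_def)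
  have "((\<lambda>r. partition_gf q * c r) has_sum S) UNIV"
    by (rule has_sum_SigmaD[OF S]) (rule row)
  hence "(\<lambda>r. partition_gf q * c r) sums S" by (rule has_sum_imp_sums)
  moreover have "(\<lambda>r. partition_gf q * c r) sums (partition_gf q * suminf c)"
    using csum by (intro sums_mult summable_sums)
  ultimately have S': "S = partition_gf q * suminf c" by (rule sums_unique2)
  \<comment> \<open>The rows of \<open>T\<close> have been summed; the same pairs are now regrouped
    along k = r + k', on the finite sets r <= k.\<close>
  have "bij_betw (\<lambda>(k, r). (r, k - r)) (SIGMA k:UNIV. {..k}) (UNIV \<times> (UNIV :: nat set))"
    by (rule bij_betwI[of _ _ _ "\<lambda>(r, k). (r + k, r)"]) auto
  from has_sum_reindex_bij_betw[OF this, of T S] S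
  have S2: "((\<lambda>x. T (case x of (k, r) \<Rightarrow> (r, k - r))) has_sum S) (SIGMA k:UNIV. {..k})"
    by simp
  have "((\<lambda>k. q ^ k * inverse (qpoch q k) * (\<Prod>i<k. 1 - q ^ (k + M) * q ^ i)) has_sum S) UNIV"
  proof (rule has_sum_SigmaD[OF S2])
    fix k :: nat
    have "(\<Sum>r\<le>k. T (r, k - r)) = q ^ k * inverse (qpoch q k) * (\<Prod>i<k. 1 - q ^ (k + M) * q ^ i)"
      unfolding qbinomial_theorem[OF q] sum_distrib_left
    proof (rule sum.cong[OF refl])
      fix r assume "r \<in> {..k}"
      hence rk: "r \<le> k" by simp
      have i: "inv_qpoch q (int k - int r) = inverse (qpoch q (k - r))"
        using rk by (simp add: inv_qpoch_def flip: of_nat_diff)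
      have e: "r + (k - r) = k" using rk by simp
      show "T (r, k - r) = q ^ k * inverse (qpoch q k) * 
         ((-1) ^ r * q ^ (r * (r - 1) div 2) * qpoch q k * inverse (qpoch q r) * inv_qpoch q (int k - int r) * (q ^ (k + M)) ^ r)"
        (is "_ = ?R")
      proof -
        have p: "(q ^ (k + M)) ^ r = q ^ ((k + M) * r)" by (simp only: power_mult)
        have c: "inverse (qpoch q k) * qpoch q k = 1" using qpoch_nonzero[OF q(1), of k] by simp
        have "?R = (inverse (qpoch q k) * qpoch q k) * T (r, k - r)"
          unfolding T_def prod.case e i p unfolding power_add by (simp only: mult_ac)
        thus ?thesis unfolding c by simp
      qed
    qed
    thus "((\<lambda>r. T (case (k, r) of (k, r) \<Rightarrow> (r, k - r))) has_sum
        (q ^ k * inverse (qpoch q k) * (\<Prod>i<k. 1 - q ^ (k + M) * q ^ i))) {..k}"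
      by (intro has_sum_finiteI) auto
  qed
  thus ?thesis unfolding S' c_def .
qed

section \<open>The rank generating function\<close>

text \<open>The first summand is s(s+1)/2 + (s+1), from the power of q in \<open>side_closed\<close>
  at m = s and from the smallest possible peak s + 1; the other two are the exponent in
  \<open>partial_theta_has_sum\<close> with M = 2s + 2.\<close>

definition theta_exp :: "nat \<Rightarrow> nat \<Rightarrow> nat" where
  "theta_exp s j = (s + 1) * (s + 2) div 2 + j * (3 * j + 1) div 2 + 2 * (s + 1) * j"

definition partial_theta :: "complex \<Rightarrow> nat \<Rightarrow> complex" where
  "partial_theta q s = (\<Sum>j. (-1) ^ j * q ^ theta_exp s j)"

text \<open>The peak is N + 1, so that the entries on either side form subsets of {1..N}.\<close>

definition rank_gf :: "complex \<Rightarrow> int \<Rightarrow> complex" where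
  "rank_gf q m = (\<Sum>N. q ^ Suc N * side_sum q N m)"

lemma side_sum_nonneg:
  fixes r :: real
  assumes "0 \<le> r"
  shows "side_sum r N m \<ge> 0"
  unfolding side_sum_def using assms by (intro sum_nonneg) auto

lemma norm_side_sum_le:
  fixes q :: "'a::{real_normed_field}"
  shows "norm (side_sum q N m) \<le> side_sum (norm q) N m"
  unfolding side_sum_def
  by (intro sum_norm_le) (auto simp: norm_power)

text \<open>For positive r a coefficient is at most the sum of two neighbouring ones, and that sum
  has a closed form. The bound depends on neither N nor m, which gives summability over the
  peak.\<close>

lemma side_sum_bound:
  fixes r :: real
  assumes r: "0 < r" "r < 1"
  shows "side_sum r N m \<le> qpoch_const r ^ 2"
proof -
  have r': "norm r < 1" "r \<noteq> 0" using r by auto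
  have inv: "0 \<le> inv_qpoch r k" "inv_qpoch r k \<le> qpoch_const r" for k
    using norm_inverse_qpoch_le[of r "nat k"] r qpoch_le_1(2)[of r "nat k"]
    by (auto simp: inv_qpoch_def)
  have "side_sum r N m \<le> side_sum r N m + side_sum r N (m + 1)"
    using side_sum_nonneg[of r N "m + 1"] r by simp
  also have "\<dots> = side_closed r N m" by (rule side_sum_add_closed[OF r'])
  also have "\<dots> = (inv_qpoch r (int N - m) * inv_qpoch r (int N + m + 1)) *
      (qpoch r (2 * N + 1) * r powi (m * (m + 1) div 2))"
    by (simp add: side_closed_def mult_ac)
  also have "\<dots> \<le> (qpoch_const r * qpoch_const r) * (1 * 1)"
  proof (intro mult_mono inv)
    have "0 \<le> m * (m + 1)" by (cases "m \<ge> 0") (auto simp: mult_nonpos_nonpos)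
    hence "r powi (m * (m + 1) div 2) = r ^ nat (m * (m + 1) div 2)"
      by (simp add: power_int_def)
    thus "r powi (m * (m + 1) div 2) \<le> 1" using r by (simp add: power_le_one)
  qed (use qpoch_le_1[of r] r inv in \<open>auto simp: qpoch_const_def\<close>)
  finally show ?thesis by (simp add: power2_eq_square)
qed

lemma norm_rank_gf_term_le:
  fixes q :: complex
  assumes q: "norm q < 1" "q \<noteq> 0"
  shows "norm (q ^ Suc N * side_sum q N m) \<le>
     norm q ^ Suc N * (qpoch_const (norm q) ^ 2)"
proof -
  have "norm (side_sum q N m) \<le> qpoch_const (norm q) ^ 2"
    using norm_side_sum_le[of q N m] side_sum_bound[of "norm q" N m] q by simp
  thus ?thesis unfolding norm_mult norm_power by (intro mult_left_mono) auto
qed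

lemma summable_norm_rank_gf:
  fixes q :: complex
  assumes q: "norm q < 1" "q \<noteq> 0"
  shows "summable (\<lambda>N. norm (q ^ Suc N * side_sum q N m))"
proof (rule summable_comparison_test')
  show "summable (\<lambda>N. norm q ^ Suc N * (qpoch_const (norm q) ^ 2))"
    using q by (intro summable_mult2) (simp add: summable_Suc_iff[of "\<lambda>n. norm q ^ n"] summable_geometric del: power_Suc)
qed (use norm_rank_gf_term_le[OF q] in simp)

lemma theta_exp_eq: "Suc s * s div 2 + Suc s + (j * (3 * j + 1) div 2 + (2 * s + 2) * j) = theta_exp s j"
proof -
  have "even (Suc s * s)" by simp
  then obtain a where a: "Suc s * s = 2 * a" by (elim evenE)
  have "(s + 1) * (s + 2) = 2 * (a + Suc s)" using a by (simp add: algebra_simps)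
  thus ?thesis unfolding theta_exp_def a by (simp add: algebra_simps)
qed

lemma theta_exp_ge: "s + j + 1 \<le> theta_exp s j"
proof -
  have "j \<le> (2 * s + 2) * j" by simp
  moreover have "Suc s * s div 2 + Suc s + (j * (3 * j + 1) div 2 + (2 * s + 2) * j) = theta_exp s j"
    by (rule theta_exp_eq)
  ultimately show ?thesis by linarith
qed

lemma summable_norm_partial_theta:
  fixes q :: complex
  assumes q: "norm q < 1"
  shows "summable (\<lambda>j. norm ((-1) ^ j * q ^ theta_exp s j))"
proof (rule summable_comparison_test')
  show "summable (\<lambda>k. norm q ^ k)" using q by (intro summable_geometric) simp
  fix j :: nat
  have "norm q ^ theta_exp s j \<le> norm q ^ j"
    using q theta_exp_ge[of s j] by (intro power_decreasing) auto
  thus "norm (norm ((-1) ^ j * q ^ theta_exp s j)) \<le> norm q ^ j"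
    by (simp add: norm_mult norm_power)
qed

text \<open>The closed form is summed over the peak. It vanishes for N < s, and for N = k + s the
  quotient (q)_(2k+2s+1)/(q)_(k+2s+1) is a product of k factors starting with 1 - q^(k+2s+2), so
  \<open>partial_theta_has_sum\<close> applies with M = 2s + 2.\<close>

lemma rank_gf_add:
  fixes q :: complex
  assumes q: "norm q < 1" "q \<noteq> 0"
  shows "rank_gf q (int s) + rank_gf q (int (Suc s)) = partition_gf q * partial_theta q s"
proof -
  note sm = summable_norm_cancel[OF summable_norm_rank_gf[OF q]]
  define c where "c = (\<lambda>N. q ^ Suc N * side_closed q N (int s))"
  have c_eq: "c N = q ^ Suc N * side_sum q N (int s) + q ^ Suc N * side_sum q N (int (Suc s))" for N
    using side_sum_add_closed[OF q, of N "int s"] by (simp add: c_def algebra_simps flip: distrib_left)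
  have smc: "summable c" unfolding c_eq[abs_def] by (intro summable_add sm)
  have "rank_gf q (int s) + rank_gf q (int (Suc s)) = suminf c"
    unfolding rank_gf_def c_eq[abs_def] by (rule suminf_add[OF sm sm])
  also have "\<dots> = (\<Sum>k. c (k + s)) + (\<Sum>N<s. c N)"
    using suminf_split_initial_segment[OF smc, of s] by simp
  also have "(\<Sum>N<s. c N) = 0"
    by (intro sum.neutral) (auto simp: c_def side_closed_def inv_qpoch_def)
  also have "(\<lambda>k. c (k + s)) = (\<lambda>k. q ^ (Suc s * s div 2 + Suc s) * 
     (q ^ k * inverse (qpoch q k) * (\<Prod>i<k. 1 - q ^ (k + (2 * s + 2)) * q ^ i)))"
  proof
    fix k
    have e1: "int (k + s) - int s = int k" "int (k + s) + int s + 1 = int (k + (2 * s + 1))"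
      "2 * (k + s) + 1 = (k + (2 * s + 1)) + k" by auto
    have e2: "int s * (int s + 1) div 2 = int (Suc s * s div 2)"
    proof -
      have "int s * (int s + 1) = int (Suc s * s)" by (simp add: algebra_simps)
      thus ?thesis by (simp only: of_nat_div of_nat_numeral)
    qed
    have e3: "Suc (k + (2 * s + 1)) = k + (2 * s + 2)" by simp
    have i: "inv_qpoch q (int n) = inverse (qpoch q n)" for n by (simp add: inv_qpoch_def)
    have "c (k + s) = q ^ Suc (k + s) * ((qpoch q (k + (2 * s + 1)) * (\<Prod>i<k. 1 - q ^ (k + (2 * s + 2)) * q ^ i))
        * inverse (qpoch q k) * inverse (qpoch q (k + (2 * s + 1))) * q ^ (Suc s * s div 2))"
      unfolding c_def side_closed_def e1 e2 i power_int_of_nat qpoch_add[of q "k + (2 * s + 1)" k] e3 ..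
    also have "\<dots> = q ^ Suc (k + s) * q ^ (Suc s * s div 2) * inverse (qpoch q k) * (\<Prod>i<k. 1 - q ^ (k + (2 * s + 2)) * q ^ i)"
      using qpoch_nonzero[OF q(1), of "k + (2 * s + 1)"] by simp
    also have "q ^ Suc (k + s) * q ^ (Suc s * s div 2) = q ^ (Suc s * s div 2 + Suc s) * q ^ k"
      by (simp add: power_add mult_ac)
    finally show "c (k + s) = q ^ (Suc s * s div 2 + Suc s) * 
     (q ^ k * inverse (qpoch q k) * (\<Prod>i<k. 1 - q ^ (k + (2 * s + 2)) * q ^ i))"
      by (simp only: mult.assoc)
  qed
  also have "(\<Sum>k. q ^ (Suc s * s div 2 + Suc s) * 
     (q ^ k * inverse (qpoch q k) * (\<Prod>i<k. 1 - q ^ (k + (2 * s + 2)) * q ^ i))) = 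
     q ^ (Suc s * s div 2 + Suc s) * (partition_gf q * (\<Sum>r. (-1) ^ r * q ^ (r * (3 * r + 1) div 2 + (2 * s + 2) * r)))"
    by (rule sums_unique[symmetric], rule sums_mult, rule has_sum_imp_sums, rule partial_theta_has_sum[OF q])
  also have "\<dots> = partition_gf q * (q ^ (Suc s * s div 2 + Suc s) * (\<Sum>r. (-1) ^ r * q ^ (r * (3 * r + 1) div 2 + (2 * s + 2) * r)))"
    by (simp only: mult_ac)
  also have "q ^ (Suc s * s div 2 + Suc s) * (\<Sum>r. (-1) ^ r * q ^ (r * (3 * r + 1) div 2 + (2 * s + 2) * r)) = partial_theta q s"
  proof -
    have eq: "q ^ (Suc s * s div 2 + Suc s) * ((-1) ^ r * q ^ (r * (3 * r + 1) div 2 + (2 * s + 2) * r)) = (-1) ^ r * q ^ theta_exp s r" for r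
      unfolding theta_exp_eq[of s r, symmetric] by (simp add: power_add mult_ac)
    have "summable (\<lambda>r. q ^ (Suc s * s div 2 + Suc s) * ((-1) ^ r * q ^ (r * (3 * r + 1) div 2 + (2 * s + 2) * r)))"
      unfolding eq by (rule summable_norm_cancel[OF summable_norm_partial_theta[OF q(1)]])
    hence "summable (\<lambda>r. (-1) ^ r * q ^ (r * (3 * r + 1) div 2 + (2 * s + 2) * r))"
      by (rule summable_mult_D) (use q in simp)
    hence "q ^ (Suc s * s div 2 + Suc s) * (\<Sum>r. (-1) ^ r * q ^ (r * (3 * r + 1) div 2 + (2 * s + 2) * r)) = 
       (\<Sum>r. q ^ (Suc s * s div 2 + Suc s) * ((-1) ^ r * q ^ (r * (3 * r + 1) div 2 + (2 * s + 2) * r)))"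
      by (rule suminf_mult[symmetric])
    also have "\<dots> = partial_theta q s" unfolding eq partial_theta_def ..
    finally show ?thesis .
  qed
  finally show ?thesis by simp
qed

text \<open>Rank s needs at least s entries to the right of the peak, so the sum starts at N = s and
  carries a factor |q|^s. This closes the telescoping sum in \<open>rank_gf_eq\<close>.\<close>

lemma rank_gf_tendsto_0:
  fixes q :: complex
  assumes q: "norm q < 1" "q \<noteq> 0"
  shows "(\<lambda>s. rank_gf q (int s)) \<longlonglongrightarrow> 0"
proof -
  define D where "D = qpoch_const (norm q) ^ 2"
  note smn = summable_norm_rank_gf[OF q]
  have bound: "norm (rank_gf q (int s)) \<le> norm q ^ s * (norm q * D / (1 - norm q))" for s
  proof -
    have z: "side_sum q N (int s) = 0" if "N < s" for N
      unfolding side_sum_def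
    proof (intro sum.neutral ballI)
      fix A B assume "A \<in> Pow {1..N}" "B \<in> Pow {1..N}"
      hence "card B \<le> N" using card_mono[of "{1..N}" B] by auto
      thus "(if int (card B) - int (card A) = int s then q ^ (\<Sum> A + \<Sum> B) else 0) = 0"
        using that by auto
    qed
    define f where "f = (\<lambda>N. q ^ Suc N * side_sum q N (int s))"
    have "rank_gf q (int s) = (\<Sum>k. f (k + s)) + (\<Sum>N<s. f N)"
      unfolding rank_gf_def f_def using suminf_split_initial_segment[OF summable_norm_cancel[OF smn], of s] by simp
    also have "(\<Sum>N<s. f N) = 0" by (intro sum.neutral) (auto simp: f_def z)
    finally have "norm (rank_gf q (int s)) = norm (\<Sum>k. f (k + s))" by simp
    also have "\<dots> \<le> (\<Sum>k. norm (f (k + s)))"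
      unfolding f_def by (rule summable_norm, subst summable_iff_shift) (rule smn)
    also have "\<dots> \<le> (\<Sum>k. norm q ^ s * (norm q * D) * norm q ^ k)"
    proof (rule suminf_le)
      show "norm (f (k + s)) \<le> norm q ^ s * (norm q * D) * norm q ^ k" for k
        using norm_rank_gf_term_le[OF q, of "k + s" "int s"] by (simp add: f_def D_def power_add mult_ac)
      show "summable (\<lambda>k. norm (f (k + s)))"
        unfolding f_def by (subst summable_iff_shift) (rule smn)
      show "summable (\<lambda>k. norm q ^ s * (norm q * D) * norm q ^ k)"
        using q by (intro summable_mult summable_geometric) simp
    qed
    also have "\<dots> = norm q ^ s * (norm q * D / (1 - norm q))"
      using q by (subst suminf_mult) (auto simp: suminf_geometric summable_geometric)
    finally show ?thesis .
  qed
  have "(\<lambda>s. norm q ^ s * (norm q * D / (1 - norm q))) \<longlonglongrightarrow> 0 * (norm q * D / (1 - norm q))"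
    using q by (intro tendsto_mult_right LIMSEQ_power_zero) simp
  hence lim: "(\<lambda>s. norm q ^ s * (norm q * D / (1 - norm q))) \<longlonglongrightarrow> 0"
    by (simp only: mult_zero_left)
  show ?thesis by (rule Lim_null_comparison[OF always_eventually lim]) (intro allI bound)
qed

definition false_theta :: "complex \<Rightarrow> nat \<Rightarrow> complex" where
  "false_theta q m = (\<Sum>s. (-1) ^ s * partial_theta q (m + s))"

text \<open>Only sums of neighbouring generating functions are known; their alternating sum
  telescopes to the one at m, with a last term that tends to 0.\<close>

lemma rank_gf_eq:
  fixes q :: complex
  assumes q: "norm q < 1" "q \<noteq> 0"
  shows "(\<lambda>s. partition_gf q * ((-1) ^ s * partial_theta q (m + s))) sums rank_gf q (int m)"
proof -
  have tel: "(\<Sum>s<S. partition_gf q * ((-1) ^ s * partial_theta q (m + s))) = 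
      rank_gf q (int m) - (-1) ^ S * rank_gf q (int (m + S))" for S
  proof (induction S)
    case (Suc S)
    have "partition_gf q * ((-1) ^ S * partial_theta q (m + S)) = (-1) ^ S * (rank_gf q (int (m + S)) + rank_gf q (int (Suc (m + S))))"
      unfolding rank_gf_add[OF q] by (simp only: mult_ac)
    thus ?case unfolding sum.lessThan_Suc Suc.IH by (simp add: algebra_simps)
  qed simp
  have "(\<lambda>S. rank_gf q (int (m + S))) \<longlonglongrightarrow> 0"
    using LIMSEQ_ignore_initial_segment[OF rank_gf_tendsto_0[OF q], of m] by (simp add: add_ac)
  hence "(\<lambda>S. (-1) ^ S * rank_gf q (int (m + S))) \<longlonglongrightarrow> 0"
    by (subst tendsto_norm_zero_iff[symmetric]) (simp add: norm_mult norm_power tendsto_norm_zero_iff)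
  hence "(\<lambda>S. rank_gf q (int m) - (-1) ^ S * rank_gf q (int (m + S))) \<longlonglongrightarrow> rank_gf q (int m) - 0"
    by (intro tendsto_diff tendsto_const)
  thus ?thesis unfolding sums_def tel by simp
qed

lemma partition_gf_nonzero:
  fixes q :: complex
  assumes q: "norm q < 1"
  shows "partition_gf q \<noteq> 0"
  using qpoch_partition_gf_tendsto[OF q] LIMSEQ_unique[OF tendsto_const, of 0 "1::complex"] by auto

theorem rank_gf_eq_false_theta:
  fixes q :: complex
  assumes q: "norm q < 1" "q \<noteq> 0"
  shows "rank_gf q (int m) = partition_gf q * false_theta q m"
    and "summable (\<lambda>s. (-1) ^ s * partial_theta q (m + s))"
proof -
  show sm: "summable (\<lambda>s. (-1) ^ s * partial_theta q (m + s))"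
    using summable_mult_D[OF sums_summable[OF rank_gf_eq[OF q]] partition_gf_nonzero[OF q(1)]] .
  show "rank_gf q (int m) = partition_gf q * false_theta q m"
    unfolding false_theta_def suminf_mult[OF sm, symmetric] by (rule sums_unique[OF rank_gf_eq[OF q]])
qed

text \<open>The triples (N, A, B) are summed in two ways: by N, which gives \<open>rank_gf\<close>,
  and by total size, which gives the counts. Absolute summability comes from the first grouping
  carried out at the real number |q|.\<close>

theorem u_has_sum:
  fixes q :: complex
  assumes q: "norm q < 1" "q \<noteq> 0"
  shows "((\<lambda>n. of_nat (u m n) * q ^ n) has_sum rank_gf q m) UNIV"
proof -
  define pairs where "pairs = (\<lambda>N :: nat. {(A, B). A \<subseteq> {1..N} \<and> B \<subseteq> {1..N} \<and> int (card B) - int (card A) = m})"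
  define f where "f = (\<lambda>q :: complex. \<lambda>(N :: nat, A, B). q ^ (Suc N + (\<Sum>A + \<Sum>B)))"
  have finpairs: "finite (pairs N)" for N
    by (rule finite_subset[of _ "Pow {1..N} \<times> Pow {1..N}"]) (auto simp: pairs_def)
  \<comment> \<open>Stated for an arbitrary commutative ring, since it is applied both to q and to
    its norm.\<close>
  have inner: "(\<Sum>x\<in>pairs N. q ^ (Suc N + (\<Sum>(fst x) + \<Sum>(snd x)))) = q ^ Suc N * side_sum q N m" 
    for N and q :: "'b::comm_ring_1"
  proof -
    have pe: "pairs N = {x \<in> Pow {1..N} \<times> Pow {1..N}. int (card (snd x)) - int (card (fst x)) = m}"
      by (auto simp: pairs_def)
    have "side_sum q N m = (\<Sum>x\<in>Pow {1..N} \<times> Pow {1..N}. 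
       if int (card (snd x)) - int (card (fst x)) = m then q ^ (\<Sum>(fst x) + \<Sum>(snd x)) else 0)"
      unfolding side_sum_def sum.cartesian_product by (simp add: case_prod_unfold)
    also have "\<dots> = (\<Sum>x\<in>pairs N. q ^ (\<Sum>(fst x) + \<Sum>(snd x)))"
      unfolding pe by (subst sum.inter_filter) simp_all
    finally show ?thesis by (simp only: sum_distrib_left power_add)
  qed
  have row: "((\<lambda>x. f q (N, x)) has_sum (q ^ Suc N * side_sum q N m)) (pairs N)" for N
    unfolding f_def using inner[of q N] finpairs[of N]
    by (intro has_sum_finiteI) (auto simp: case_prod_unfold)
  have rown: "((\<lambda>x. norm (f q (N, x))) has_sum (norm q ^ Suc N * side_sum (norm q) N m)) (pairs N)" for N
    unfolding f_def using inner[of "norm q" N] finpairs[of N]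
    by (intro has_sum_finiteI) (auto simp: case_prod_unfold norm_power norm_mult)
  have "(\<lambda>N. norm q ^ Suc N * side_sum (norm q) N m) summable_on UNIV"
  proof (rule summable_nonneg_imp_summable_on)
    have r: "0 < norm q" "norm q < 1" using q by auto
    show "summable (\<lambda>N. norm q ^ Suc N * side_sum (norm q) N m)"
    proof (rule summable_comparison_test')
      show "summable (\<lambda>N. norm q ^ Suc N * (qpoch_const (norm q) ^ 2))"
        using q by (intro summable_mult2) (simp add: summable_Suc_iff[of "\<lambda>n. norm q ^ n"] summable_geometric del: power_Suc)
      fix N :: nat
      show "norm (norm q ^ Suc N * side_sum (norm q) N m) \<le> norm q ^ Suc N * (qpoch_const (norm q) ^ 2)"
        using side_sum_bound[OF r, of N m] side_sum_nonneg[of "norm q" N m]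
        by (auto simp: abs_mult abs_of_nonneg intro!: mult_left_mono)
    qed
  qed (use side_sum_nonneg[of "norm q"] in auto)
  hence "(\<lambda>x. norm (f q x)) summable_on Sigma UNIV pairs"
    by (intro summable_on_SigmaI[where g = "\<lambda>N. norm q ^ Suc N * side_sum (norm q) N m"] rown) auto
  hence "f q summable_on Sigma UNIV pairs" by (rule Infinite_Sum.abs_summable_summable)
  then obtain S where S: "(f q has_sum S) (Sigma UNIV pairs)" by (auto simp: summable_on_def)
  have "((\<lambda>N. q ^ Suc N * side_sum q N m) has_sum S) UNIV"
    by (rule has_sum_SigmaD[OF S row])
  hence "(\<lambda>N. q ^ Suc N * side_sum q N m) sums S" by (rule has_sum_imp_sums)
  hence S': "S = rank_gf q m" unfolding rank_gf_def by (rule sums_unique)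
  have iv: "{Suc 0..<p} = {Suc 0..p - Suc 0}" for p by (cases p) auto
  have "bij_betw (\<lambda>(n, p, A, B). (p - 1, A, B)) (SIGMA n:UNIV. peak_triples m n) (Sigma UNIV pairs)"
    by (rule bij_betw_byWitness[where f' = "\<lambda>(N, A, B). (\<Sum>A + \<Sum>B + Suc N, Suc N, A, B)"])
       (auto simp: peak_triples_def pairs_def iv)
  from has_sum_reindex_bij_betw[OF this, of "f q" S] S
  have S2: "((\<lambda>x. f q (case x of (n, p, A, B) \<Rightarrow> (p - 1, A, B))) has_sum S) (SIGMA n:UNIV. peak_triples m n)"
    by simp
  have "((\<lambda>n. of_nat (u m n) * q ^ n) has_sum S) UNIV"
  proof (rule has_sum_SigmaD[OF S2])
    fix n
    have "(\<Sum>x\<in>peak_triples m n. f q (case x of (p, A, B) \<Rightarrow> (p - 1, A, B))) = (\<Sum>x\<in>peak_triples m n. q ^ n)"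
    proof (intro sum.cong[OF refl], clarify)
      fix p A B assume "(p, A, B) \<in> peak_triples m n"
      hence "Suc (p - 1) + (\<Sum>A + \<Sum>B) = n" by (auto simp: peak_triples_def)
      thus "f q (p - 1, A, B) = q ^ n" unfolding f_def prod.case by (simp only:)
    qed
    also have "\<dots> = of_nat (u m n) * q ^ n" by (simp add: u_eq_card_triples)
    finally show "((\<lambda>y. f q (case (n, y) of (n, p, A, B) \<Rightarrow> (p - 1, A, B))) has_sum of_nat (u m n) * q ^ n) (peak_triples m n)"
      by (intro has_sum_finiteI finite_peak_triples) simp
  qed
  thus ?thesis unfolding S' .
qed

section \<open>The false theta series near 1\<close>

text \<open>This is (1 - E)^5 for the shift operator E. The argument type is general because both
  sequences and entire functions are differenced.\<close>

definition fwd_diff5 :: "('a::comm_semiring_1 \<Rightarrow> 'b::real_normed_field) \<Rightarrow> 'a \<Rightarrow> 'b" where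
  "fwd_diff5 f x = f x - 5 * f (x + 1) + 10 * f (x + 2) - 10 * f (x + 3) + 5 * f (x + 4) - f (x + 5)"

text \<open>The coefficients of \<open>\<Sum>k<5. (1 - E)\<^sup>k / 2\<^bsup>k+1\<^esup>\<close>, where \<open>E\<close> is the shift operator: a truncated Euler
  transform, that is, the geometric series for \<open>1/(1 + E)\<close>.\<close>
definition euler_weight :: "nat \<Rightarrow> 'b::real_normed_field" where
  "euler_weight a = (if a = 0 then 31 / 32 else if a = 1 then - 26 / 32 else if a = 2 then 16 / 32
     else if a = 3 then - 6 / 32 else if a = 4 then 1 / 32 else 0)"

lemma sum_less_5: "(\<Sum>a<5. f a) = f 0 + f 1 + f 2 + f 3 + f 4" for f :: "nat \<Rightarrow> 'a::comm_monoid_add"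
  by (simp add: eval_nat_numeral ac_simps)

text \<open>From 1/(1 + E) = (sum over k < 5 of (1 - E)^k / 2^(k+1)) + (1 - E)^5 / (32 (1 + E)). The
  identity is exact: five initial values and an alternating sum of fifth differences.\<close>

lemma alternating_suminf_fwd_diff5:
  fixes f :: "nat \<Rightarrow> complex"
  assumes sm: "summable (\<lambda>n. norm (f n))"
  shows "(\<Sum>n. (-1) ^ n * f n) = (\<Sum>a<5. euler_weight a * f a) + (\<Sum>n. (-1) ^ n * fwd_diff5 f n) / 32"
proof -
  have s: "summable (\<lambda>n. (-1) ^ n * f (n + k))" for k
  proof (rule summable_norm_cancel)
    have "summable (\<lambda>n. norm (f (n + k)))" by (subst summable_iff_shift[of "\<lambda>n. norm (f n)"]) (rule sm)
    thus "summable (\<lambda>n. norm ((-1) ^ n * f (n + k)))" by (simp add: norm_mult norm_power)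
  qed
  define A where "A = (\<lambda>k. \<Sum>n. (-1) ^ n * f (n + k))"
  have step: "A (Suc k) = f k - A k" for k
  proof -
    have "A k = f k + (\<Sum>n. (-1) ^ Suc n * f (Suc n + k))"
      unfolding A_def using suminf_split_head[OF s[of k]] by simp
    also have "(\<lambda>n. (-1) ^ Suc n * f (Suc n + k)) = (\<lambda>n. - ((-1) ^ n * f (n + Suc k)))"
      by simp
    also have "(\<Sum>n. - ((-1) ^ n * f (n + Suc k))) = - A (Suc k)"
      unfolding A_def by (rule suminf_minus[OF s])
    finally show ?thesis by simp
  qed
  have "(\<Sum>n. (-1) ^ n * fwd_diff5 f n) = (\<Sum>n. (-1) ^ n * f (n + 0) - 5 * ((-1) ^ n * f (n + 1)) + 10 * ((-1) ^ n * f (n + 2))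
      - 10 * ((-1) ^ n * f (n + 3)) + 5 * ((-1) ^ n * f (n + 4)) - (-1) ^ n * f (n + 5))"
    by (simp add: fwd_diff5_def algebra_simps)
  also have "\<dots> = A 0 - 5 * A 1 + 10 * A 2 - 10 * A 3 + 5 * A 4 - A 5"
    unfolding A_def
    by (intro sums_unique[symmetric] sums_add sums_diff sums_mult summable_sums s)
  also have "\<dots> = 32 * A 0 - 31 * f 0 + 26 * f 1 - 16 * f 2 + 6 * f 3 - f 4"
    using step[of 0] step[of 1] step[of 2] step[of 3] step[of 4] by (simp add: eval_nat_numeral)
  finally have D: "(\<Sum>n. (-1) ^ n * fwd_diff5 f n) = 32 * A 0 - 31 * f 0 + 26 * f 1 - 16 * f 2 + 6 * f 3 - f 4" .
  show ?thesis unfolding sum_less_5 D by (simp add: euler_weight_def A_def field_simps)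
qed

text \<open>Half of the radius loss 2 \<delta> pays for Cauchy's estimate of the derivative on discs
  of radius \<delta>, the other half for the move from z to z + 1, whence \<delta> >= 1.\<close>

lemma norm_diff_le_cauchy:
  fixes F :: "complex \<Rightarrow> complex"
  assumes hol: "F holomorphic_on UNIV" and bound: "\<And>z. z \<in> cball a R \<Longrightarrow> norm (F z) \<le> B"
    and d: "\<delta> \<ge> 1" and z: "z \<in> cball a (R - 2 * \<delta>)"
  shows "norm (F z - F (z + 1)) \<le> B / \<delta>"
proof -
  define S where "S = cball a (R - \<delta>)"
  have "norm (F z - F (z + 1)) \<le> (B / \<delta>) * norm (z - (z + 1))"
  proof (rule field_differentiable_bound[of S F "deriv F"])
    show "convex S" by (simp add: S_def)
    show "z \<in> S" using z d by (simp add: S_def)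
    show "z + 1 \<in> S"
    proof -
      have "dist a (z + 1) \<le> dist a z + 1"
        using dist_triangle[of a "z + 1" z] by (simp add: dist_norm)
      thus ?thesis using z d by (simp add: S_def)
    qed
    fix w assume w: "w \<in> S"
    show "(F has_field_derivative deriv F w) (at w within S)"
      using hol by (metis UNIV_I at_within_open holomorphic_derivI open_UNIV has_field_derivative_at_within)
    have sub: "cball w \<delta> \<subseteq> cball a R"
    proof
      fix x assume "x \<in> cball w \<delta>"
      thus "x \<in> cball a R" using w dist_triangle[of a x w] by (simp add: S_def)
    qed
    have "norm ((deriv ^^ 1) F w) \<le> fact 1 * B / \<delta> ^ 1"
    proof (rule Cauchy_inequality)
      show "F holomorphic_on ball w \<delta>" using hol by (rule holomorphic_on_subset) auto
      show "continuous_on (cball w \<delta>) F"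
        using hol holomorphic_on_imp_continuous_on continuous_on_subset by blast
      fix x assume "norm (w - x) = \<delta>"
      hence "x \<in> cball w \<delta>" by (simp add: dist_norm)
      thus "norm (F x) \<le> B" using sub bound by blast
    qed (use d in auto)
    thus "norm (deriv F w) \<le> B / \<delta>" by simp
  qed
  thus ?thesis by simp
qed

text \<open>Used at the scale \<open>\<delta> = 1/\<surd>\<eta>\<close> of the Gaussian terms: each difference gains a factor \<open>\<surd>\<eta>\<close>, and five of them
  outweigh the roughly \<open>1/\<eta>\<close> relevant terms of the double series, leaving \<open>O(\<eta>\<^bsup>3/2\<^esup>)\<close>.\<close>
lemma norm_fwd_diff5_le_cauchy:
  fixes F :: "complex \<Rightarrow> complex"
  assumes hol: "F holomorphic_on UNIV" and bound: "\<And>z. z \<in> cball a (10 * \<delta>) \<Longrightarrow> norm (F z) \<le> B"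
    and d: "\<delta> \<ge> 1"
  shows "norm (fwd_diff5 F a) \<le> B / \<delta> ^ 5"
proof -
  define D where "D = (\<lambda>(G :: complex \<Rightarrow> complex) z. G z - G (z + 1))"
  have shift: "(\<lambda>z. G (z + 1)) holomorphic_on UNIV" if "G holomorphic_on UNIV" for G :: "complex \<Rightarrow> complex"
  proof -
    have "(\<lambda>z :: complex. z + 1) holomorphic_on UNIV" by (intro holomorphic_intros)
    from holomorphic_on_compose_gen[OF this that] show ?thesis by (simp add: o_def)
  qed
  have hD: "D G holomorphic_on UNIV" if "G holomorphic_on UNIV" for G
    unfolding D_def using that shift[OF that] by (intro holomorphic_intros)
  have step: "norm (D G z) \<le> C / \<delta>" 
    if "G holomorphic_on UNIV" "\<And>z. z \<in> cball a R \<Longrightarrow> norm (G z) \<le> C" "z \<in> cball a (R - 2 * \<delta>)" for G C R z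
    unfolding D_def using norm_diff_le_cauchy[OF that(1) that(2) d that(3)] by simp
  have 1: "norm (D F z) \<le> B / \<delta>" if "z \<in> cball a (8 * \<delta>)" for z
    by (rule step[OF hol bound]) (use that in auto)
  have 2: "norm (D (D F) z) \<le> B / \<delta> / \<delta>" if "z \<in> cball a (6 * \<delta>)" for z
    by (rule step[OF hD[OF hol] 1]) (use that in auto)
  have 3: "norm (D (D (D F)) z) \<le> B / \<delta> / \<delta> / \<delta>" if "z \<in> cball a (4 * \<delta>)" for z
    by (rule step[OF hD[OF hD[OF hol]] 2]) (use that in auto)
  have 4: "norm (D (D (D (D F))) z) \<le> B / \<delta> / \<delta> / \<delta> / \<delta>" if "z \<in> cball a (2 * \<delta>)" for z
    by (rule step[OF hD[OF hD[OF hD[OF hol]]] 3]) (use that in auto)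
  have 5: "norm (D (D (D (D (D F)))) a) \<le> B / \<delta> / \<delta> / \<delta> / \<delta> / \<delta>"
    by (rule step[OF hD[OF hD[OF hD[OF hD[OF hol]]]] 4]) auto
  have "D (D (D (D (D F)))) a = fwd_diff5 F a"
    by (simp add: D_def fwd_diff5_def add.assoc)
  thus ?thesis using 5 by (simp add: power_numeral_reduce)
qed

section \<open>Bounds for the terms of the double series\<close>

text \<open>The exponent \<open>theta_exp\<close> continued to complex arguments, so that
  differences in either index can be bounded by Cauchy's estimate.\<close>

definition theta_poly :: "nat \<Rightarrow> complex \<Rightarrow> complex \<Rightarrow> complex" where
  "theta_poly m z w = (z + of_nat m + 1) * (z + of_nat m + 2) / 2 + w * (3 * w + 1) / 2 + 2 * (z + of_nat m + 1) * w"

definition theta_term :: "nat \<Rightarrow> complex \<Rightarrow> complex \<Rightarrow> complex \<Rightarrow> complex" where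
  "theta_term m t z w = exp (- t * theta_poly m z w)"

lemma theta_poly_of_nat: "theta_poly m (of_nat s) (of_nat j) = of_nat (theta_exp (m + s) j)"
proof -
  have "even ((m + s + 1) * (m + s + 2))" "even (j * (3 * j + 1))" by auto
  then obtain a b where a: "(m + s + 1) * (m + s + 2) = 2 * a" and b: "j * (3 * j + 1) = 2 * b" by (elim evenE)
  have a': "(of_nat s + of_nat m + 1) * (of_nat s + of_nat m + 2) = (2 * of_nat a :: complex)"
  proof -
    have "(of_nat s + of_nat m + 1) * (of_nat s + of_nat m + 2) = (of_nat ((m + s + 1) * (m + s + 2)) :: complex)"
      by (simp only: of_nat_mult of_nat_add of_nat_1 of_nat_numeral add_ac)
    thus ?thesis unfolding a by simp
  qed
  have b': "of_nat j * (3 * of_nat j + 1) = (2 * of_nat b :: complex)"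
  proof -
    have "of_nat j * (3 * of_nat j + 1) = (of_nat (j * (3 * j + 1)) :: complex)"
      by (simp only: of_nat_mult of_nat_add of_nat_1 of_nat_numeral)
    thus ?thesis unfolding b by simp
  qed
  show ?thesis unfolding theta_poly_def theta_exp_def a b a' b' by (simp add: algebra_simps)
qed

lemma theta_term_of_nat: "theta_term m t (of_nat s) (of_nat j) = exp (- t) ^ theta_exp (m + s) j"
  unfolding theta_term_def theta_poly_of_nat by (simp add: mult.commute flip: exp_of_nat_mult)

text \<open>The shift by m, the linear terms and the mixed term only increase the exponent, so there
  is Gaussian decay in both indices, uniformly in m.\<close>

lemma theta_exp_ge_squares: "real (theta_exp (m + s) j) \<ge> (real s ^ 2 + real j ^ 2) / 2"
proof -
  have e: "of_nat (theta_exp (m + s) j) = (real s + real m + 1) * (real s + real m + 2) / 2 + real j * (3 * real j + 1) / 2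
      + 2 * (real s + real m + 1) * real j"
    using arg_cong[OF theta_poly_of_nat[of m s j, symmetric], of Re] by (simp add: theta_poly_def)
  have "real s * real s \<le> (real s + real m + 1) * (real s + real m + 2)" by (intro mult_mono) auto
  moreover have "real j * real j \<le> real j * (3 * real j + 1)" by (intro mult_left_mono) auto
  moreover have "0 \<le> 2 * (real s + real m + 1) * real j" by simp
  moreover have "a \<le> b \<Longrightarrow> c \<le> d \<Longrightarrow> 0 \<le> f \<Longrightarrow> (a + c) / 2 \<le> b / 2 + d / 2 + f"
    for a b c d f :: real
    by (simp add: field_simps)
  ultimately show ?thesis unfolding e power2_eq_square by blast
qed

text \<open>An explicit bound for the terms of the double series; only its finiteness matters.\<close>
definition theta_const :: "nat \<Rightarrow> real" where
  "theta_const m = exp (40 * real m + 4071)"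

text \<open>Completing the square: (y - 61)^2 >= 0 with y = e x, and 61^2 = 3721. Gaussian decay is
  traded for exponential decay on the scale 1/e, which a geometric series sums.\<close>

lemma gauss_le_exp:
  fixes e x :: real
  shows "- (e * x)\<^sup>2 / 2 + 60 * e * x \<le> - e * x + 3721 / 2"
proof -
  have "0 \<le> (e * x - 61)\<^sup>2" by simp
  thus ?thesis by (simp add: power2_eq_square algebra_simps)
qed

text \<open>At a lattice point the exponent decays like a Gaussian in e s and e j. A displacement
  that changes it by an amount growing only linearly in e s and e j, as \<open>err\<close> demands,
  still leaves exponential decay.\<close>

lemma norm_theta_term_le:
  fixes t z w :: complex and e :: real
  assumes e: "0 < e" "Re t = e\<^sup>2"
    and err: "norm (t * (theta_poly m z w - theta_poly m (of_nat s) (of_nat j))) \<le> 60 * e * (real s + real j) + 40 * real m + 350"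
  shows "norm (theta_term m t z w) \<le> theta_const m * exp (- e * real s) * exp (- e * real j)"
proof -
  define P where "P = theta_poly m (of_nat s) (of_nat j)"
  have "Re (- t * theta_poly m z w) = Re (- t * P) - Re (t * (theta_poly m z w - P))"
    by (simp add: algebra_simps)
  moreover have "- Re (t * (theta_poly m z w - P)) \<le> norm (t * (theta_poly m z w - P))"
    using complex_Re_le_cmod[of "- (t * (theta_poly m z w - P))"] unfolding norm_minus_cancel by simp
  moreover note err[folded P_def]
  moreover have "Re (- t * P) = - e\<^sup>2 * real (theta_exp (m + s) j)"
    unfolding P_def theta_poly_of_nat by (simp add: e)
  ultimately have "Re (- t * theta_poly m z w) \<le> - e\<^sup>2 * real (theta_exp (m + s) j) + (60 * e * (real s + real j) + 40 * real m + 350)"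
    by linarith
  also have "- e\<^sup>2 * real (theta_exp (m + s) j) \<le> - e\<^sup>2 * ((real s ^ 2 + real j ^ 2) / 2)"
    using theta_exp_ge_squares[of s j m] by (intro mult_left_mono_neg) auto
  also have "- e\<^sup>2 * ((real s ^ 2 + real j ^ 2) / 2) + (60 * e * (real s + real j) + 40 * real m + 350) =
     (- (e * real s)\<^sup>2 / 2 + 60 * e * real s) + (- (e * real j)\<^sup>2 / 2 + 60 * e * real j) + 40 * real m + 350"
    by (simp add: power2_eq_square field_simps)
  also have "\<dots> \<le> (- e * real s + 3721 / 2) + (- e * real j + 3721 / 2) + 40 * real m + 350"
    by (intro add_mono gauss_le_exp order.refl)
  finally have "norm (theta_term m t z w) \<le> exp ((- e * real s + 3721 / 2) + (- e * real j + 3721 / 2) + 40 * real m + 350)"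
    unfolding theta_term_def norm_exp_eq_Re by simp
  \<comment> \<open>The two halves of 3721 and the 350 add up to the 4071 in
    \<open>theta_const\<close>.\<close>
  also have "\<dots> = theta_const m * exp (- e * real s) * exp (- e * real j)"
    by (simp add: theta_const_def flip: exp_add)
  finally show ?thesis .
qed

lemma norm_theta_term_nat_le:
  fixes t :: complex and e :: real
  assumes e: "0 < e" "Re t = e\<^sup>2"
  shows "norm (theta_term m t (of_nat s) (of_nat j)) \<le> theta_const m * exp (- e * real s) * exp (- e * real j)"
  by (rule norm_theta_term_le[OF e]) (use e in simp)

text \<open>The exponent changes by t v k, where v is the displacement and k the slope. Since |t| is
  of order e^2, |v| of order 1/e, and k grows linearly in s + j + m + 1/e, the change stays within
  \<open>err\<close>: the factors 2 and 10 turn 3, 2, 5/2 and 15 into 60, 40, 50 and 300, and 350 =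
  50 + 300.\<close>

lemma norm_theta_term_perturb:
  fixes t z w v k :: complex and e :: real
  assumes e: "0 < e" "e \<le> 1" "Re t = e\<^sup>2" and t: "norm t \<le> 2 * e\<^sup>2"
    and vk: "theta_poly m z w - theta_poly m (of_nat s) (of_nat j) = v * k" and v: "norm v \<le> 10 / e"
    and k: "norm k \<le> 3 * (real s + real j) + 2 * real m + 5 / 2 + 15 / e"
  shows "norm (theta_term m t z w) \<le> theta_const m * exp (- e * real s) * exp (- e * real j)"
proof (rule norm_theta_term_le[OF e(1,3)])
  have "norm (t * (theta_poly m z w - theta_poly m (of_nat s) (of_nat j))) \<le>
      2 * e\<^sup>2 * ((10 / e) * (3 * (real s + real j) + 2 * real m + 5 / 2 + 15 / e))"
    unfolding vk norm_mult using t v k e by (intro mult_mono) auto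
  also have "\<dots> = 60 * e * (real s + real j) + 40 * (e * real m) + 50 * e + 300"
    using e by (simp add: field_simps power2_eq_square)
  also have "\<dots> \<le> 60 * e * (real s + real j) + 40 * real m + 350"
    using e mult_left_le_one_le[of "real m" e] by simp
  finally show "norm (t * (theta_poly m z w - theta_poly m (of_nat s) (of_nat j))) \<le> 60 * e * (real s + real j) + 40 * real m + 350" .
qed

text \<open>Cauchy's estimate with \<delta> = 1/e in each variable separately. The slopes are s + m
  + 3/2 + 2j + v/2 and 3j + 5/2 + 2s + 2m + 3v/2; one common bound covers both, its 15/e being the
  3/2 in front of v times 10/e.\<close>

lemma fwd_diff5_theta_le:
  fixes t :: complex and e :: real and m s j :: nat
  assumes e: "0 < e" "e \<le> 1" "Re t = e\<^sup>2" and t: "norm t \<le> 2 * e\<^sup>2"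
  defines "B \<equiv> theta_const m * exp (- e * real s) * exp (- e * real j)"
  shows "norm (fwd_diff5 (\<lambda>z. theta_term m t z (of_nat j)) (of_nat s)) \<le> B * e ^ 5"
    and "norm (fwd_diff5 (\<lambda>w. theta_term m t (of_nat s) w) (of_nat j)) \<le> B * e ^ 5"
proof -
  define y where "y = 1 / e"
  have d: "1 \<le> 1 / e" using e by simp
  have y: "0 \<le> y" "0 \<le> real s" "0 \<le> real j" "0 \<le> real m" "10 / e = 10 * y" "15 / e = 15 * y" using e by (simp_all add: y_def)
  have Be: "B / (1 / e) ^ 5 = B * e ^ 5" using e by (simp add: power_one_over field_simps)
  have "norm (fwd_diff5 (\<lambda>z. theta_term m t z (of_nat j)) (of_nat s)) \<le> B / (1 / e) ^ 5"
  proof (rule norm_fwd_diff5_le_cauchy[OF _ _ d])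
    show "(\<lambda>z. theta_term m t z (of_nat j)) holomorphic_on UNIV"
      unfolding theta_term_def theta_poly_def by (intro holomorphic_intros) auto
    fix z :: complex assume z: "z \<in> cball (of_nat s) (10 * (1 / e))"
    define v where "v = z - of_nat s"
    have v: "norm v \<le> 10 / e" using z by (simp add: v_def dist_norm norm_minus_commute)
    show "norm (theta_term m t z (of_nat j)) \<le> B"
      unfolding B_def
    proof (rule norm_theta_term_perturb[OF e t _ v])
      show "theta_poly m z (of_nat j) - theta_poly m (of_nat s) (of_nat j) = v * (of_nat s + of_nat m + 3 / 2 + 2 * of_nat j + v / 2)"
        unfolding theta_poly_def v_def by (simp add: field_simps)
      have "norm (of_nat s + of_nat m + 3 / 2 + 2 * of_nat j + v / 2 :: complex) \<le>
          norm (of_nat s :: complex) + norm (of_nat m :: complex) + norm (3 / 2 :: complex) + norm (2 * of_nat j :: complex) + norm (v / 2)"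
        by (intro norm_triangle_le add_mono order.refl)
      also have "\<dots> = real s + real m + 3 / 2 + 2 * real j + norm v / 2"
        by (simp add: norm_divide norm_mult)
      also have "\<dots> \<le> 3 * (real s + real j) + 2 * real m + 5 / 2 + 15 / e"
        using v y(1-4) unfolding y(5,6) by (simp add: field_simps)
      finally show "norm (of_nat s + of_nat m + 3 / 2 + 2 * of_nat j + v / 2 :: complex) \<le> 3 * (real s + real j) + 2 * real m + 5 / 2 + 15 / e" .
    qed
  qed
  thus "norm (fwd_diff5 (\<lambda>z. theta_term m t z (of_nat j)) (of_nat s)) \<le> B * e ^ 5" unfolding Be .
  have "norm (fwd_diff5 (\<lambda>w. theta_term m t (of_nat s) w) (of_nat j)) \<le> B / (1 / e) ^ 5"
  proof (rule norm_fwd_diff5_le_cauchy[OF _ _ d])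
    show "(\<lambda>w. theta_term m t (of_nat s) w) holomorphic_on UNIV"
      unfolding theta_term_def theta_poly_def by (intro holomorphic_intros) auto
    fix w :: complex assume w: "w \<in> cball (of_nat j) (10 * (1 / e))"
    define v where "v = w - of_nat j"
    have v: "norm v \<le> 10 / e" using w by (simp add: v_def dist_norm norm_minus_commute)
    show "norm (theta_term m t (of_nat s) w) \<le> B"
      unfolding B_def
    proof (rule norm_theta_term_perturb[OF e t _ v])
      show "theta_poly m (of_nat s) w - theta_poly m (of_nat s) (of_nat j) = v * (3 * of_nat j + 5 / 2 + 2 * of_nat s + 2 * of_nat m + 3 * v / 2)"
        unfolding theta_poly_def v_def by (simp add: field_simps)
      have "norm (3 * of_nat j + 5 / 2 + 2 * of_nat s + 2 * of_nat m + 3 * v / 2 :: complex) \<le>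
          norm (3 * of_nat j :: complex) + norm (5 / 2 :: complex) + norm (2 * of_nat s :: complex) + norm (2 * of_nat m :: complex) + norm (3 * v / 2)"
        by (intro norm_triangle_le add_mono order.refl)
      also have "\<dots> = 3 * real j + 5 / 2 + 2 * real s + 2 * real m + 3 * norm v / 2"
        by (simp add: norm_divide norm_mult)
      also have "\<dots> \<le> 3 * (real s + real j) + 2 * real m + 5 / 2 + 15 / e"
        using v y(1-4) unfolding y(5,6) by (simp add: field_simps)
      finally show "norm (3 * of_nat j + 5 / 2 + 2 * of_nat s + 2 * of_nat m + 3 * v / 2 :: complex) \<le> 3 * (real s + real j) + 2 * real m + 5 / 2 + 15 / e" .
    qed
  qed
  thus "norm (fwd_diff5 (\<lambda>w. theta_term m t (of_nat s) w) (of_nat j)) \<le> B * e ^ 5" unfolding Be .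
qed

lemma geometric_exp_bound:
  fixes e :: real
  assumes e: "0 < e" "e \<le> 1"
  shows "summable (\<lambda>n. exp (- e * real n))" "(\<Sum>n. exp (- e * real n)) \<le> 2 / e"
proof -
  have p: "exp (- e * real n) = exp (- e) ^ n" for n by (simp add: mult.commute flip: exp_of_nat_mult)
  have l: "norm (exp (- e)) < 1" using e by simp
  show "summable (\<lambda>n. exp (- e * real n))" unfolding p by (rule summable_geometric[OF l])
  have "exp (- e) \<le> 1 / (1 + e)"
    using exp_ge_add_one_self[of e] e by (simp add: exp_minus field_simps)
  also have "\<dots> \<le> 1 - e / 2"
  proof -
    have "1 \<le> (1 - e / 2) * (1 + e)" using e mult_left_le[of e e] by (simp add: algebra_simps)
    thus ?thesis using e by (subst pos_divide_le_eq) auto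
  qed
  finally have "e / 2 \<le> 1 - exp (- e)" by simp
  hence "1 / (1 - exp (- e)) \<le> 1 / (e / 2)" using e by (intro divide_left_mono) auto
  thus "(\<Sum>n. exp (- e * real n)) \<le> 2 / e" unfolding p suminf_geometric[OF l] by simp
qed

lemma norm_alternating_suminf_le:
  fixes f :: "nat \<Rightarrow> complex" and e B :: real
  assumes e: "0 < e" "e \<le> 1" and f: "\<And>n. norm (f n) \<le> B * exp (- e * real n)"
  shows "summable (\<lambda>n. norm (f n))" "norm (\<Sum>n. (-1) ^ n * f n) \<le> B * (2 / e)"
proof -
  have sB: "summable (\<lambda>n. B * exp (- e * real n))" by (intro summable_mult geometric_exp_bound e)
  show sm: "summable (\<lambda>n. norm (f n))"
    by (rule summable_comparison_test'[OF sB]) (use f in simp)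
  have B: "0 \<le> B" using order_trans[OF norm_ge_zero f[of 0]] by simp
  have "norm (\<Sum>n. (-1) ^ n * f n) \<le> (\<Sum>n. norm ((-1) ^ n * f n))"
    by (rule summable_norm) (use sm in \<open>simp add: norm_mult norm_power\<close>)
  also have "\<dots> = (\<Sum>n. norm (f n))" by (simp add: norm_mult norm_power)
  also have "\<dots> \<le> (\<Sum>n. B * exp (- e * real n))" by (rule suminf_le[OF f sm sB])
  also have "\<dots> = B * (\<Sum>n. exp (- e * real n))" by (rule suminf_mult[OF geometric_exp_bound(1)[OF e]])
  also have "\<dots> \<le> B * (2 / e)" by (rule mult_left_mono[OF geometric_exp_bound(2)[OF e] B])
  finally show "norm (\<Sum>n. (-1) ^ n * f n) \<le> B * (2 / e)" .
qed

lemma false_theta_eq: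
  "false_theta (exp (- t)) m = (\<Sum>s. (-1) ^ s * (\<Sum>j. (-1) ^ j * theta_term m t (of_nat s) (of_nat j)))"
  by (simp add: false_theta_def partial_theta_def theta_term_of_nat)

text \<open>Absolute values alone, hence the loss of 1/Re t, but without a restriction on Im t. The
  bound serves off the cone, where an exponentially small factor absorbs the loss.\<close>

theorem norm_false_theta_le:
  assumes t: "0 < Re t" "Re t \<le> 1"
  shows "norm (false_theta (exp (- t)) m) \<le> 4 * theta_const m / Re t"
proof -
  define e where "e = sqrt (Re t)"
  have e: "0 < e" "e \<le> 1" "Re t = e\<^sup>2" using t by (auto simp: e_def)
  have "norm (false_theta (exp (- t)) m) \<le> (theta_const m * (2 / e)) * (2 / e)"
    unfolding false_theta_eq
  proof (rule norm_alternating_suminf_le[OF e(1,2)])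
    fix s
    have "norm (\<Sum>j. (-1) ^ j * theta_term m t (of_nat s) (of_nat j)) \<le> (theta_const m * exp (- e * real s)) * (2 / e)"
      by (rule norm_alternating_suminf_le[OF e(1,2)]) (rule norm_theta_term_nat_le[OF e(1,3)])
    thus "norm (\<Sum>j. (-1) ^ j * theta_term m t (of_nat s) (of_nat j)) \<le> theta_const m * (2 / e) * exp (- e * real s)"
      by (simp add: mult_ac)
  qed
  thus ?thesis unfolding e(3) by (simp add: power2_eq_square)
qed

text \<open>Fifth differences of quadratic polynomials vanish, so the weights reproduce the Abel
  values 1/2, -1/4 and 0 of the alternating sums of 1, a and a^2.\<close>

lemma euler_weight_quadratic:
  "(\<Sum>a<5. euler_weight a * (c0 + c1 * of_nat a + c2 * of_nat a ^ 2)) = (c0 / 2 - c1 / 4 :: complex)"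
  unfolding sum_less_5 by (simp add: euler_weight_def algebra_simps add_divide_distrib diff_divide_distrib)

text \<open>The Abel value of the double series linearized in t, which is the source of the
  expansion in \<open>false_theta_asymp\<close>.\<close>

lemma euler_weight_sums:
  "(\<Sum>a<5. \<Sum>b<5. euler_weight a * (euler_weight b * (1 - t * theta_poly m (of_nat a) (of_nat b)))) =
    1 / 4 - (of_nat m ^ 2 - 1) / 8 * t"
proof -
  define M where "M = (of_nat m :: complex)"
  have inner: "(\<Sum>b<5. euler_weight b * (1 - t * theta_poly m z (of_nat b))) = 
      (1 - t * ((z + M + 1) * (z + M + 2) / 2)) / 2 - (- t * (1 / 2 + 2 * (z + M + 1))) / 4" for z
  proof -
    have "1 - t * theta_poly m z b = (1 - t * ((z + M + 1) * (z + M + 2) / 2)) + (- t * (1 / 2 + 2 * (z + M + 1))) * b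
        + (- 3 / 2 * t) * b ^ 2" for b
      by (simp add: theta_poly_def M_def field_simps power2_eq_square)
    thus ?thesis by (simp only: euler_weight_quadratic)
  qed
  have "(\<Sum>a<5. \<Sum>b<5. euler_weight a * (euler_weight b * (1 - t * theta_poly m (of_nat a) (of_nat b)))) = 
    (\<Sum>a<5. euler_weight a * ((1 - t * ((of_nat a + M + 1) * (of_nat a + M + 2) / 2)) / 2 - (- t * (1 / 2 + 2 * (of_nat a + M + 1))) / 4))"
    by (simp only: sum_distrib_left[symmetric] inner)
  also have "\<dots> = (\<Sum>a<5. euler_weight a * ((1 / 2 - t * ((M + 1) * (M + 2) / 4) + t * (5 / 8 + M / 2))
      + (- t * (2 * M + 3) / 4 + t / 2) * of_nat a + (- t / 4) * of_nat a ^ 2))"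
    by (intro sum.cong[OF refl] arg_cong2[of _ _ _ _ "(*)"]) (simp_all add: field_simps power2_eq_square)
  also have "\<dots> = 1 / 4 - (M ^ 2 - 1) / 8 * t"
    unfolding euler_weight_quadratic by (simp add: field_simps power2_eq_square)
  finally show ?thesis unfolding M_def .
qed

text \<open>Let e be the square root of Re t; the cone gives |t| <= 2 e^2. In the outer remainder
  \<open>S1\<close> five powers of e meet a factor 4/e^2 from two geometric sums, which leaves e^3.
  The inner remainders in \<open>S2\<close> occur at five outer points only, and \<open>S3\<close>
  is the quadratic Taylor error at 25 lattice points; both are even of order e^4.\<close>

theorem false_theta_asymp:
  "\<exists>C. \<forall>t. 0 < Re t \<and> Re t \<le> 1 \<and> \<bar>Im t\<bar> \<le> Re t \<longrightarrow>
     norm (false_theta (exp (- t)) m - (1 / 4 - (of_nat m ^ 2 - 1) / 8 * t)) \<le> C * sqrt (Re t) ^ 3"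
proof -
  define K where "K = theta_const m"
  have K: "K > 0" by (simp add: K_def theta_const_def)
  define p where "p = (\<lambda>a b. theta_poly m (of_nat a) (of_nat b))"
  define w where "w = (\<lambda>a. norm (euler_weight a :: complex))"
  define Cab where "Cab = (\<lambda>a b. w a * (w b * 
     (exp (2 * norm (p a b)) * (2 * norm (p a b))\<^sup>2)))"
  define C where "C = K / 8 + (\<Sum>a<5. w a * K / 16) + (\<Sum>a<5. \<Sum>b<5. Cab a b)"
  show ?thesis
  proof (intro exI[of _ C] allI impI)
    fix t :: complex
    assume t: "0 < Re t \<and> Re t \<le> 1 \<and> \<bar>Im t\<bar> \<le> Re t"
    define e where "e = sqrt (Re t)"
    have e: "0 < e" "e \<le> 1" "Re t = e\<^sup>2" using t by (auto simp: e_def)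
    have nt: "norm t \<le> 2 * e\<^sup>2" using cmod_le[of t] t e(3) by simp
    define h where "h = (\<lambda>s j. theta_term m t (of_nat s) (of_nat j))"
    define \<phi> where "\<phi> = (\<lambda>s. \<Sum>j. (-1) ^ j * h s j)"
    have hb: "norm (h s j) \<le> (K * exp (- e * real s)) * exp (- e * real j)" for s j
      unfolding h_def K_def by (rule norm_theta_term_nat_le[OF e(1,3)])
    have hsm: "summable (\<lambda>j. norm (h s j))" for s
      by (rule norm_alternating_suminf_le[OF e(1,2) hb])
    have hsm': "summable (\<lambda>j. (-1) ^ j * h s j)" for s
      by (rule summable_norm_cancel) (use hsm[of s] in \<open>simp add: norm_mult norm_power\<close>)
    have \<phi>b: "norm (\<phi> s) \<le> (K * (2 / e)) * exp (- e * real s)" for s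
      using norm_alternating_suminf_le(2)[OF e(1,2) hb, of s] by (simp add: \<phi>_def mult_ac)
    have \<phi>sm: "summable (\<lambda>s. norm (\<phi> s))"
      by (rule norm_alternating_suminf_le[OF e(1,2) \<phi>b])
    have F: "false_theta (exp (- t)) m = (\<Sum>s. (-1) ^ s * \<phi> s)"
      unfolding false_theta_eq \<phi>_def h_def ..
    have F2: "false_theta (exp (- t)) m = (\<Sum>a<5. euler_weight a * \<phi> a) + (\<Sum>s. (-1) ^ s * fwd_diff5 \<phi> s) / 32"
      unfolding F by (rule alternating_suminf_fwd_diff5[OF \<phi>sm])
    \<comment> \<open>The outer difference passes through the convergent inner sum, so only
      differences of single terms have to be bounded.\<close>
    have d\<phi>: "fwd_diff5 \<phi> s = (\<Sum>j. (-1) ^ j * fwd_diff5 (\<lambda>s. h s j) s)" for s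
    proof -
      have "fwd_diff5 \<phi> s = (\<Sum>j. (-1) ^ j * h s j - 5 * ((-1) ^ j * h (s + 1) j) + 10 * ((-1) ^ j * h (s + 2) j)
        - 10 * ((-1) ^ j * h (s + 3) j) + 5 * ((-1) ^ j * h (s + 4) j) - (-1) ^ j * h (s + 5) j)"
        unfolding fwd_diff5_def \<phi>_def
        by (intro sums_unique sums_add sums_diff sums_mult summable_sums hsm')
      thus ?thesis by (simp add: fwd_diff5_def algebra_simps)
    qed
    have dl: "norm (fwd_diff5 (\<lambda>s. h s j) s) \<le> (K * exp (- e * real s) * e ^ 5) * exp (- e * real j)" for s j
      using fwd_diff5_theta_le(1)[OF e nt, of m j s] by (simp add: fwd_diff5_def h_def K_def mult_ac add_ac)
    have dr: "norm (fwd_diff5 (h s) j) \<le> (K * exp (- e * real s) * e ^ 5) * exp (- e * real j)" for s j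
      using fwd_diff5_theta_le(2)[OF e nt, of m s j] by (simp add: fwd_diff5_def h_def K_def mult_ac add_ac)
    have "norm (fwd_diff5 \<phi> s) \<le> (K * e ^ 5 * (2 / e)) * exp (- e * real s)" for s
      unfolding d\<phi> using norm_alternating_suminf_le(2)[OF e(1,2) dl, of s] by (simp add: mult_ac)
    hence "norm (\<Sum>s. (-1) ^ s * fwd_diff5 \<phi> s) \<le> (K * e ^ 5 * (2 / e)) * (2 / e)"
      by (rule norm_alternating_suminf_le[OF e(1,2)])
    also have "\<dots> = 4 * K * e ^ 3" using e by (simp add: power_numeral_reduce)
    finally have E1: "norm ((\<Sum>s. (-1) ^ s * fwd_diff5 \<phi> s) / 32) \<le> K / 8 * e ^ 3"
      by (simp add: norm_divide)
    have E2: "norm (\<phi> a - (\<Sum>b<5. euler_weight b * h a b)) \<le> K / 16 * e ^ 3" for a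
    proof -
      have "\<phi> a - (\<Sum>b<5. euler_weight b * h a b) = (\<Sum>j. (-1) ^ j * fwd_diff5 (h a) j) / 32"
        unfolding \<phi>_def alternating_suminf_fwd_diff5[OF hsm] by simp
      also have "norm \<dots> \<le> (K * exp (- e * real a) * e ^ 5) * (2 / e) / 32"
        using norm_alternating_suminf_le(2)[OF e(1,2) dr, of a] by (simp add: norm_divide mult_ac)
      also have "\<dots> = K / 16 * (exp (- e * real a) * e) * e ^ 3" using e by (simp add: power_numeral_reduce)
      also have "\<dots> \<le> K / 16 * (1 * 1) * e ^ 3"
        using e K by (intro mult_right_mono mult_left_mono mult_mono) auto
      finally show ?thesis by simp
    qed
    have E3: "norm (h a b - (1 - t * p a b)) \<le> 
        (exp (2 * norm (p a b)) * (2 * norm (p a b))\<^sup>2) * e ^ 3" for a b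
    proof -
      define P where "P = p a b"
      have "norm (exp (- t * P) - (\<Sum>k\<le>1. (- t * P) ^ k / fact k)) \<le> exp \<bar>Re (- t * P)\<bar> * norm (- t * P) ^ Suc 1 / fact 1"
        by (rule Taylor_exp)
      hence "norm (h a b - (1 - t * P)) \<le> exp \<bar>Re (- t * P)\<bar> * norm (t * P) ^ 2"
        by (simp add: h_def theta_term_def P_def p_def power2_eq_square norm_mult)
      also have "\<dots> \<le> exp (2 * norm P) * (2 * e\<^sup>2 * norm P) ^ 2"
      proof (intro mult_mono power_mono)
        have "\<bar>Re (- t * P)\<bar> \<le> norm (- t * P)" by (rule abs_Re_le_cmod)
        also have "\<dots> \<le> 2 * e\<^sup>2 * norm P" using nt by (simp add: norm_mult mult_right_mono)
        also have "\<dots> \<le> 2 * 1 * norm P" using e by (intro mult_right_mono mult_left_mono) (auto simp: power_le_one)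
        finally show "exp \<bar>Re (- t * P)\<bar> \<le> exp (2 * norm P)" by simp
        show "norm (t * P) \<le> 2 * e\<^sup>2 * norm P" using nt by (simp add: norm_mult mult_right_mono)
      qed auto
      also have "\<dots> = exp (2 * norm P) * (2 * norm P)\<^sup>2 * e ^ 3 * e" by (simp add: power_numeral_reduce)
      also have "\<dots> \<le> exp (2 * norm P) * (2 * norm P)\<^sup>2 * e ^ 3 * 1"
        using e by (intro mult_left_mono) auto
      finally show ?thesis by (simp add: P_def)
    qed
    define S1 where "S1 = (\<Sum>s. (-1) ^ s * fwd_diff5 \<phi> s) / 32"
    define S2 where "S2 = (\<Sum>a<5. euler_weight a * (\<phi> a - (\<Sum>b<5. euler_weight b * h a b)))"
    define S3 where "S3 = (\<Sum>a<5. \<Sum>b<5. euler_weight a * (euler_weight b * (h a b - (1 - t * p a b))))"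
    have split: "false_theta (exp (- t)) m - (1 / 4 - (of_nat m ^ 2 - 1) / 8 * t) = S1 + S2 + S3"
      unfolding F2 euler_weight_sums[symmetric] S1_def S2_def S3_def p_def
      by (simp add: right_diff_distrib sum_subtractf sum_distrib_left)
    have N1: "norm S1 \<le> K / 8 * e ^ 3" unfolding S1_def by (rule E1)
    have N2: "norm S2 \<le> (\<Sum>a<5. w a * K / 16) * e ^ 3"
      unfolding S2_def sum_distrib_right
    proof (rule sum_norm_le)
      fix a
      show "norm (euler_weight a * (\<phi> a - (\<Sum>b<5. euler_weight b * h a b))) \<le> w a * K / 16 * e ^ 3"
        unfolding norm_mult using mult_left_mono[OF E2[of a] norm_ge_zero[of "euler_weight a"]] by (simp add: w_def mult_ac)
    qed
    have N3: "norm S3 \<le> (\<Sum>a<5. \<Sum>b<5. Cab a b) * e ^ 3"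
      unfolding S3_def sum_distrib_right
    proof (intro sum_norm_le)
      fix a b
      show "norm (euler_weight a * (euler_weight b * (h a b - (1 - t * p a b)))) \<le> Cab a b * e ^ 3"
        unfolding norm_mult Cab_def w_def mult.assoc
        by (intro mult_left_mono norm_ge_zero) (use E3[of a b] in \<open>simp add: mult_ac\<close>)
    qed
    have "norm (S1 + S2 + S3) \<le> norm S1 + norm S2 + norm S3"
      by (intro norm_triangle_le add_mono order.refl)
    also have "\<dots> \<le> K / 8 * e ^ 3 + (\<Sum>a<5. w a * K / 16) * e ^ 3 + (\<Sum>a<5. \<Sum>b<5. Cab a b) * e ^ 3"
      by (intro add_mono N1 N2 N3)
    also have "\<dots> = C * e ^ 3"
      unfolding C_def distrib_right ..
    finally show "norm (false_theta (exp (- t)) m - (1 / 4 - (of_nat m ^ 2 - 1) / 8 * t)) \<le> C * sqrt (Re t) ^ 3"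
      unfolding split e_def .
  qed
qed

section \<open>The partition generating function near 1\<close>

text \<open>The Lambert series of -log (q)_infinity at q = e^(-t). Defining the logarithm by a
  series avoids a choice of branch; the term at j = 0 is 0 because
  \<open>inverse 0 = 0\<close>.\<close>

definition log_partition_gf :: "complex \<Rightarrow> complex" where
  "log_partition_gf t = (\<Sum>j. inverse (of_nat j) * inverse (exp (of_nat j * t) - 1))"

lemma lambert_term:
  fixes t :: complex
  assumes "Re t > 0"
  shows "inverse (of_nat j) * inverse (exp (of_nat j * t) - 1) = inverse (of_nat j) * (exp (- t) ^ j / (1 - exp (- t) ^ j))"
proof (cases "j = 0")
  case False
  have n: "norm (exp (- t)) < 1" using assms by simp
  have "exp (of_nat j * t) = inverse (exp (- t) ^ j)"
    by (simp add: exp_minus power_inverse flip: exp_of_nat_mult)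
  moreover have "exp (- t) ^ j \<noteq> 0" by simp
  moreover have "1 - exp (- t) ^ j \<noteq> 0" using one_minus_power_nonzero[OF n, of j] False by simp
  moreover have "inverse (inverse y - 1) = y / (1 - y)" if "y \<noteq> 0" "1 - y \<noteq> 0" for y :: complex
    using that by (simp add: field_simps)
  ultimately show ?thesis by simp
qed simp

lemma norm_lambert_term_le:
  fixes t :: complex
  assumes "Re t > 0"
  shows "norm (inverse (of_nat j) * inverse (exp (of_nat j * t) - 1)) \<le> exp (- Re t) ^ j / (1 - exp (- Re t))"
proof (cases "j = 0")
  case False
  define r where "r = exp (- Re t)"
  have r: "0 < r" "r < 1" using assms by (auto simp: r_def)
  have nq: "norm (exp (- t)) = r" by (simp add: r_def)
  have "r ^ j \<le> r" using r False power_decreasing[of 1 j r] by simp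
  moreover have "1 - r ^ j \<le> norm (1 - exp (- t) ^ j)"
    using norm_triangle_ineq2[of 1 "exp (- t) ^ j"] by (simp only: norm_power nq norm_one)
  ultimately have d: "1 - r \<le> norm (1 - exp (- t) ^ j)" by linarith
  have "norm (inverse (of_nat j) * inverse (exp (of_nat j * t) - 1)) = inverse (real j) * (r ^ j / norm (1 - exp (- t) ^ j))"
    unfolding lambert_term[OF assms] by (simp add: norm_mult norm_inverse norm_divide norm_power r_def)
  also have "\<dots> \<le> 1 * (r ^ j / (1 - r))"
  proof (rule mult_mono)
    have "0 < norm (1 - exp (- t) ^ j)" using d r by linarith
    thus "r ^ j / norm (1 - exp (- t) ^ j) \<le> r ^ j / (1 - r)"
      using d r by (intro divide_left_mono mult_pos_pos) auto
    show "inverse (real j) \<le> 1" using False by (simp add: field_simps)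
  qed (use r in auto)
  finally show ?thesis by (simp add: r_def)
qed (use assms in simp)

lemma summable_norm_lambert:
  fixes t :: complex
  assumes "Re t > 0"
  shows "summable (\<lambda>j. norm (inverse (of_nat j) * inverse (exp (of_nat j * t) - 1)))"
proof (rule summable_comparison_test')
  show "summable (\<lambda>j. exp (- Re t) ^ j / (1 - exp (- Re t)))"
    using assms by (intro summable_divide summable_geometric) simp
qed (use norm_lambert_term_le[OF assms] in simp)

lemma inverse_qpoch_tendsto:
  fixes q :: complex
  assumes q: "norm q < 1"
  shows "(\<lambda>N. inverse (qpoch q N)) \<longlonglongrightarrow> partition_gf q"
proof -
  have "(\<lambda>N. partition_gf q * inverse (qpoch q N * partition_gf q)) \<longlonglongrightarrow> partition_gf q * inverse 1"
    by (intro tendsto_intros qpoch_partition_gf_tendsto[OF q]) simp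
  moreover have "partition_gf q * inverse (qpoch q N * partition_gf q) = inverse (qpoch q N)" for N
    using partition_gf_nonzero[OF q] qpoch_nonzero[OF q, of N] by (simp add: field_simps)
  ultimately show ?thesis by (simp only: inverse_1 mult_1_right)
qed

text \<open>For finite N the logarithmic series and finite geometric sums show exactly that the sum
  of -ln (1 - q^i) over i <= N equals the sum of a_j (1 - q^(jN)) over j. The part with q^(jN) is at
  most |q|^N times a convergent sum.\<close>

theorem partition_gf_eq_exp:
  fixes t :: complex
  assumes t: "Re t > 0"
  shows "partition_gf (exp (- t)) = exp (log_partition_gf t)"
proof -
  define q where "q = exp (- t)"
  have q: "norm q < 1" using t by (simp add: q_def)
  define a where "a = (\<lambda>j. inverse (of_nat j) * (q ^ j / (1 - q ^ j)))"
  have a_eq: "inverse (of_nat j) * inverse (exp (of_nat j * t) - 1) = a j" for j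
    unfolding a_def q_def by (rule lambert_term[OF t])
  have L: "log_partition_gf t = suminf a" unfolding log_partition_gf_def a_eq ..
  have sma: "summable (\<lambda>j. norm (a j))" using summable_norm_lambert[OF t] unfolding a_eq .
  have fin: "inverse (qpoch q N) = exp (suminf a - (\<Sum>j. a j * q ^ (j * N)))" for N
  proof -
    have "norm (q ^ i) < 1" if "i \<in> {1..N}" for i using q that by (simp add: norm_power power_less_one_iff)
    hence ln: "(\<lambda>j. (q ^ i) ^ j / of_nat j) sums (- ln (1 - q ^ i))" if "i \<in> {1..N}" for i
      using sums_minus[OF Ln_series'[of "- (q ^ i)"]] that by simp
    have "(\<lambda>j. \<Sum>i=1..N. (q ^ i) ^ j / of_nat j) sums (\<Sum>i=1..N. - ln (1 - q ^ i))"
      by (rule sums_sum[OF ln])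
    moreover have "(\<Sum>i=1..N. (q ^ i) ^ j / of_nat j) = a j - a j * q ^ (j * N)" for j
    proof (cases "j = 0")
      case False
      hence qj: "1 - q ^ j \<noteq> 0" using one_minus_power_nonzero[OF q, of j] by simp
      have "(\<Sum>i=1..N. (q ^ j) ^ i) * (1 - q ^ j) = q ^ j - q ^ j * (q ^ j) ^ N"
      proof (induction N)
        case (Suc N)
        have "(\<Sum>i=1..Suc N. (q ^ j) ^ i) * (1 - q ^ j) = (\<Sum>i=1..N. (q ^ j) ^ i) * (1 - q ^ j) + q ^ j * (q ^ j) ^ N * (1 - q ^ j)"
          by (simp add: distrib_right)
        hence e: "(\<Sum>i=1..Suc N. (q ^ j) ^ i) * (1 - q ^ j) = q ^ j - q ^ j * (q ^ j) ^ N + q ^ j * (q ^ j) ^ N * (1 - q ^ j)"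
          unfolding Suc.IH .
        show ?case unfolding e by (simp add: algebra_simps)
      qed simp
      hence "(\<Sum>i=1..N. (q ^ j) ^ i) = (q ^ j - q ^ j * (q ^ j) ^ N) / (1 - q ^ j)"
        using qj by (simp add: eq_divide_eq)
      moreover have "(\<Sum>i=1..N. (q ^ i) ^ j / of_nat j) = (\<Sum>i=1..N. (q ^ j) ^ i) / of_nat j"
        by (simp add: sum_divide_distrib mult.commute flip: power_mult)
      ultimately have "(\<Sum>i=1..N. (q ^ i) ^ j / of_nat j) = (q ^ j - q ^ j * (q ^ j) ^ N) / (1 - q ^ j) / of_nat j" by simp
      also have "\<dots> = a j - a j * q ^ (j * N)"
        unfolding a_def power_mult by (simp only: divide_inverse) (simp only: algebra_simps)
      finally show ?thesis .
    qed (simp add: a_def)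
    ultimately have s1: "(\<lambda>j. a j - a j * q ^ (j * N)) sums (\<Sum>i=1..N. - ln (1 - q ^ i))" by simp
    have sma': "summable (\<lambda>j. norm (a j * q ^ (j * N)))"
    proof (rule summable_comparison_test'[OF sma])
      fix j :: nat
      show "norm (norm (a j * q ^ (j * N))) \<le> norm (a j)"
        using q by (simp add: norm_mult norm_power mult_left_le power_le_one)
    qed
    have "(\<lambda>j. a j - a j * q ^ (j * N)) sums (suminf a - (\<Sum>j. a j * q ^ (j * N)))"
      by (rule sums_diff[OF summable_sums[OF summable_norm_cancel[OF sma]] summable_sums[OF summable_norm_cancel[OF sma']]])
    with s1 have "(\<Sum>i=1..N. - ln (1 - q ^ i)) = suminf a - (\<Sum>j. a j * q ^ (j * N))"
      by (rule sums_unique2)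
    hence "exp (suminf a - (\<Sum>j. a j * q ^ (j * N))) = (\<Prod>i=1..N. exp (- ln (1 - q ^ i)))"
      by (simp flip: exp_sum)
    also have "\<dots> = (\<Prod>i=1..N. inverse (1 - q ^ i))"
      using one_minus_power_nonzero[OF q] by (intro prod.cong) (auto simp: exp_minus)
    also have "\<dots> = inverse (\<Prod>i=1..N. 1 - q ^ i)"
      using prod_inversef[of "\<lambda>i. 1 - q ^ i" "{1..N}"] by (simp only: o_def)
    finally show ?thesis by (simp only: qpoch_def)
  qed
  have "(\<lambda>N. \<Sum>j. a j * q ^ (j * N)) \<longlonglongrightarrow> 0"
  proof (rule Lim_null_comparison)
    show "(\<lambda>N. norm q ^ N * (\<Sum>j. norm (a j))) \<longlonglongrightarrow> 0"
      using tendsto_mult_right[OF LIMSEQ_power_zero[of "norm q"], of "\<Sum>j. norm (a j)"] q by simp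
    show "\<forall>\<^sub>F N in sequentially. norm (\<Sum>j. a j * q ^ (j * N)) \<le> norm q ^ N * (\<Sum>j. norm (a j))"
    proof (intro always_eventually allI)
      fix N
      have b: "norm (a j * q ^ (j * N)) \<le> norm q ^ N * norm (a j)" for j
      \<comment> \<open>At j = 0 the power of q is 1, so the bound there relies on
        \<open>a 0 = 0\<close>.\<close>
      proof (cases "j = 0")
        case False
        hence "N \<le> j * N" by simp
        hence "norm q ^ (j * N) \<le> norm q ^ N" using q by (intro power_decreasing) auto
        from mult_left_mono[OF this norm_ge_zero[of "a j"]]
        show ?thesis by (simp add: norm_mult norm_power mult.commute)
      qed (simp add: a_def)
      have sb: "summable (\<lambda>j. norm q ^ N * norm (a j))" by (intro summable_mult sma)
      have sc: "summable (\<lambda>j. norm (a j * q ^ (j * N)))"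
        by (rule summable_comparison_test'[OF sb]) (use b in simp)
      have "norm (\<Sum>j. a j * q ^ (j * N)) \<le> (\<Sum>j. norm (a j * q ^ (j * N)))" by (rule summable_norm[OF sc])
      also have "\<dots> \<le> (\<Sum>j. norm q ^ N * norm (a j))" by (rule suminf_le[OF b sc sb])
      also have "\<dots> = norm q ^ N * (\<Sum>j. norm (a j))" by (rule suminf_mult[OF sma])
      finally show "norm (\<Sum>j. a j * q ^ (j * N)) \<le> norm q ^ N * (\<Sum>j. norm (a j))" .
    qed
  qed
  hence "(\<lambda>N. exp (suminf a - (\<Sum>j. a j * q ^ (j * N)))) \<longlonglongrightarrow> exp (suminf a - 0)"
    by (intro tendsto_intros)
  hence "(\<lambda>N. inverse (qpoch q N)) \<longlonglongrightarrow> exp (suminf a)" by (simp add: fin)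
  with inverse_qpoch_tendsto[OF q] show ?thesis
    unfolding L q_def[symmetric] by (rule LIMSEQ_unique)
qed

section \<open>The trapezoidal rule and Stirling's constant\<close>

text \<open>As a function of the step x the defect has derivative (g(a+x) - g(a) - x g'(a+x))/2,
  which is at most B h^2 if g'' is bounded by B; integration adds the third power of h. Here k is g'
  and k' is g''; the constant is not optimized.\<close>

lemma trapezoid_error:
  fixes H g k :: "real \<Rightarrow> real"
  assumes h: "h \<ge> 0"
    and H: "\<And>x. a \<le> x \<Longrightarrow> x \<le> a + h \<Longrightarrow> (H has_real_derivative g x) (at x)"
    and g: "\<And>x. a \<le> x \<Longrightarrow> x \<le> a + h \<Longrightarrow> (g has_real_derivative k x) (at x)"
    and k: "\<And>x. a \<le> x \<Longrightarrow> x \<le> a + h \<Longrightarrow> (k has_real_derivative k' x) (at x)"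
    and B: "\<And>x. a \<le> x \<Longrightarrow> x \<le> a + h \<Longrightarrow> \<bar>k' x\<bar> \<le> B"
  shows "\<bar>H (a + h) - H a - h * (g a + g (a + h)) / 2\<bar> \<le> B * h ^ 3"
proof -
  define E where "E = (\<lambda>x. H (a + x) - H a - x * (g a + g (a + x)) / 2)"
  define E' where "E' = (\<lambda>x. (g (a + x) - g a - x * k (a + x)) / 2)"
  have B0: "B \<ge> 0" using B[of a] h by fastforce
  have kvar: "\<bar>k x - k y\<bar> \<le> B * \<bar>x - y\<bar>" if "x \<in> {a..a + h}" "y \<in> {a..a + h}" for x y
  proof -
    have "norm (k x - k y) \<le> B * norm (x - y)"
      by (rule field_differentiable_bound[of "{a..a + h}" k k'])
         (use that k B in \<open>auto intro: has_field_derivative_at_within\<close>)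
    thus ?thesis by simp
  qed
  have E'b: "norm (E' x) \<le> B * h\<^sup>2" if x: "x \<in> {0..h}" for x
  proof -
    \<comment> \<open>The derivative of \<phi> is \<open>k y - k (a + x)\<close>, which is small on
      the whole interval, so the mean value inequality yields the second-order estimate.\<close>
    define \<phi> where "\<phi> = (\<lambda>y. g y - (y - a) * k (a + x))"
    have "norm (\<phi> (a + x) - \<phi> a) \<le> (B * h) * norm ((a + x) - a)"
    proof (rule field_differentiable_bound[of "{a..a + x}" \<phi> "\<lambda>y. k y - k (a + x)"])
      fix y assume y: "y \<in> {a..a + x}"
      show "(\<phi> has_field_derivative k y - k (a + x)) (at y within {a..a + x})"
        unfolding \<phi>_def using x y by (auto intro!: derivative_eq_intros has_field_derivative_at_within[OF g])
      have "\<bar>k y - k (a + x)\<bar> \<le> B * \<bar>y - (a + x)\<bar>" using x y by (intro kvar) auto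
      also have "\<dots> \<le> B * h" using x y B0 by (intro mult_left_mono) auto
      finally show "norm (k y - k (a + x)) \<le> B * h" by simp
    qed (use x in auto)
    hence "\<bar>g (a + x) - g a - x * k (a + x)\<bar> \<le> B * h * x" using x by (simp add: \<phi>_def algebra_simps)
    also have "\<dots> \<le> B * h * h" using x B0 h by (intro mult_left_mono) auto
    finally have "\<bar>g (a + x) - g a - x * k (a + x)\<bar> \<le> B * h\<^sup>2" by (simp add: power2_eq_square mult.assoc)
    moreover have "0 \<le> B * h\<^sup>2" using B0 by simp
    ultimately show ?thesis unfolding E'_def by simp
  qed
  have "norm (E h - E 0) \<le> (B * h\<^sup>2) * norm (h - 0)"
  proof (rule field_differentiable_bound[of "{0..h}" E E'])
    fix x assume x: "x \<in> {0..h}"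
    have 1: "((\<lambda>x. H (a + x)) has_real_derivative g (a + x)) (at x)"
      using DERIV_shift[of H "g (a + x)" x a] H[of "a + x"] x by (simp add: add.commute)
    have 2: "((\<lambda>x. g (a + x)) has_real_derivative k (a + x)) (at x)"
      using DERIV_shift[of g "k (a + x)" x a] g[of "a + x"] x by (simp add: add.commute)
    show "(E has_field_derivative E' x) (at x within {0..h})"
    proof -
      have "((\<lambda>x. x * (g a + g (a + x))) has_real_derivative (1 * (g a + g (a + x)) + (0 + k (a + x)) * x)) (at x)"
        by (intro DERIV_mult DERIV_add DERIV_ident DERIV_const 2)
      hence "(E has_real_derivative (g (a + x) - 0 - (1 * (g a + g (a + x)) + (0 + k (a + x)) * x) / 2)) (at x)"
        unfolding E_def by (intro DERIV_diff DERIV_cdivide 1 DERIV_const)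
      moreover have "g (a + x) - 0 - (1 * (g a + g (a + x)) + (0 + k (a + x)) * x) / 2 = E' x"
        by (simp add: E'_def field_simps)
      ultimately show ?thesis by (simp add: has_field_derivative_at_within)
    qed
    show "norm (E' x) \<le> B * h\<^sup>2" by (rule E'b[OF x])
  qed (use h in auto)
  thus ?thesis using h by (simp add: E_def power_numeral_reduce mult.assoc)
qed

text \<open>The trapezoidal rule for ln makes the increments O(1/n^2), so a limit c exists. Wallis'
  product determines it: its logarithm is 4 s(n) - 2 s(2n) plus a term tending to -ln 4, hence ln
  (pi/2) = 2c - ln 4.\<close>

lemma stirling_limit:
  "(\<lambda>n. ln (fact n) - (real n + 1 / 2) * ln (real n) + real n) \<longlonglongrightarrow> ln (2 * pi) / 2"
proof -
  define s where "s = (\<lambda>n. ln (fact n) - (real n + 1 / 2) * ln (real n) + real n)"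
  \<comment> \<open>The shift by one keeps the interval [n+1, n+2] away from the singularity of ln
    at 0.\<close>
  define d where "d = (\<lambda>n. s (Suc n) - s (Suc (Suc n)))"
  have dbound: "norm (d n) \<le> 1 / real ((n + 1)\<^sup>2)" for n
  proof -
    define x where "x = real (Suc n)"
    have x: "x \<ge> 1" by (simp add: x_def)
    have l: "ln (fact (Suc (Suc n)) :: real) = ln (x + 1) + ln (fact (Suc n))"
      by (subst fact_Suc, subst ln_mult) (simp_all del: fact_Suc add: x_def add_ac)
    have x1: "real (Suc (Suc n)) = x + 1" by (simp add: x_def)
    have "\<bar>((x + 1) * ln (x + 1) - (x + 1)) - (x * ln x - x) - 1 * (ln x + ln (x + 1)) / 2\<bar> \<le> (1 / x\<^sup>2) * 1 ^ 3"
    proof (rule trapezoid_error[where k = "\<lambda>x. 1 / x" and k' = "\<lambda>x. - 1 / x\<^sup>2" and H = "\<lambda>x. x * ln x - x"])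
      fix y assume y: "x \<le> y" "y \<le> x + 1"
      have y0: "y > 0" using y x by simp
      show "((\<lambda>x. x * ln x - x) has_real_derivative ln y) (at y)"
        using y0 by (auto intro!: derivative_eq_intros)
      show "(ln has_real_derivative 1 / y) (at y)"
        using y0 by (auto intro!: derivative_eq_intros)
      show "((\<lambda>x. 1 / x) has_real_derivative - 1 / y\<^sup>2) (at y)"
        using y0 by (auto intro!: derivative_eq_intros simp: power2_eq_square)
      show "\<bar>- 1 / y\<^sup>2\<bar> \<le> 1 / x\<^sup>2"
        using y y0 x by (auto simp: abs_divide intro!: divide_left_mono power_mono mult_pos_pos)
    qed simp
    moreover have "d n = ((x + 1) * ln (x + 1) - (x + 1)) - (x * ln x - x) - 1 * (ln x + ln (x + 1)) / 2"
      unfolding d_def s_def l x1 x_def[symmetric] by (simp add: field_simps)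
    ultimately show ?thesis by (simp add: x_def add.commute)
  qed
  have "summable d"
    by (rule summable_comparison_test'[OF sums_summable[OF inverse_squares_sums]]) (rule dbound)
  moreover have "(\<Sum>i<n. d i) = s 1 - s (Suc n)" for n
    unfolding d_def by (induction n) auto
  ultimately have "(\<lambda>n. s 1 - s (Suc n)) \<longlonglongrightarrow> suminf d"
    using summable_LIMSEQ by fastforce
  from tendsto_diff[OF tendsto_const[of "s 1"] this]
  have "(\<lambda>n. s (Suc n)) \<longlonglongrightarrow> s 1 - suminf d" by simp
  then obtain c where c: "s \<longlonglongrightarrow> c" using LIMSEQ_imp_Suc by blast
  define W where "W = (\<lambda>n. \<Prod>k=1..n. (4 * real k ^ 2) / (4 * real k ^ 2 - 1))"
  have W_eq: "W n = 16 ^ n * fact n ^ 4 / (fact (2 * n) ^ 2 * (2 * real n + 1))" for n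
  proof (induction n)
    case (Suc n)
    have "W (Suc n) = W n * ((4 * real (Suc n) ^ 2) / (4 * real (Suc n) ^ 2 - 1))" by (simp add: W_def)
    also have "4 * real (Suc n) ^ 2 - 1 = (2 * real n + 1) * (2 * real n + 3)"
      by (simp add: power2_eq_square algebra_simps)
    finally have 1: "W (Suc n) = 16 ^ n * fact n ^ 4 / (fact (2 * n) ^ 2 * (2 * real n + 1)) * 
        (4 * real (Suc n) ^ 2 / ((2 * real n + 1) * (2 * real n + 3)))" unfolding Suc.IH .
    have f: "fact (2 * Suc n) = (2 * real n + 1) * (2 * real (Suc n)) * fact (2 * n)"
      by (simp add: algebra_simps)
    have "16 ^ Suc n * fact (Suc n) ^ 4 / (fact (2 * Suc n) ^ 2 * (2 * real (Suc n) + 1)) = 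
       16 * 16 ^ n * (real (Suc n) * fact n) ^ 4 / (((2 * real n + 1) * (2 * real (Suc n)) * fact (2 * n)) ^ 2 * (2 * real n + 3))"
      unfolding f fact_Suc by (simp add: add_ac)
    also have "\<dots> = W (Suc n)"
      unfolding 1 by (simp add: power_mult_distrib divide_simps power_numeral_reduce del: of_nat_Suc)
    finally show ?case ..
  qed (simp add: W_def)
  have lnW: "4 * s n - 2 * s (2 * n) + (ln (real n) - ln 2 - ln (2 * real n + 1)) = ln (W n)" if "n > 0" for n
  proof -
    have "ln (W n) = real n * ln 16 + 4 * ln (fact n) - (2 * ln (fact (2 * n)) + ln (2 * real n + 1))"
      unfolding W_eq by (simp add: ln_mult ln_div ln_realpow)
    also have "ln (16 :: real) = 4 * ln 2" using ln_realpow[of 2 4] by simp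
    finally have "ln (W n) = real n * (4 * ln 2) + 4 * ln (fact n) - (2 * ln (fact (2 * n)) + ln (2 * real n + 1))" .
    moreover have "ln (real (2 * n)) = ln 2 + ln (real n)" using that by (simp add: ln_mult)
    ultimately show ?thesis unfolding s_def by (simp add: algebra_simps)
  qed
  have "(\<lambda>n. ln (W n)) \<longlonglongrightarrow> ln (pi / 2)"
    by (intro tendsto_ln) (use wallis in \<open>auto simp: W_def\<close>)
  moreover have "(\<lambda>n. ln (W n)) \<longlonglongrightarrow> 4 * c - 2 * c + - ln 4"
  proof (rule Lim_transform_eventually)
    have c2: "(\<lambda>n. s (2 * n)) \<longlonglongrightarrow> c"
      by (rule filterlim_compose[OF c]) (auto intro!: filterlim_subseq strict_monoI)
    have "(\<lambda>n. ln (real n) - ln 2 - ln (2 * real n + 1)) \<longlonglongrightarrow> - ln 4" 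
    proof -
      have "(\<lambda>n. ln (real n) - ln 2 - ln (2 * real n + 1)) \<longlonglongrightarrow> - ln 2 - ln 2" by real_asymp
      moreover have "ln (4 :: real) = 2 * ln 2" using ln_realpow[of 2 2] by simp
      ultimately show ?thesis by simp
    qed
    thus "(\<lambda>n. 4 * s n - 2 * s (2 * n) + (ln (real n) - ln 2 - ln (2 * real n + 1))) \<longlonglongrightarrow> 4 * c - 2 * c + - ln 4"
      by (intro tendsto_intros c c2)
    show "\<forall>\<^sub>F n in sequentially. 4 * s n - 2 * s (2 * n) + (ln (real n) - ln 2 - ln (2 * real n + 1)) = ln (W n)"
      using eventually_gt_at_top[of 0] by eventually_elim (rule lnW)
  qed
  ultimately have "ln (pi / 2) = 4 * c - 2 * c + - ln 4" by (rule LIMSEQ_unique)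
  moreover have "ln (2 * pi) = ln (pi / 2) + ln 4" using ln_mult_pos[of "pi / 2" 4] by simp
  ultimately have "c = ln (2 * pi) / 2" by simp
  with c show ?thesis unfolding s_def by simp
qed

text \<open>Removing the pole \<open>1/z\<close> from \<open>1/(e\<^sup>z - 1)\<close> separates the main term \<open>\<pi>\<^sup>2/(6t)\<close> of the logarithm
  of the partition generating function.\<close>
definition lambert_rem :: "complex \<Rightarrow> complex" where
  "lambert_rem z = inverse (exp z - 1) - inverse z"

definition lambert_rem' :: "complex \<Rightarrow> complex" where
  "lambert_rem' z = inverse (z\<^sup>2) - exp z / (exp z - 1)\<^sup>2"

lemma exp_neq_1_Re_pos:
  fixes z :: complex
  assumes "Re z > 0"
  shows "exp z \<noteq> 1" "z \<noteq> 0"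
proof -
  show "exp z \<noteq> 1"
  proof
    assume "exp z = 1"
    hence "norm (exp z) = 1" by simp
    thus False using assms by simp
  qed
qed (use assms in auto)

lemma lambert_rem_deriv:
  assumes "Re z > 0"
  shows "(lambert_rem has_field_derivative lambert_rem' z) (at z)"
  unfolding lambert_rem_def[abs_def] lambert_rem'_def using exp_neq_1_Re_pos[OF assms]
  by (auto intro!: derivative_eq_intros simp: power2_eq_square field_simps)

text \<open>With s = 2 sinh (z/2) the subtracted term is 1/s^2. As s is odd in z, s - z = O(z^3),
  and (s - z)(s + z)/(z^2 s^2) stays bounded: the double poles cancel. The constants 1/4, 9/4 and
  (3/4)^2 combine to exactly 1.\<close>

lemma norm_lambert_rem'_le_1:
  assumes z: "Re z > 0" "norm z \<le> 1"
  shows "norm (lambert_rem' z) \<le> 1"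
proof -
  define s where "s = exp (z / 2) - exp (- z / 2)"
  have nz: "z \<noteq> 0" using exp_neq_1_Re_pos z by blast
  have half: "exp z = exp (z / 2) * exp (z / 2)" by (simp flip: exp_add)
  have e1: "exp z - 1 = exp (z / 2) * s"
    by (simp add: s_def algebra_simps flip: exp_add)
  have sz: "norm (s - z) \<le> norm z ^ 3 / 4"
  proof -
    have T: "norm (exp w - (1 + w + w\<^sup>2 / 2)) \<le> norm z ^ 3 / 8" if w: "norm w = norm z / 2" for w :: complex
    proof -
      have "norm (exp w - (\<Sum>k\<le>2. w ^ k / fact k)) \<le> exp \<bar>Re w\<bar> * norm w ^ Suc 2 / fact 2"
        by (rule Taylor_exp)
      also have "\<dots> \<le> 2 * norm w ^ Suc 2 / fact 2"
      proof -
        have "\<bar>Re w\<bar> \<le> 1 / 2" using abs_Re_le_cmod[of w] w z by linarith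
        hence "exp \<bar>Re w\<bar> \<le> 2" using exp_bound_half[of "\<bar>Re w\<bar>"] by simp
        thus ?thesis by (intro divide_right_mono mult_right_mono) auto
      qed
      also have "\<dots> = norm z ^ 3 / 8" by (simp add: w power_divide eval_nat_numeral)
      finally show ?thesis by (simp add: eval_nat_numeral)
    qed
    have "s - z = (exp (z / 2) - (1 + z / 2 + (z / 2)\<^sup>2 / 2)) - (exp (- z / 2) - (1 + - z / 2 + (- z / 2)\<^sup>2 / 2))"
      by (simp add: s_def power2_eq_square)
    also have "norm \<dots> \<le> norm z ^ 3 / 8 + norm z ^ 3 / 8"
      by (rule order_trans[OF norm_triangle_ineq4]) (intro add_mono T, simp_all add: norm_divide)
    finally show ?thesis by simp
  qed
  have z3: "norm z ^ 3 \<le> norm z" using z power_decreasing[of 1 3 "norm z"] by simp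
  have s_lo: "norm s \<ge> 3 / 4 * norm z"
    using norm_triangle_ineq2[of z "z - s"] sz z3 by (simp add: norm_minus_commute)
  have s_up: "norm (s + z) \<le> 9 / 4 * norm z"
    using norm_triangle_ineq[of "s - z" "2 * z"] sz z3 by (simp add: norm_mult add.commute)
  have npos: "norm z > 0" using nz by simp
  have s0: "s \<noteq> 0" using s_lo npos by auto
  have "lambert_rem' z = inverse (z\<^sup>2) - inverse (s\<^sup>2)"
    unfolding lambert_rem'_def e1 using half s0 by (simp add: power2_eq_square field_simps)
  also have "\<dots> = (s - z) * (s + z) / (z\<^sup>2 * s\<^sup>2)"
    using nz s0 by (simp add: power2_eq_square field_simps)
  also have "norm \<dots> = norm (s - z) * norm (s + z) / (norm z ^ 2 * norm s ^ 2)"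
    by (simp add: norm_mult norm_divide norm_power)
  also have "\<dots> \<le> (norm z ^ 3 / 4) * (9 / 4 * norm z) / (norm z ^ 2 * (3 / 4 * norm z) ^ 2)"
    using npos s_lo by (intro frac_le mult_mono sz s_up mult_left_mono power_mono mult_pos_pos) auto
  also have "\<dots> = 1" using npos by (simp add: field_simps power_numeral_reduce)
  finally show ?thesis .
qed

text \<open>The quadratic decay is what makes the sums over the multiples of t of order 1/Re t. For
  Re z > 1/2 the two summands give 5/(Re z)^2, and 1 + Re z <= 3 Re z turns the 5 into 45.\<close>

lemma norm_lambert_rem'_le:
  assumes z: "Re z > 0" "\<bar>Im z\<bar> \<le> Re z"
  shows "norm (lambert_rem' z) \<le> 45 / (1 + Re z)\<^sup>2"
proof (cases "Re z \<le> 1 / 2")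
  case True
  have "norm z \<le> 1" using cmod_le[of z] z True by linarith
  hence "norm (lambert_rem' z) \<le> 1" using norm_lambert_rem'_le_1 z by blast
  also have "1 \<le> 45 / (1 + Re z)\<^sup>2"
  proof -
    have "(1 + Re z)\<^sup>2 \<le> (3 / 2)\<^sup>2" using True z by (intro power_mono) auto
    thus ?thesis using z by (simp add: pos_le_divide_eq power2_eq_square)
  qed
  finally show ?thesis .
next
  case False
  define x where "x = Re z"
  have x: "x > 1 / 2" using False by (simp add: x_def)
  have "norm (exp z - 1) \<ge> exp x - 1"
    using norm_triangle_ineq2[of "exp z" 1] by (simp add: x_def)
  moreover have "exp x - 1 \<ge> x / 2 * exp (x / 2)"
  proof -
    have "exp x - 1 = (exp (x / 2) - 1) * (exp (x / 2) + 1)" by (simp add: algebra_simps flip: exp_add)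
    also have "\<dots> \<ge> (x / 2) * exp (x / 2)"
    proof (rule mult_mono)
      show le: "x / 2 \<le> exp (x / 2) - 1" using exp_ge_add_one_self[of "x / 2"] by linarith
      show "0 \<le> exp (x / 2) - 1" using le x by linarith
    qed auto
    finally show ?thesis .
  qed
  ultimately have lo: "norm (exp z - 1) \<ge> x / 2 * exp (x / 2)" by linarith
  have "norm (exp z / (exp z - 1)\<^sup>2) = exp x / norm (exp z - 1) ^ 2"
    by (simp add: norm_divide norm_power x_def)
  also have "\<dots> \<le> exp x / (x / 2 * exp (x / 2)) ^ 2"
    using lo x by (intro divide_left_mono power_mono mult_pos_pos zero_less_power order.strict_trans2[OF _ lo]) auto
  also have "\<dots> = 4 / x\<^sup>2"
    using x by (simp add: power2_eq_square field_simps flip: exp_add)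
  finally have 1: "norm (exp z / (exp z - 1)\<^sup>2) \<le> 4 / x\<^sup>2" .
  have "norm (inverse (z\<^sup>2)) \<le> 1 / x\<^sup>2"
  proof -
    have "x \<le> norm z" unfolding x_def by (rule complex_Re_le_cmod)
    hence "inverse (norm z ^ 2) \<le> inverse (x ^ 2)" using x by (intro le_imp_inverse_le power_mono) auto
    moreover have "norm (inverse (z\<^sup>2)) = inverse (norm z ^ 2)" by (simp only: norm_inverse norm_power)
    ultimately show ?thesis by (simp only: inverse_eq_divide[of "x\<^sup>2"])
  qed
  with 1 have "norm (lambert_rem' z) \<le> 1 / x\<^sup>2 + 4 / x\<^sup>2"
    unfolding lambert_rem'_def by (intro order_trans[OF norm_triangle_ineq4] add_mono)
  also have "\<dots> = 45 / (3 * x)\<^sup>2" by (simp add: power2_eq_square)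
  also have "\<dots> \<le> 45 / (1 + x)\<^sup>2" using x by (intro divide_left_mono power_mono) auto
  finally show ?thesis by (simp add: x_def)
qed

text \<open>Each term is at most a difference of consecutive values of 1/(e (1 + j e)), a discrete
  form of the comparison with the integral of (1 + x)^(-2).\<close>

lemma inverse_square_series_le:
  fixes e :: real
  assumes e: "e > 0"
  shows "summable (\<lambda>j. 1 / (1 + real (Suc j) * e)\<^sup>2)" "(\<Sum>j. 1 / (1 + real (Suc j) * e)\<^sup>2) \<le> 1 / e"
proof -
  define c where "c = (\<lambda>j. 1 / (1 + real j * e) / e)"
  have "c \<longlonglongrightarrow> 0" unfolding c_def using e by real_asymp
  from telescope_sums'[OF this] have tel: "(\<lambda>j. c j - c (Suc j)) sums (1 / e)" by (simp add: c_def)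
  have le: "1 / (1 + real (Suc j) * e)\<^sup>2 \<le> c j - c (Suc j)" for j
  proof -
    define y where "y = 1 + real j * e"
    have y: "y \<ge> 1" using e by (simp add: y_def)
    have y': "1 + real (Suc j) * e = y + e" by (simp add: y_def algebra_simps)
    have "c j - c (Suc j) = 1 / (y * (y + e))"
    proof -
      have "1 / y - 1 / (y + e) = e / (y * (y + e))" using y e by (subst diff_frac_eq) auto
      hence "(1 / y - 1 / (y + e)) / e = 1 / (y * (y + e))" using e by simp
      thus ?thesis unfolding c_def y' y_def[symmetric] by (simp only: diff_divide_distrib)
    qed
    also have "\<dots> \<ge> 1 / ((y + e) * (y + e))"
      using y e by (intro divide_left_mono mult_right_mono mult_pos_pos) auto
    finally show ?thesis unfolding y' by (simp add: power2_eq_square)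
  qed
  show sm: "summable (\<lambda>j. 1 / (1 + real (Suc j) * e)\<^sup>2)"
    by (rule summable_comparison_test'[OF sums_summable[OF tel]]) (use le in simp)
  show "(\<Sum>j. 1 / (1 + real (Suc j) * e)\<^sup>2) \<le> 1 / e"
    using suminf_le[OF le sm sums_summable[OF tel]] sums_unique[OF tel] by simp
qed

text \<open>Along the segment from n Re t to n t the real part is constant, the length n |Im t|
  cancels the weight 1/n, and the derivative bounds sum to O(1/Re t). The term (1/2) log t familiar
  from the modular transformation varies between Re t and t by no more than this error, so it is
  invisible here.\<close>

theorem log_partition_gf_diff:
  fixes t :: complex
  assumes t: "Re t > 0" "\<bar>Im t\<bar> \<le> Re t"
  shows "norm (log_partition_gf t - log_partition_gf (of_real (Re t)) - pi\<^sup>2 / 6 * (1 / t - 1 / of_real (Re t))) \<le> 45 * \<bar>Im t\<bar> / Re t"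
proof -
  define e where "e = Re t"
  define v where "v = (of_real e :: complex)"
  have e: "e > 0" and v: "Re v > 0" using t by (auto simp: e_def v_def)
  define a where "a = (\<lambda>j t :: complex. inverse (of_nat j) * inverse (exp (of_nat j * t) - 1))"
  have head: "(\<lambda>j. a (Suc j) t) sums log_partition_gf t" if "Re t > 0" for t
    unfolding sums_Suc_iff[of "\<lambda>j. a j t"] using summable_sums[OF summable_norm_cancel[OF summable_norm_lambert[OF that]]]
    by (simp add: a_def log_partition_gf_def)
  define R where "R = (\<lambda>j. inverse (of_nat (Suc j)) * (lambert_rem (of_nat (Suc j) * t) - lambert_rem (of_nat (Suc j) * v)))"
  have tv: "t \<noteq> 0" "v \<noteq> 0" using t v by auto
  have basel: "(\<lambda>j. of_real (1 / (real j + 1)\<^sup>2) * (1 / t - 1 / v)) sums (of_real (pi\<^sup>2 / 6) * (1 / t - 1 / v))"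
    using sums_of_real[OF inverse_squares_sums, where ?'a = complex] by (intro sums_mult2) (simp add: add_ac)
  have R_eq: "R j = a (Suc j) t - a (Suc j) v - of_real (1 / (real j + 1)\<^sup>2) * (1 / t - 1 / v)" for j
  proof -
    define n where "n = (of_nat (Suc j) :: complex)"
    have n: "n \<noteq> 0" unfolding n_def by (simp del: of_nat_Suc)
    have "complex_of_real (1 / (real j + 1)\<^sup>2) = 1 / n\<^sup>2" by (simp add: n_def add_ac)
    thus ?thesis unfolding R_def a_def n_def[symmetric] lambert_rem_def
      by (simp only: inverse_mult_distrib divide_inverse power2_eq_square algebra_simps mult_1_left)
  qed
  have sR: "R sums (log_partition_gf t - log_partition_gf v - of_real (pi\<^sup>2 / 6) * (1 / t - 1 / v))"
    unfolding R_eq[abs_def] by (intro sums_diff head basel t v)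
  have bR: "norm (R j) \<le> 45 * \<bar>Im t\<bar> * (1 / (1 + real (Suc j) * e)\<^sup>2)" for j
  proof -
    define n where "n = real (Suc j)"
    have n: "n > 0" by (simp add: n_def)
    define S where "S = closed_segment (of_real n * v) (of_real n * t)"
    have S: "Re w = n * e \<and> \<bar>Im w\<bar> \<le> n * e" if w: "w \<in> S" for w
    proof -
      obtain c where c: "0 \<le> c" "c \<le> 1" "w = (1 - c) *\<^sub>R (of_real n * v) + c *\<^sub>R (of_real n * t)"
        using w unfolding S_def in_segment by auto
      have "Re w = n * e" unfolding c(3) by (simp add: v_def e_def algebra_simps)
      moreover have "\<bar>Im w\<bar> = c * (n * \<bar>Im t\<bar>)" unfolding c(3) using n c by (simp add: v_def abs_mult)
      moreover have "c * (n * \<bar>Im t\<bar>) \<le> 1 * (n * e)"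
        using n c t by (intro mult_mono) (auto simp: e_def)
      ultimately show ?thesis by simp
    qed
    have "norm (lambert_rem (of_real n * t) - lambert_rem (of_real n * v)) \<le> (45 / (1 + n * e)\<^sup>2) * norm (of_real n * t - of_real n * v)"
    proof (rule field_differentiable_bound[of S lambert_rem lambert_rem'])
      fix w assume w: "w \<in> S"
      have pos: "Re w > 0" using S[OF w] n e by simp
      show "(lambert_rem has_field_derivative lambert_rem' w) (at w within S)"
        by (rule has_field_derivative_at_within[OF lambert_rem_deriv[OF pos]])
      show "norm (lambert_rem' w) \<le> 45 / (1 + n * e)\<^sup>2"
        using norm_lambert_rem'_le[OF pos] S[OF w] by simp
    qed (auto simp: S_def)
    also have "of_real n * t - of_real n * v = of_real n * (\<i> * of_real (Im t))"
      by (simp add: v_def e_def complex_eq_iff)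
    also have "norm (of_real n * (\<i> * of_real (Im t))) = n * \<bar>Im t\<bar>" using n by (simp add: norm_mult)
    finally have A: "inverse n * norm (lambert_rem (of_real n * t) - lambert_rem (of_real n * v)) \<le> inverse n * ((45 / (1 + n * e)\<^sup>2) * (n * \<bar>Im t\<bar>))"
      using n by (intro mult_left_mono) auto
    have B: "norm (R j) = inverse n * norm (lambert_rem (of_real n * t) - lambert_rem (of_real n * v))"
      unfolding R_def n_def norm_mult norm_inverse by (simp only: norm_of_nat of_real_of_nat_eq)
    have C: "inverse n * ((45 / (1 + n * e)\<^sup>2) * (n * \<bar>Im t\<bar>)) = 45 * \<bar>Im t\<bar> * (1 / (1 + n * e)\<^sup>2)"
      using n by (simp add: field_simps)
    show ?thesis using A unfolding B[symmetric] C unfolding n_def .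
  qed
  note ser = inverse_square_series_le[OF e]
  have sb: "summable (\<lambda>j. 45 * \<bar>Im t\<bar> * (1 / (1 + real (Suc j) * e)\<^sup>2))" by (intro summable_mult ser)
  have sn: "summable (\<lambda>j. norm (R j))" by (rule summable_comparison_test'[OF sb]) (use bR in simp)
  have "norm (suminf R) \<le> (\<Sum>j. norm (R j))" by (rule summable_norm[OF sn])
  also have "\<dots> \<le> (\<Sum>j. 45 * \<bar>Im t\<bar> * (1 / (1 + real (Suc j) * e)\<^sup>2))" by (rule suminf_le[OF bR sn sb])
  also have "\<dots> = 45 * \<bar>Im t\<bar> * (\<Sum>j. 1 / (1 + real (Suc j) * e)\<^sup>2)" by (rule suminf_mult[OF ser(1)])
  also have "\<dots> \<le> 45 * \<bar>Im t\<bar> * (1 / e)" by (intro mult_left_mono ser) auto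
  finally have "norm (suminf R) \<le> 45 * \<bar>Im t\<bar> / e" by simp
  thus ?thesis unfolding sums_unique[OF sR, symmetric] by (simp add: e_def v_def)
qed

section \<open>Decay away from the real axis\<close>

text \<open>Since |e^(jt) - 1| >= e^(j Re t) - 1, every term of the Lambert series has its largest
  real part on the real axis. All deficits are nonnegative, and the one at j = 1 is kept.\<close>

theorem Re_log_partition_gf_le:
  fixes t :: complex
  assumes t: "Re t > 0"
  shows "Re (log_partition_gf t) \<le> Re (log_partition_gf (of_real (Re t)))
     - (Re (inverse (exp (of_real (Re t)) - 1)) - Re (inverse (exp t - 1)))"
proof -
  define v where "v = (of_real (Re t) :: complex)"
  have v: "Re v > 0" using t by (simp add: v_def)
  define a where "a = (\<lambda>j t :: complex. inverse (of_nat j) * inverse (exp (of_nat j * t) - 1))"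
  have sums: "(\<lambda>j. a (Suc j) t) sums log_partition_gf t" if "Re t > 0" for t
    unfolding sums_Suc_iff[of "\<lambda>j. a j t"] using summable_sums[OF summable_norm_cancel[OF summable_norm_lambert[OF that]]]
    by (simp add: a_def log_partition_gf_def)
  have d: "(\<lambda>j. Re (a (Suc j) v - a (Suc j) t)) sums Re (log_partition_gf v - log_partition_gf t)"
    by (intro sums_Re sums_diff sums t v)
  have nn: "Re (a j v - a j t) \<ge> 0" for j
  proof (cases "j = 0")
    case False
    define r where "r = exp (real j * Re t)"
    have r: "r > 1" using False t by (simp add: r_def)
    have nr: "norm (exp (of_nat j * t)) = r" by (simp add: r_def)
    have "Re (inverse (exp (of_nat j * t) - 1)) \<le> norm (inverse (exp (of_nat j * t) - 1))" by (rule complex_Re_le_cmod)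
    also have "\<dots> \<le> inverse (r - 1)"
      unfolding norm_inverse
    proof (rule le_imp_inverse_le)
      show "r - 1 \<le> norm (exp (of_nat j * t) - 1)"
        using norm_triangle_ineq2[of "exp (of_nat j * t)" 1] nr by simp
    qed (use r in simp)
    also have "inverse (r - 1) = Re (inverse (exp (of_nat j * v) - 1))"
    proof -
      have "exp (of_nat j * v) - 1 = of_real (r - 1)" by (simp add: v_def r_def flip: exp_of_real)
      thus ?thesis by (simp only: of_real_inverse[symmetric] Re_complex_of_real)
    qed
    finally have "inverse (real j) * Re (inverse (exp (of_nat j * t) - 1)) \<le> inverse (real j) * Re (inverse (exp (of_nat j * v) - 1))"
      by (intro mult_left_mono) auto
    moreover have R: "Re (inverse (of_nat j) * w) = inverse (real j) * Re w" for w :: complex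
    proof -
      have "inverse (of_nat j) = complex_of_real (inverse (real j))" by simp
      thus ?thesis by (metis Re_complex_of_real Im_complex_of_real diff_zero mult_zero_left times_complex.sel(1))
    qed
    ultimately show ?thesis unfolding a_def minus_complex.sel R by (simp only: diff_ge_0_iff_ge)
  qed (simp add: a_def)
  have "(\<Sum>j<1. Re (a (Suc j) v - a (Suc j) t)) \<le> Re (log_partition_gf v - log_partition_gf t)"
    using sum_le_suminf[OF sums_summable[OF d], of "{..<1}"] nn sums_unique[OF d] by simp
  thus ?thesis by (simp add: a_def v_def)
qed

text \<open>The fourth-order Taylor bound together with x^2 <= 10, which holds as pi <= 3.15: 1/2 -
  10/24 = 1/12.\<close>

lemma one_minus_cos_ge:
  fixes x :: real
  assumes "\<bar>x\<bar> \<le> pi"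
  shows "1 - cos x \<ge> x\<^sup>2 / 12"
proof -
  obtain t where "cos x = (\<Sum>m<4. cos_coeff m * x ^ m) + (cos (t + 1 / 2 * real 4 * pi) / fact 4) * x ^ 4"
    using Maclaurin_cos_expansion[of x 4] by blast
  also have "(\<Sum>m<4. cos_coeff m * x ^ m) = 1 - x\<^sup>2 / 2"
    by (simp add: eval_nat_numeral cos_coeff_def) presburger
  also have "(cos (t + 1 / 2 * real 4 * pi) / fact 4) * x ^ 4 \<le> (1 / fact 4) * x ^ 4"
    by (intro mult_right_mono divide_right_mono) auto
  finally have 1: "cos x \<le> 1 - x\<^sup>2 / 2 + x ^ 4 / 24" by (simp add: fact_numeral)
  have "pi \<le> 3.15" using pi_approx by simp
  hence "\<bar>x\<bar> \<le> 3.15" using assms by linarith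
  hence "\<bar>x\<bar>\<^sup>2 \<le> 3.15\<^sup>2" by (intro power_mono) auto
  hence "x\<^sup>2 \<le> 10" by (simp add: power2_eq_square)
  hence "x\<^sup>2 * x\<^sup>2 \<le> 10 * x\<^sup>2" by (intro mult_right_mono) auto
  moreover have "x ^ 4 = x\<^sup>2 * x\<^sup>2" by (simp add: power2_eq_square eval_nat_numeral)
  ultimately show ?thesis using 1 by linarith
qed

text \<open>In the Lambert series only the first term is needed to see that the generating function is
  exponentially smaller away from the real axis.\<close>
lemma Re_inverse_exp_diff_ge:
  fixes t :: complex
  assumes t: "0 < Re t" "Re t \<le> 1 / 2" and th: "\<bar>Im t\<bar> \<le> pi"
  shows "Re (inverse (exp (of_real (Re t)) - 1)) - Re (inverse (exp t - 1)) \<ge> (Im t)\<^sup>2 / (50 * Re t * ((Re t)\<^sup>2 + (Im t)\<^sup>2))"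
proof -
  define e where "e = Re t"
  define \<theta> where "\<theta> = Im t"
  define E where "E = exp e"
  define w where "w = 1 - cos \<theta>"
  \<comment> \<open>This is |e^t - 1|^2, arranged so that both summands are visibly
    nonnegative.\<close>
  define D where "D = (E - 1)\<^sup>2 + 2 * (E * w)"
  have e: "0 < e" "e \<le> 1 / 2" using t by (auto simp: e_def)
  have E1: "E > 1" using e by (simp add: E_def)
  have E2: "E - 1 \<le> 2 * e"
  proof -
    have "1 - e \<le> exp (- e)" using exp_ge_add_one_self[of "- e"] by simp
    hence "E * (1 - e) \<le> 1" using mult_left_mono[of "1 - e" "exp (- e)" E] E1 by (simp add: E_def flip: exp_add)
    hence "E - 1 \<le> E * e" by (simp add: algebra_simps)
    moreover have "E * (1 / 2) \<le> E * (1 - e)" using e E1 by (intro mult_left_mono) auto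
    hence "E \<le> 2" using \<open>E * (1 - e) \<le> 1\<close> by linarith
    hence "E * e \<le> 2 * e" using e by (intro mult_right_mono) auto
    ultimately show ?thesis by linarith
  qed
  have w: "w \<ge> \<theta>\<^sup>2 / 12" unfolding w_def using one_minus_cos_ge th by (simp add: \<theta>_def)
  have w0: "w \<ge> 0" by (simp add: w_def)
  have Dpos: "D > 0" unfolding D_def using E1 w0 by (intro add_pos_nonneg) auto
  have sc: "(sin \<theta>)\<^sup>2 = 1 - (cos \<theta>)\<^sup>2" using sin_cos_squared_add[of \<theta>] by linarith
  have Dn: "(E * cos \<theta> - 1)\<^sup>2 + (E * sin \<theta>)\<^sup>2 = D"
    unfolding power_mult_distrib sc D_def w_def by (simp add: power2_eq_square algebra_simps)
  have I2: "Re (inverse (exp t - 1)) = (E * cos \<theta> - 1) / D"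
    using Dn by (simp add: Re_exp Im_exp E_def e_def \<theta>_def)
  have I1: "Re (inverse (exp (of_real (Re t)) - 1)) = 1 / (E - 1)"
  proof -
    have "inverse (exp (of_real (Re t)) - 1) = complex_of_real (inverse (E - 1))"
      by (simp add: E_def e_def flip: exp_of_real)
    thus ?thesis by (simp add: inverse_eq_divide)
  qed
  have num: "D - (E * cos \<theta> - 1) * (E - 1) = E * w * (E + 1)"
    unfolding D_def w_def by (simp add: power2_eq_square algebra_simps)
  have "Re (inverse (exp (of_real (Re t)) - 1)) - Re (inverse (exp t - 1)) = E * w * (E + 1) / ((E - 1) * D)"
    unfolding I1 I2 num[symmetric] using E1 Dpos by (subst diff_frac_eq) auto
  also have "\<dots> \<ge> (2 * (E * w)) / ((E - 1) * D)"
  proof (rule divide_right_mono)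
    have "E * w * 2 \<le> E * w * (E + 1)" using E1 w0 by (intro mult_left_mono) auto
    thus "2 * (E * w) \<le> E * w * (E + 1)" by simp
  qed (use E1 Dpos in auto)
  also have "(2 * (E * w)) / ((E - 1) * D) = (2 * (E * w)) / D / (E - 1)" by simp
  also have "(2 * (E * w)) / D / (E - 1) \<ge> (2 * (E * w)) / D / (2 * e)"
    using E1 E2 Dpos w0 e by (intro divide_left_mono mult_pos_pos divide_nonneg_pos) auto
  also have "(2 * (E * w)) / D / (2 * e) \<ge> (\<theta>\<^sup>2 / (25 * (e\<^sup>2 + \<theta>\<^sup>2))) / (2 * e)"
  proof (rule divide_right_mono)
    define A where "A = (E - 1)\<^sup>2"
    define p where "p = E * w"
    have A: "0 \<le> A" "A \<le> 4 * e\<^sup>2"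
      using power_mono[OF E2, of 2] E1 by (auto simp: A_def power2_eq_square)
    have "1 * w \<le> p" unfolding p_def using E1 w0 by (intro mult_right_mono) auto
    hence p: "p \<ge> \<theta>\<^sup>2 / 12" using w by linarith
    have "\<theta>\<^sup>2 * (A + 2 * p) \<le> 2 * p * (25 * (e\<^sup>2 + \<theta>\<^sup>2))"
    proof -
      have "\<theta>\<^sup>2 * A \<le> \<theta>\<^sup>2 * (4 * e\<^sup>2)" using A by (intro mult_left_mono) auto
      moreover have "(\<theta>\<^sup>2 / 12) * (48 * e\<^sup>2) \<le> p * (48 * e\<^sup>2)" using p by (intro mult_right_mono) auto
      moreover have "0 \<le> p" using p order_trans[of 0 "\<theta>\<^sup>2 / 12" p] by simp
      hence "0 \<le> p * \<theta>\<^sup>2" "0 \<le> p * e\<^sup>2" by simp_all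
      ultimately show ?thesis by (simp add: algebra_simps)
    qed
    moreover have "A + 2 * p > 0" using Dpos by (simp add: D_def A_def p_def)
    moreover have "25 * (e\<^sup>2 + \<theta>\<^sup>2) > 0" using e by (simp add: add_pos_nonneg)
    ultimately have "\<theta>\<^sup>2 / (25 * (e\<^sup>2 + \<theta>\<^sup>2)) \<le> 2 * p / (A + 2 * p)"
      by (simp add: divide_le_eq pos_le_divide_eq mult.commute)
    thus "\<theta>\<^sup>2 / (25 * (e\<^sup>2 + \<theta>\<^sup>2)) \<le> 2 * (E * w) / D"
      by (simp add: D_def A_def p_def)
  qed (use e in auto)
  finally show ?thesis by (simp add: e_def \<theta>_def mult_ac)
qed

section \<open>Behaviour on the real axis\<close>

text \<open>The dilogarithm of e^(-x), with a vanishing term at k = 0 since 1 / 0 = 0. It is an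
  antiderivative of ln (1 - e^(-x)), and its limit pi^2/6 at 0 is the source of the main
  term.\<close>

definition dilog_exp :: "real \<Rightarrow> real" where
  "dilog_exp x = (\<Sum>k. 1 / real k ^ 2 * exp (- x) ^ k)"

lemma inverse_squares_sums': "(\<lambda>k. 1 / real k ^ 2) sums (pi\<^sup>2 / 6)"
proof -
  have "(\<lambda>k. 1 / real (Suc k) ^ 2) sums (pi\<^sup>2 / 6)" using inverse_squares_sums by (simp add: add.commute)
  thus ?thesis using sums_Suc_iff[of "\<lambda>k. 1 / real k ^ 2"] by simp
qed

lemma dilog_exp_deriv:
  assumes x: "x > 0"
  shows "(dilog_exp has_real_derivative ln (1 - exp (- x))) (at x)"
proof -
  define Li where "Li = (\<lambda>y :: real. \<Sum>k. 1 / real k ^ 2 * y ^ k)"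
  define y where "y = exp (- x)"
  have y: "0 < y" "y < 1" using x by (auto simp: y_def)
  have dc: "diffs (\<lambda>k. 1 / real k ^ 2) = (\<lambda>k. 1 / (real k + 1))"
    by (rule ext) (simp add: diffs_def power2_eq_square add.commute)
  have "(Li has_field_derivative (\<Sum>k. diffs (\<lambda>k. 1 / real k ^ 2) k * y ^ k)) (at y)"
    unfolding Li_def
  proof (rule termdiffs_strong')
    fix z :: real assume z: "norm z < 1"
    show "summable (\<lambda>k. 1 / real k ^ 2 * z ^ k)"
    proof (rule summable_comparison_test'[OF sums_summable[OF inverse_squares_sums']])
      fix k :: nat
      have "\<bar>z\<bar> ^ k \<le> 1" using z by (intro power_le_one) auto
      hence "1 / real k ^ 2 * \<bar>z\<bar> ^ k \<le> 1 / real k ^ 2 * 1" by (intro mult_left_mono) auto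
      thus "norm (1 / real k ^ 2 * z ^ k) \<le> 1 / real k ^ 2" by (simp add: abs_mult power_abs)
    qed
  qed (use y in simp)
  hence D: "(Li has_field_derivative (\<Sum>k. 1 / (real k + 1) * y ^ k)) (at y)" unfolding dc .
  have "summable (\<lambda>k. 1 / (real k + 1) * y ^ k)"
  proof (rule summable_comparison_test'[OF summable_geometric[of y]])
    fix k :: nat
    have "1 / (real k + 1) * y ^ k \<le> 1 * y ^ k" using y by (intro mult_right_mono) auto
    thus "norm (1 / (real k + 1) * y ^ k) \<le> y ^ k" using y by simp
  qed (use y in simp)
  hence "(\<Sum>k. 1 / (real k + 1) * y ^ k) * - y = (\<Sum>k. 1 / (real k + 1) * y ^ k * - y)"
    by (rule suminf_mult2)
  also have "\<dots> = (\<Sum>k. (- 1) ^ k * (1 / real (k + 1)) * (1 - y - 1) ^ Suc k)"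
  proof (rule suminf_cong)
    fix k
    have "(1 - y - 1) ^ Suc k = - ((- 1) ^ k * y ^ k * y)" by (simp add: power_minus[of y])
    thus "1 / (real k + 1) * y ^ k * - y = (- 1) ^ k * (1 / real (k + 1)) * (1 - y - 1) ^ Suc k"
      by (simp add: add.commute flip: power_mult_distrib)
  qed
  also have "\<dots> = ln (1 - y)" by (rule ln_series[symmetric]) (use y in auto)
  finally have val: "(\<Sum>k. 1 / (real k + 1) * y ^ k) * - y = ln (1 - y)" .
  have "((\<lambda>x. exp (- x)) has_real_derivative - y) (at x)"
    unfolding y_def by (auto intro!: derivative_eq_intros)
  from DERIV_chain'[OF this D[unfolded y_def]]
  have "((\<lambda>x. Li (exp (- x))) has_real_derivative (\<Sum>k. 1 / (real k + 1) * exp (- x) ^ k) * - y) (at x)" .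
  thus ?thesis using val unfolding dilog_exp_def[abs_def] Li_def y_def by simp
qed

lemma dilog_exp_bound:
  assumes "x \<ge> 0"
  shows "0 \<le> dilog_exp x" "dilog_exp x \<le> exp (- x) * (pi\<^sup>2 / 6)"
proof -
  have le: "1 / real k ^ 2 * exp (- x) ^ k \<le> exp (- x) * (1 / real k ^ 2)" for k
  proof (cases "k = 0")
    case False
    hence "exp (- x) ^ k \<le> exp (- x) ^ 1" using assms by (intro power_decreasing) auto
    thus ?thesis by (simp add: divide_right_mono)
  qed simp
  have sm: "summable (\<lambda>k. 1 / real k ^ 2 * exp (- x) ^ k)"
    by (rule summable_comparison_test'[OF summable_mult[OF sums_summable[OF inverse_squares_sums'], of "exp (- x)"]])
       (use le in simp)
  show "0 \<le> dilog_exp x" unfolding dilog_exp_def by (rule suminf_nonneg[OF sm]) simp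
  have "dilog_exp x \<le> (\<Sum>k. exp (- x) * (1 / real k ^ 2))"
    unfolding dilog_exp_def
    by (rule suminf_le[OF le sm summable_mult[OF sums_summable[OF inverse_squares_sums']]])
  also have "\<dots> = exp (- x) * (pi\<^sup>2 / 6)"
    using sums_unique[OF sums_mult[OF inverse_squares_sums', of "exp (- x)"]] by simp
  finally show "dilog_exp x \<le> exp (- x) * (pi\<^sup>2 / 6)" .
qed

lemma dilog_exp_tendsto_0: "(dilog_exp \<longlongrightarrow> pi\<^sup>2 / 6) (at_right 0)"
proof -
  have "((\<lambda>x. \<Sum>k. 1 / real k ^ 2 * exp (- x) ^ k) \<longlongrightarrow> (\<Sum>k. 1 / real k ^ 2)) (at_right (0 :: real))"
  proof (rule conjunct2[OF conjunct2[OF tannerys_theorem]])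
    show "((\<lambda>x. 1 / real k ^ 2 * exp (- x) ^ k) \<longlongrightarrow> 1 / real k ^ 2) (at_right 0)" for k
    proof -
      have "((\<lambda>x :: real. 1 / real k ^ 2 * exp (- x) ^ k) \<longlongrightarrow> 1 / real k ^ 2 * exp (- 0) ^ k) (at_right 0)"
        by (intro tendsto_intros)
      thus ?thesis by simp
    qed
    have "\<forall>\<^sub>F x in at_right (0 :: real). \<forall>k. norm (1 / real k ^ 2 * exp (- x) ^ k) \<le> 1 / real k ^ 2"
      using eventually_at_right_less[of "0 :: real"]
    proof eventually_elim
      case (elim x)
      have "exp (- x) ^ k \<le> 1" for k using elim by (intro power_le_one) auto
      thus ?case by (auto intro!: divide_right_mono simp: abs_mult)
    qed
    hence "\<forall>\<^sub>F (k, x) in sequentially \<times>\<^sub>F at_right (0 :: real). \<forall>k. norm (1 / real k ^ 2 * exp (- x) ^ k) \<le> 1 / real k ^ 2"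
      by (subst eventually_prod2) auto
    thus "\<forall>\<^sub>F (k, x) in sequentially \<times>\<^sub>F at_right (0 :: real). norm (1 / real k ^ 2 * exp (- x) ^ k) \<le> 1 / real k ^ 2"
      by eventually_elim auto
    show "summable (\<lambda>k. 1 / real k ^ 2)" using inverse_squares_sums' by (rule sums_summable)
  qed simp
  thus ?thesis unfolding dilog_exp_def[abs_def] sums_unique[OF inverse_squares_sums', symmetric] .
qed

text \<open>The logarithmic singularity of \<open>- ln (1 - e\<^bsup>-x\<^esup>)\<close> at 0 is removed, so that the trapezoidal rule applies;
  the removed terms sum to \<open>ln (M!)\<close> and are recovered by Stirling's formula.\<close>
definition log_ratio :: "real \<Rightarrow> real" where
  "log_ratio x = ln x - ln (1 - exp (- x))"

definition log_ratio_int :: "real \<Rightarrow> real" where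
  "log_ratio_int x = x * ln x - x - dilog_exp x"

lemma log_ratio_int_deriv:
  assumes "x > 0"
  shows "(log_ratio_int has_real_derivative log_ratio x) (at x)"
  unfolding log_ratio_int_def[abs_def] log_ratio_def
  using assms by (auto intro!: derivative_eq_intros dilog_exp_deriv)

lemma log_ratio_deriv:
  assumes "x > 0"
  shows "(log_ratio has_real_derivative 1 / x - 1 / (exp x - 1)) (at x)"
proof -
  have e: "exp (- x) / (1 - exp (- x)) = 1 / (exp x - 1)" using assms by (simp add: exp_minus field_simps)
  have "(log_ratio has_real_derivative 1 / x - exp (- x) / (1 - exp (- x))) (at x)"
    unfolding log_ratio_def[abs_def] using assms by (auto intro!: derivative_eq_intros)
  thus ?thesis unfolding e .
qed

text \<open>The second derivative of \<open>log_ratio\<close> is the negative of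
  \<open>lambert_rem'\<close> on the positive axis, so the earlier bound carries over.\<close>

lemma log_ratio_deriv2:
  assumes x: "x > 0"
  shows "((\<lambda>x. 1 / x - 1 / (exp x - 1)) has_real_derivative exp x / (exp x - 1)\<^sup>2 - 1 / x\<^sup>2) (at x)"
    and "\<bar>exp x / (exp x - 1)\<^sup>2 - 1 / x\<^sup>2\<bar> \<le> 45 / (1 + x)\<^sup>2"
proof -
  show "((\<lambda>x. 1 / x - 1 / (exp x - 1)) has_real_derivative exp x / (exp x - 1)\<^sup>2 - 1 / x\<^sup>2) (at x)"
    using x by (auto intro!: derivative_eq_intros simp: power2_eq_square)
  have "lambert_rem' (of_real x) = of_real (1 / x\<^sup>2 - exp x / (exp x - 1)\<^sup>2)"
    by (simp add: lambert_rem'_def inverse_eq_divide exp_of_real)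
  hence "norm (lambert_rem' (of_real x)) = \<bar>1 / x\<^sup>2 - exp x / (exp x - 1)\<^sup>2\<bar>" by (simp only: norm_of_real)
  moreover have "norm (lambert_rem' (of_real x)) \<le> 45 / (1 + x)\<^sup>2"
    using norm_lambert_rem'_le[of "of_real x"] x by simp
  ultimately show "\<bar>exp x / (exp x - 1)\<^sup>2 - 1 / x\<^sup>2\<bar> \<le> 45 / (1 + x)\<^sup>2" by (simp add: abs_minus_commute)
qed

lemma log_ratio_bounds:
  assumes x: "x > 0"
  shows "0 \<le> log_ratio x" "log_ratio x \<le> x"
proof -
  have p: "1 - exp (- x) > 0" using x by simp
  have "1 - exp (- x) \<le> x" using exp_ge_add_one_self[of "- x"] by linarith
  thus "0 \<le> log_ratio x" unfolding log_ratio_def using p x by simp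
  have "x * exp (- x) \<le> 1 - exp (- x)"
    using mult_right_mono[OF exp_ge_add_one_self[of x], of "exp (- x)"] by (simp add: algebra_simps flip: exp_add)
  hence "ln (x * exp (- x)) \<le> ln (1 - exp (- x))" using p x by (subst ln_le_cancel_iff) auto
  thus "log_ratio x \<le> x" unfolding log_ratio_def using x by (simp add: ln_mult_pos)
qed

text \<open>The mean value inequality on [d, e], where \<open>log_ratio\<close> is at most e, as d
  tends to 0 from the right.\<close>

lemma log_ratio_int_near_0:
  assumes e: "e > 0"
  shows "\<bar>log_ratio_int e + pi\<^sup>2 / 6\<bar> \<le> e\<^sup>2"
proof -
  have lim: "(log_ratio_int \<longlongrightarrow> - (pi\<^sup>2 / 6)) (at_right 0)"
  proof -
    have "((\<lambda>x :: real. x * ln x - x) \<longlongrightarrow> 0) (at_right 0)" by real_asymp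
    from tendsto_diff[OF this dilog_exp_tendsto_0] show ?thesis unfolding log_ratio_int_def[abs_def] by simp
  qed
  have "((\<lambda>d. norm (log_ratio_int e - log_ratio_int d)) \<longlongrightarrow> norm (log_ratio_int e - - (pi\<^sup>2 / 6))) (at_right 0)"
    by (intro tendsto_intros lim)
  moreover have "\<forall>\<^sub>F d in at_right 0. norm (log_ratio_int e - log_ratio_int d) \<le> e\<^sup>2"
  proof -
    have "\<forall>\<^sub>F d in at_right (0 :: real). 0 < d \<and> d < e"
      using e by (intro eventually_conj eventually_at_right_less) (auto simp: eventually_at_right_field)
    thus ?thesis
    proof eventually_elim
      case (elim d)
      have "norm (log_ratio_int e - log_ratio_int d) \<le> e * norm (e - d)"
      proof (rule field_differentiable_bound[of "{d..e}" log_ratio_int log_ratio])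
        fix z assume z: "z \<in> {d..e}"
        hence z0: "z > 0" using elim by simp
        show "(log_ratio_int has_field_derivative log_ratio z) (at z within {d..e})"
          by (rule has_field_derivative_at_within[OF log_ratio_int_deriv[OF z0]])
        show "norm (log_ratio z) \<le> e" using log_ratio_bounds[OF z0] z by simp
      qed (use elim in auto)
      also have "\<dots> \<le> e * e" using elim by (intro mult_left_mono) auto
      finally show ?case by (simp add: power2_eq_square)
    qed
  qed
  ultimately have "norm (log_ratio_int e - - (pi\<^sup>2 / 6)) \<le> e\<^sup>2"
    by (rule tendsto_upperbound) simp
  thus ?thesis by simp
qed

text \<open>The local errors 45 e^3/(1 + k e)^2 add up to O(e^2). The sum starts at e because the
  formula for \<open>log_ratio\<close> is singular at 0; the interval from 0 to e is covered by
  \<open>log_ratio_int_near_0\<close>.\<close>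

lemma trapezoid_log_ratio:
  assumes e: "e > 0"
  shows "\<bar>log_ratio_int (real (Suc N) * e) - log_ratio_int e - e * ((\<Sum>k=1..Suc N. log_ratio (real k * e))
    - (log_ratio e + log_ratio (real (Suc N) * e)) / 2)\<bar> \<le> 45 * e\<^sup>2"
proof -
  have one: "\<bar>log_ratio_int (real (Suc k) * e + e) - log_ratio_int (real (Suc k) * e) - 
      e * (log_ratio (real (Suc k) * e) + log_ratio (real (Suc k) * e + e)) / 2\<bar> \<le> 45 / (1 + real (Suc k) * e)\<^sup>2 * e ^ 3" for k
  proof (rule trapezoid_error[where k = "\<lambda>x. 1 / x - 1 / (exp x - 1)" and k' = "\<lambda>x. exp x / (exp x - 1)\<^sup>2 - 1 / x\<^sup>2"])
    fix x assume x: "real (Suc k) * e \<le> x" "x \<le> real (Suc k) * e + e"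
    have p: "0 < real (Suc k) * e" using e by simp
    have x0: "x > 0" using x p by linarith
    show "(log_ratio_int has_real_derivative log_ratio x) (at x)" by (rule log_ratio_int_deriv[OF x0])
    show "(log_ratio has_real_derivative 1 / x - 1 / (exp x - 1)) (at x)" by (rule log_ratio_deriv[OF x0])
    show "((\<lambda>x. 1 / x - 1 / (exp x - 1)) has_real_derivative exp x / (exp x - 1)\<^sup>2 - 1 / x\<^sup>2) (at x)"
      by (rule log_ratio_deriv2[OF x0])
    have "\<bar>exp x / (exp x - 1)\<^sup>2 - 1 / x\<^sup>2\<bar> \<le> 45 / (1 + x)\<^sup>2" by (rule log_ratio_deriv2[OF x0])
    also have "\<dots> \<le> 45 / (1 + real (Suc k) * e)\<^sup>2" using x p by (intro divide_left_mono power_mono) auto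
    finally show "\<bar>exp x / (exp x - 1)\<^sup>2 - 1 / x\<^sup>2\<bar> \<le> 45 / (1 + real (Suc k) * e)\<^sup>2" .
  qed (use e in auto)
  have "\<bar>log_ratio_int (real (Suc N) * e) - log_ratio_int e - e * ((\<Sum>k=1..Suc N. log_ratio (real k * e))
    - (log_ratio e + log_ratio (real (Suc N) * e)) / 2)\<bar> \<le> 45 * e ^ 3 * (\<Sum>k<N. 1 / (1 + real (Suc k) * e)\<^sup>2)"
  proof (induction N)
    case (Suc N)
    have sh: "real (Suc (Suc N)) * e = real (Suc N) * e + e" by (simp add: algebra_simps)
    have "log_ratio_int (real (Suc (Suc N)) * e) - log_ratio_int e - e * ((\<Sum>k=1..Suc (Suc N). log_ratio (real k * e))
      - (log_ratio e + log_ratio (real (Suc (Suc N)) * e)) / 2) = 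
      (log_ratio_int (real (Suc N) * e) - log_ratio_int e - e * ((\<Sum>k=1..Suc N. log_ratio (real k * e))
        - (log_ratio e + log_ratio (real (Suc N) * e)) / 2)) + 
      (log_ratio_int (real (Suc N) * e + e) - log_ratio_int (real (Suc N) * e) - 
        e * (log_ratio (real (Suc N) * e) + log_ratio (real (Suc N) * e + e)) / 2)"
    proof -
      have "(\<Sum>k=1..Suc (Suc N). log_ratio (real k * e)) = (\<Sum>k=1..Suc N. log_ratio (real k * e)) + log_ratio (real (Suc N) * e + e)"
        unfolding sh[symmetric] by simp
      moreover have "H2 - H0 - e * ((G + g2) - (g0 + g2) / 2) = (H1 - H0 - e * (G - (g0 + g1) / 2)) + (H2 - H1 - e * (g1 + g2) / 2)"
        for H0 H1 H2 G g0 g1 g2 :: real by (simp add: field_simps)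
      ultimately show ?thesis unfolding sh by (simp only:)
    qed
    also have "\<bar>\<dots>\<bar> \<le> 45 * e ^ 3 * (\<Sum>k<N. 1 / (1 + real (Suc k) * e)\<^sup>2) + 45 / (1 + real (Suc N) * e)\<^sup>2 * e ^ 3"
      by (intro order_trans[OF abs_triangle_ineq] add_mono Suc.IH one)
    also have "\<dots> = 45 * e ^ 3 * (\<Sum>k<Suc N. 1 / (1 + real (Suc k) * e)\<^sup>2)"
      by (simp add: distrib_left)
    finally show ?case .
  qed simp
  also have "\<dots> \<le> 45 * e ^ 3 * (1 / e)"
  proof (rule mult_left_mono)
    note ser = inverse_square_series_le[OF e]
    show "(\<Sum>k<N. 1 / (1 + real (Suc k) * e)\<^sup>2) \<le> 1 / e"
      using order_trans[OF sum_le_suminf[OF ser(1), of "{..<N}"] ser(2)] by simp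
  qed (use e in auto)
  also have "\<dots> = 45 * e\<^sup>2" using e by (simp add: power_numeral_reduce)
  finally show ?thesis .
qed

text \<open>Euler-Maclaurin summation of -ln (1 - e^(-ke)) over k <= M, with M tending to infinity.
  The logarithms split off in \<open>log_ratio\<close> sum to a factorial, and Stirling's formula
  cancels it against the growing part of \<open>log_ratio_int\<close>. The trapezoidal rule
  contributes 45 e to the error, the lower endpoint at most 2 e.\<close>

theorem log_partition_gf_real_asymp:
  assumes e: "e > 0"
  shows "\<bar>Re (log_partition_gf (of_real e)) - (pi\<^sup>2 / (6 * e) + ln e / 2 - ln (2 * pi) / 2)\<bar> \<le> 47 * e"
proof -
  define q where "q = exp (- complex_of_real e)"
  have q: "norm q < 1" using e by (simp add: q_def)
  define S where "S = (\<lambda>M. - (\<Sum>k=1..M. ln (1 - exp (- (real k * e)))))"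
  have Slim: "S \<longlonglongrightarrow> Re (log_partition_gf (of_real e))"
  proof -
    have pos: "1 - exp (- (real k * e)) > 0" if "k \<ge> 1" for k
      using that e by simp
    have "norm (inverse (qpoch q M)) = exp (S M)" for M
    proof -
      have n1: "norm (1 - q ^ k) = 1 - exp (- (real k * e))" if "k \<ge> 1" for k
      proof -
        have "q ^ k = of_real (exp (- (real k * e)))"
        proof -
          have "q ^ k = exp (of_real (- (real k * e)))" by (simp add: q_def flip: exp_of_nat_mult)
          thus ?thesis by (simp only: exp_of_real)
        qed
        hence "1 - q ^ k = of_real (1 - exp (- (real k * e)))" by simp
        hence "norm (1 - q ^ k) = \<bar>1 - exp (- (real k * e))\<bar>" by (simp only: norm_of_real)
        thus ?thesis using pos[OF that] by simp
      qed
      have "exp (S M) = inverse (\<Prod>k=1..M. exp (ln (1 - exp (- (real k * e)))))"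
        by (simp add: S_def exp_minus exp_sum)
      also have "(\<Prod>k=1..M. exp (ln (1 - exp (- (real k * e))))) = (\<Prod>k=1..M. norm (1 - q ^ k))"
        using pos by (intro prod.cong) (auto simp: n1)
      finally show ?thesis by (simp add: qpoch_def norm_inverse prod_norm)
    qed
    hence "(\<lambda>M. exp (S M)) \<longlonglongrightarrow> norm (partition_gf q)"
      using tendsto_norm[OF inverse_qpoch_tendsto[OF q]] by simp
    also have "norm (partition_gf q) = exp (Re (log_partition_gf (of_real e)))"
      using partition_gf_eq_exp[of "of_real e"] e by (simp add: q_def)
    finally have "(\<lambda>M. ln (exp (S M))) \<longlonglongrightarrow> ln (exp (Re (log_partition_gf (of_real e))))"
      by (intro tendsto_ln) auto
    thus ?thesis by simp
  qed
  define s where "s = (\<lambda>n. ln (fact n) - (real n + 1 / 2) * ln (real n) + real n)"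
  \<comment> \<open>\<open>R\<close> collects the contributions of the upper endpoint and of the
    factorial, \<open>K\<close> those of the lower endpoint.\<close>
  define R where "R = (\<lambda>M. - dilog_exp (real M * e) / e - s M + ln e / 2 - ln (1 - exp (- (real M * e))) / 2)"
  define K where "K = log_ratio e / 2 - log_ratio_int e / e"
  have SR: "\<bar>S M - (R M + K)\<bar> \<le> 45 * e" if M: "M \<ge> 1" for M
  proof -
    obtain N where N: "M = Suc N" using M by (cases M) auto
    define G where "G = (\<Sum>k=1..M. log_ratio (real k * e))"
    have SG: "S M = G - ln (fact M) - real M * ln e"
    proof -
      have "G = (\<Sum>k=1..M. (ln (real k) + ln e) - ln (1 - exp (- (real k * e))))"
        unfolding G_def log_ratio_def using e by (intro sum.cong refl) (auto simp: ln_mult_pos)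
      also have "\<dots> = (\<Sum>k=1..M. ln (real k)) + real M * ln e + S M"
        by (simp add: S_def sum_subtractf sum.distrib)
      also have "(\<Sum>k=1..M. ln (real k)) = ln (fact M)"
        by (induction M) (simp_all add: ln_mult_pos del: of_nat_Suc)
      finally show ?thesis by simp
    qed
    define H where "H = log_ratio_int (real M * e)"
    have tr: "\<bar>H - log_ratio_int e - e * (G - (log_ratio e + log_ratio (real M * e)) / 2)\<bar> \<le> 45 * e\<^sup>2"
      using trapezoid_log_ratio[OF e, of N] unfolding H_def G_def N .
    have lM: "ln (real M * e) = ln (real M) + ln e" using M e by (simp add: ln_mult_pos)
    have H': "H / e = real M * (ln (real M) + ln e) - real M - dilog_exp (real M * e) / e"
      unfolding H_def log_ratio_int_def lM using e by (simp add: field_simps)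
    have "S M - (R M + K) = - ((H - log_ratio_int e - e * (G - (log_ratio e + log_ratio (real M * e)) / 2)) / e)"
    proof -
      have "(H - log_ratio_int e - e * (G - (log_ratio e + log_ratio (real M * e)) / 2)) / e = 
         H / e - log_ratio_int e / e - (G - (log_ratio e + log_ratio (real M * e)) / 2)"
        using e by (simp add: diff_divide_distrib)
      thus ?thesis unfolding SG R_def K_def H' s_def log_ratio_def[of "real M * e"] lM
        by (simp add: algebra_simps add_divide_distrib diff_divide_distrib)
    qed
    also have "\<bar>\<dots>\<bar> = \<bar>H - log_ratio_int e - e * (G - (log_ratio e + log_ratio (real M * e)) / 2)\<bar> / e"
      using e by (simp add: abs_divide)
    also have "\<dots> \<le> 45 * e\<^sup>2 / e" using tr e by (intro divide_right_mono) auto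
    also have "\<dots> = 45 * e" using e by (simp add: power2_eq_square)
    finally show ?thesis .
  qed
  have expM: "(\<lambda>M. exp (- (real M * e))) \<longlonglongrightarrow> 0" using e by real_asymp
  have dl: "(\<lambda>M. dilog_exp (real M * e)) \<longlonglongrightarrow> 0"
  proof (rule tendsto_sandwich[OF always_eventually always_eventually tendsto_const])
    show "\<forall>M. 0 \<le> dilog_exp (real M * e)" using e by (auto intro!: dilog_exp_bound)
    show "\<forall>M. dilog_exp (real M * e) \<le> exp (- (real M * e)) * (pi\<^sup>2 / 6)"
      by (intro allI dilog_exp_bound(2)) (use e in simp)
    show "(\<lambda>M. exp (- (real M * e)) * (pi\<^sup>2 / 6)) \<longlonglongrightarrow> 0"
      using tendsto_mult_right[OF expM, of "pi\<^sup>2 / 6"] by simp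
  qed
  have "R \<longlonglongrightarrow> - 0 / e - ln (2 * pi) / 2 + ln e / 2 - ln (1 - 0) / 2"
    unfolding R_def s_def by (intro tendsto_intros dl stirling_limit expM) (use e in auto)
  hence Rlim: "R \<longlonglongrightarrow> ln e / 2 - ln (2 * pi) / 2" by simp
  have ev: "\<forall>\<^sub>F M in sequentially. norm (S M - (R M + K)) \<le> 45 * e"
    using eventually_ge_at_top[of 1] by eventually_elim (use SR in simp)
  have "(\<lambda>M. norm (S M - (R M + K))) \<longlonglongrightarrow> norm (Re (log_partition_gf (of_real e)) - ((ln e / 2 - ln (2 * pi) / 2) + K))"
    by (intro tendsto_intros Slim Rlim)
  hence "norm (Re (log_partition_gf (of_real e)) - ((ln e / 2 - ln (2 * pi) / 2) + K)) \<le> 45 * e"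
    by (rule tendsto_upperbound[OF _ ev]) simp
  moreover have "\<bar>K - pi\<^sup>2 / (6 * e)\<bar> \<le> 2 * e"
  proof -
    have "\<bar>(log_ratio_int e + pi\<^sup>2 / 6) / e\<bar> \<le> e\<^sup>2 / e"
      using log_ratio_int_near_0[OF e] e unfolding abs_divide by (simp add: divide_right_mono)
    moreover have "(log_ratio_int e + pi\<^sup>2 / 6) / e = log_ratio_int e / e + pi\<^sup>2 / (6 * e)"
      by (simp add: add_divide_distrib)
    moreover have "e\<^sup>2 / e = e" using e by (simp add: power2_eq_square)
    ultimately show ?thesis unfolding K_def using log_ratio_bounds[OF e] by linarith
  qed
  ultimately show ?thesis unfolding real_norm_def abs_le_iff by linarith
qed

section \<open>The circle method\<close>

lemma Im_log_partition_gf_real: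
  assumes "e > 0"
  shows "Im (log_partition_gf (of_real e)) = 0"
proof -
  have "(\<lambda>j. Im (inverse (of_nat j) * inverse (exp (of_nat j * complex_of_real e) - 1))) sums Im (log_partition_gf (of_real e))"
    unfolding log_partition_gf_def
    by (intro sums_Im summable_sums summable_norm_cancel[OF summable_norm_lambert]) (use assms in simp)
  moreover have "Im (inverse (of_nat j) * inverse (exp (of_nat j * complex_of_real e) - 1)) = 0" for j
  proof -
    have "inverse (of_nat j) * inverse (exp (of_nat j * complex_of_real e) - 1) = of_real (inverse (real j) * inverse (exp (real j * e) - 1))"
      by (simp flip: exp_of_real)
    thus ?thesis by (simp only: Im_complex_of_real)
  qed
  ultimately have "(\<lambda>j. 0 :: real) sums Im (log_partition_gf (of_real e))" by (simp only:)
  thus ?thesis using sums_unique2 sums_zero by blast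
qed

lemma exp_fourier_integral:
  fixes j :: int
  shows "((\<lambda>x. exp (\<i> * of_int j * of_real x)) has_integral (if j = 0 then 2 * of_real pi else 0)) {- pi..pi}"
proof (cases "j = 0")
  case True
  show ?thesis using has_integral_const_real[of "1 :: complex" "- pi" pi] True by (simp add: scaleR_conv_of_real)
next
  case False
  define z where "z = \<i> * of_int j"
  have z: "z \<noteq> 0" using False by (simp add: z_def)
  have "((\<lambda>x. exp (z * of_real x)) has_integral (exp (z * of_real pi) / z - exp (z * of_real (- pi)) / z)) {- pi..pi}"
  proof (rule fundamental_theorem_of_calculus)
    fix x assume "x \<in> {- pi..pi}"
    show "((\<lambda>x. exp (z * of_real x) / z) has_vector_derivative exp (z * of_real x)) (at x within {- pi..pi})"
      by (rule has_vector_derivative_real_field[where f = "\<lambda>w. exp (z * w) / z"])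
         (use z in \<open>auto intro!: derivative_eq_intros\<close>)
  qed simp
  moreover have "exp (z * of_real pi) = exp (z * of_real (- pi))"
  proof -
    have "exp (z * of_real pi) = exp (z * of_real (- pi) + (2 * of_int j * of_real pi) * \<i>)"
      by (simp add: z_def algebra_simps)
    also have "\<dots> = exp (z * of_real (- pi)) * exp ((2 * of_int j * of_real pi) * \<i>)" by (rule exp_add)
    also have "exp ((2 * of_int j * of_real pi) * \<i>) = 1" using exp_integer_2pi[of "real_of_int j"] by simp
    finally show ?thesis by simp
  qed
  ultimately show ?thesis using False by (simp add: z_def)
qed

text \<open>Cauchy's coefficient formula on the circle of radius e^(-e), in real form: the series
  converges uniformly there, and only the frequency k = n survives the integration.\<close>

lemma coefficient_integral:
  fixes a :: "nat \<Rightarrow> real" and n :: nat and e :: real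
  assumes sm: "summable (\<lambda>k. \<bar>a k\<bar> * exp (- e) ^ k)"
  defines "G \<equiv> (\<lambda>x. (\<Sum>k. of_real (a k) * exp (- (of_real e + \<i> * of_real x)) ^ k) * exp (of_nat n * (of_real e + \<i> * of_real x)))"
  shows "(G has_integral (2 * of_real pi * of_real (a n))) {- pi..pi}" "continuous_on {- pi..pi} G"
proof -
  define g where "g = (\<lambda>k x. of_real (a k) * exp (- (of_real e + \<i> * of_real x)) ^ k * exp (of_nat n * (of_real e + \<i> * of_real x)) :: complex)"
  have ng: "norm (g k x) = \<bar>a k\<bar> * exp (- e) ^ k * exp (real n * e)" for k x
    by (simp add: g_def norm_mult norm_power)
  have smn: "summable (\<lambda>k. \<bar>a k\<bar> * exp (- e) ^ k * exp (real n * e))" by (intro summable_mult2 sm)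
  have "uniform_limit {- pi..pi} (\<lambda>N x. \<Sum>k<N. g k x) (\<lambda>x. \<Sum>k. g k x) sequentially"
    by (rule Weierstrass_m_test[OF _ smn]) (simp only: ng order.refl)
  moreover have "(\<lambda>x. \<Sum>k. g k x) = G"
  proof
    fix x
    have "summable (\<lambda>k. of_real (a k) * exp (- (of_real e + \<i> * of_real x)) ^ k :: complex)"
      by (rule summable_norm_cancel) (use sm in \<open>simp add: norm_mult norm_power\<close>)
    thus "(\<Sum>k. g k x) = G x" unfolding g_def G_def by (rule suminf_mult2[symmetric])
  qed
  ultimately have ul: "uniform_limit {- pi..pi} (\<lambda>N x. \<Sum>k<N. g k x) G sequentially" by simp
  have contg: "continuous_on {- pi..pi} (g k)" for k
    unfolding g_def by (intro continuous_intros)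
  have cont: "continuous_on {- pi..pi} (\<lambda>x. \<Sum>k<N. g k x)" for N
    by (intro continuous_on_sum contg)
  show "continuous_on {- pi..pi} G"
    by (rule uniform_limit_theorem[OF _ ul]) (use cont in auto)
  obtain I J where I: "\<And>N. ((\<lambda>x. \<Sum>k<N. g k x) has_integral I N) {- pi..pi}" and J: "(G has_integral J) {- pi..pi}"
    and lim: "I \<longlonglongrightarrow> J"
    using uniform_limit_integral[OF ul cont] by auto
  have ig: "(g k has_integral (if k = n then 2 * of_real pi * of_real (a n) else 0)) {- pi..pi}" for k
  proof -
    have gk: "g k x = (of_real (a k) * exp (of_real ((real n - real k) * e))) * exp (\<i> * of_int (int n - int k) * of_real x)" for x
    proof -
      have "exp (- (of_real e + \<i> * of_real x)) ^ k = exp (of_nat k * - (of_real e + \<i> * of_real x) :: complex)"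
        by (simp only: exp_of_nat_mult)
      thus ?thesis unfolding g_def mult.assoc by (simp add: algebra_simps flip: exp_add)
    qed
    have "(g k has_integral (of_real (a k) * exp (of_real ((real n - real k) * e))) * (if int n - int k = 0 then 2 * of_real pi else 0)) {- pi..pi}"
      unfolding gk by (intro has_integral_mult_right exp_fourier_integral)
    thus ?thesis by (cases "k = n") (simp_all add: mult_ac)
  qed
  have Ieq: "I N = 2 * of_real pi * of_real (a n)" if "N > n" for N
  proof -
    have "((\<lambda>x. \<Sum>k<N. g k x) has_integral (\<Sum>k<N. if k = n then 2 * of_real pi * of_real (a n) else 0)) {- pi..pi}"
      by (intro has_integral_sum ig) auto
    with I[of N] have "I N = (\<Sum>k<N. if k = n then 2 * of_real pi * of_real (a n) else 0)"
      by (rule has_integral_unique)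
    thus ?thesis using that by simp
  qed
  then have "\<forall>\<^sub>F N in sequentially. I N = 2 * of_real pi * of_real (a n)"
    by (intro eventually_mono[OF eventually_gt_at_top[of n]] Ieq)
  hence "I \<longlonglongrightarrow> 2 * of_real pi * of_real (a n)" by (rule tendsto_eventually)
  with lim have "J = 2 * of_real pi * of_real (a n)" by (rule LIMSEQ_unique)
  with J show "(G has_integral (2 * of_real pi * of_real (a n))) {- pi..pi}" by simp
qed

lemma gaussian_integral:
  "integrable lborel (\<lambda>x. exp (- (pi\<^sup>2 / 6) * x\<^sup>2))" "(\<integral>x. exp (- (pi\<^sup>2 / 6) * x\<^sup>2) \<partial>lborel) = sqrt (6 / pi)"
proof -
  \<comment> \<open>Chosen so that 1/(2 \<sigma>^2) = pi^2/6.\<close>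
  define \<sigma> where "\<sigma> = sqrt 3 / pi"
  have s: "\<sigma> > 0" "\<sigma>\<^sup>2 = 3 / pi\<^sup>2" by (auto simp: \<sigma>_def power_divide)
  have d: "exp (- (pi\<^sup>2 / 6) * x\<^sup>2) = sqrt (6 / pi) * normal_density 0 \<sigma> x" for x
  proof -
    have "2 * pi * \<sigma>\<^sup>2 = 6 / pi" unfolding s(2) by (simp add: power2_eq_square)
    moreover have "- x\<^sup>2 / (2 * \<sigma>\<^sup>2) = - (pi\<^sup>2 / 6) * x\<^sup>2" unfolding s(2) by (simp add: field_simps)
    ultimately show ?thesis unfolding normal_density_def by simp
  qed
  show "integrable lborel (\<lambda>x. exp (- (pi\<^sup>2 / 6) * x\<^sup>2))"
    unfolding d using s by (intro integrable_mult_right integrable_normal_density)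
  show "(\<integral>x. exp (- (pi\<^sup>2 / 6) * x\<^sup>2) \<partial>lborel) = sqrt (6 / pi)"
    unfolding d using s by (simp add: integral_normal_density)
qed

lemma integrable_inverse_1_plus_square': "integrable lborel (\<lambda>x :: real. W * (1 / (1 + x\<^sup>2)))"
proof (rule integrable_mult_right)
  have "einterval (-\<infinity>) \<infinity> = UNIV" by (auto simp: einterval_def)
  thus "integrable lborel (\<lambda>x :: real. 1 / (1 + x\<^sup>2))"
    using integrable_inverse_1_plus_square by (simp add: set_integrable_def inverse_eq_divide)
qed

lemma power_div_fact_le_exp:
  fixes x :: real
  assumes "x \<ge> 0"
  shows "x ^ k / fact k \<le> exp x"
proof -
  have s: "(\<lambda>n. x ^ n /\<^sub>R fact n) sums exp x" by (rule exp_converges)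
  have "(\<Sum>n\<in>{k}. x ^ n /\<^sub>R fact n) \<le> (\<Sum>n. x ^ n /\<^sub>R fact n)"
    by (rule sum_le_suminf[OF sums_summable[OF s]]) (use assms in auto)
  thus ?thesis using sums_unique[OF s] by (simp add: divide_inverse mult.commute)
qed

section \<open>The integrand near and away from the saddle point\<close>

text \<open>The exponential part of Cauchy's integrand, normalized to be 1 at the real point t =
  e.\<close>

definition saddle_factor :: "nat \<Rightarrow> real \<Rightarrow> complex \<Rightarrow> complex" where
  "saddle_factor n e t = exp (of_nat n * (t - of_real e) + (log_partition_gf t - log_partition_gf (of_real e)))"

text \<open>In the cone the exponent is at most -x^2/100 on the scale Im t = e^(3/2) x, and exp
  (-x^2/100) <= 100/(1 + x^2). Outside, exp (-1/(100 e)) is bounded by a multiple of e^(\<kappa>+4):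
  \<kappa> powers cancel the normalization, one the bound C/e, and the remaining e^3 is at most
  11/(1 + x^2), because e^3 x^2 <= pi^2 on the range of integration. One majorant thus serves both
  ranges.\<close>

lemma norm_integrand_le:
  fixes t :: complex and F :: "complex \<Rightarrow> complex" and \<kappa> :: nat
  assumes e: "0 < e" "e \<le> 1 / 2" and x: "\<bar>e * sqrt e * x\<bar> \<le> pi"
    and t: "t = of_real e + \<i> * of_real (e * sqrt e * x)"
    and C: "C \<ge> 0"
    and F1: "\<bar>Im t\<bar> \<le> Re t \<Longrightarrow> norm (F t) \<le> C * e ^ \<kappa>" and F2: "norm (F t) \<le> C / e"
  shows "norm (saddle_factor n e t * F t / of_real e ^ \<kappa>)
     \<le> C * (100 + 11 * (fact (\<kappa> + 4) * 100 ^ (\<kappa> + 4))) * (1 / (1 + x\<^sup>2))"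
proof -
  define \<theta> where "\<theta> = e * sqrt e * x"
  have Ret: "Re t = e" "Im t = \<theta>" by (simp_all add: t \<theta>_def)
  have th2: "\<theta>\<^sup>2 = e ^ 3 * x\<^sup>2" using e by (simp add: \<theta>_def power_mult_distrib power_numeral_reduce)
  have "Re (log_partition_gf t) \<le> Re (log_partition_gf (of_real e)) - \<theta>\<^sup>2 / (50 * e * (e\<^sup>2 + \<theta>\<^sup>2))"
    using Re_log_partition_gf_le[of t] Re_inverse_exp_diff_ge[of t] e x Ret by (simp add: \<theta>_def)
  moreover have "Re (of_nat n * (t - of_real e)) = 0" by (simp add: t)
  ultimately have "Re (of_nat n * (t - of_real e) + (log_partition_gf t - log_partition_gf (of_real e))) \<le> - (\<theta>\<^sup>2 / (50 * e * (e\<^sup>2 + \<theta>\<^sup>2)))"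
    unfolding plus_complex.sel minus_complex.sel[of "log_partition_gf t"] by linarith
  hence E: "norm (saddle_factor n e t) \<le> exp (- (\<theta>\<^sup>2 / (50 * e * (e\<^sup>2 + \<theta>\<^sup>2))))"
    by (simp only: saddle_factor_def norm_exp_eq_Re exp_le_cancel_iff)
  have x1: "1 + x\<^sup>2 > 0" by (simp add: add_pos_nonneg)
  define N where "N = norm (saddle_factor n e t * F t / of_real e ^ \<kappa>)"
  have N_eq: "N = norm (saddle_factor n e t) * (norm (F t) / e ^ \<kappa>)"
    unfolding N_def using e by (simp add: norm_mult norm_divide norm_power)
  have fpos: "0 \<le> (fact (\<kappa> + 4) * 100 ^ (\<kappa> + 4) :: real)" by simp
  show ?thesis
  proof (cases "\<bar>\<theta>\<bar> \<le> e")
    case True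
    have "\<theta>\<^sup>2 \<le> e\<^sup>2" using True e by (simp add: abs_le_square_iff[symmetric])
    hence "50 * e * (e\<^sup>2 + \<theta>\<^sup>2) \<le> 50 * e * (e\<^sup>2 + e\<^sup>2)" using e by (intro mult_left_mono add_mono) auto
    also have "\<dots> = 100 * e ^ 3" by (simp add: power_numeral_reduce)
    finally have "\<theta>\<^sup>2 / (100 * e ^ 3) \<le> \<theta>\<^sup>2 / (50 * e * (e\<^sup>2 + \<theta>\<^sup>2))"
      using e by (intro divide_left_mono mult_pos_pos add_pos_nonneg) auto
    moreover have "\<theta>\<^sup>2 / (100 * e ^ 3) = x\<^sup>2 / 100" unfolding th2 using e by simp
    ultimately have "exp (- (\<theta>\<^sup>2 / (50 * e * (e\<^sup>2 + \<theta>\<^sup>2)))) \<le> exp (- (x\<^sup>2 / 100))" by simp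
    also have "\<dots> \<le> 1 / (1 + x\<^sup>2 / 100)"
      using exp_ge_add_one_self[of "x\<^sup>2 / 100"] by (simp add: exp_minus inverse_eq_divide add_pos_nonneg frac_le)
    also have "\<dots> \<le> 100 / (1 + x\<^sup>2)"
      using x1 by (simp add: divide_simps add_pos_nonneg)
    finally have E': "norm (saddle_factor n e t) \<le> 100 / (1 + x\<^sup>2)"
      using E by linarith
    have "norm (F t) \<le> C * e ^ \<kappa>" by (rule F1) (use True Ret in simp)
    hence "norm (F t) / e ^ \<kappa> \<le> C" using e by (simp add: divide_le_eq)
    hence "N \<le> 100 / (1 + x\<^sup>2) * C" unfolding N_eq using E' e x1 by (intro mult_mono) auto
    also have "\<dots> = C * 100 * (1 / (1 + x\<^sup>2))" by simp
    also have "\<dots> \<le> C * (100 + 11 * (fact (\<kappa> + 4) * 100 ^ (\<kappa> + 4))) * (1 / (1 + x\<^sup>2))"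
      using C x1 by (intro mult_right_mono mult_left_mono) auto
    finally show ?thesis unfolding N_def .
  next
    case False
    have "e\<^sup>2 \<le> \<theta>\<^sup>2" using False e by (simp add: abs_le_square_iff[symmetric])
    hence "\<theta>\<^sup>2 / (e\<^sup>2 + \<theta>\<^sup>2) \<ge> 1 / 2" using e by (simp add: pos_le_divide_eq add_pos_nonneg)
    hence "1 / 2 / (50 * e) \<le> \<theta>\<^sup>2 / (e\<^sup>2 + \<theta>\<^sup>2) / (50 * e)" using e by (intro divide_right_mono) auto
    hence "1 / (100 * e) \<le> \<theta>\<^sup>2 / (50 * e * (e\<^sup>2 + \<theta>\<^sup>2))" by (simp add: mult_ac)
    hence "exp (- (\<theta>\<^sup>2 / (50 * e * (e\<^sup>2 + \<theta>\<^sup>2)))) \<le> exp (- (1 / (100 * e)))" by simp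
    also have "\<dots> \<le> fact (\<kappa> + 4) * (100 * e) ^ (\<kappa> + 4)"
    proof -
      have "(1 / (100 * e)) ^ (\<kappa> + 4) / fact (\<kappa> + 4) \<le> exp (1 / (100 * e))"
        by (rule power_div_fact_le_exp) (use e in simp)
      hence "inverse (exp (1 / (100 * e))) \<le> inverse ((1 / (100 * e)) ^ (\<kappa> + 4) / fact (\<kappa> + 4))"
        using e by (intro le_imp_inverse_le) auto
      thus ?thesis by (simp add: exp_minus power_one_over mult_ac)
    qed
    also have "\<dots> = fact (\<kappa> + 4) * 100 ^ (\<kappa> + 4) * e ^ (\<kappa> + 4)" by (simp only: power_mult_distrib mult.assoc)
    finally have E': "norm (saddle_factor n e t) \<le> fact (\<kappa> + 4) * 100 ^ (\<kappa> + 4) * e ^ (\<kappa> + 4)"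
      using E by linarith
    have "norm (F t) / e ^ \<kappa> \<le> C / e / e ^ \<kappa>" using F2 e by (intro divide_right_mono) auto
    hence "N \<le> (fact (\<kappa> + 4) * 100 ^ (\<kappa> + 4) * e ^ (\<kappa> + 4)) * (C / e / e ^ \<kappa>)"
      unfolding N_eq using E' e fpos by (intro mult_mono) auto
    also have "\<dots> = C * (fact (\<kappa> + 4) * 100 ^ (\<kappa> + 4)) * e ^ 3"
      using e by (simp add: power_add power_numeral_reduce)
    also have "e ^ 3 \<le> 11 * (1 / (1 + x\<^sup>2))"
    proof -
      have pi4: "pi \<le> 3.15" using pi_approx by simp
      have "\<theta>\<^sup>2 \<le> pi\<^sup>2" using x by (simp add: \<theta>_def abs_le_square_iff[symmetric])
      also have "pi\<^sup>2 \<le> 3.15\<^sup>2" using pi4 by (intro power_mono) auto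
      finally have "e ^ 3 * x\<^sup>2 \<le> 10" unfolding th2 by (simp add: power2_eq_square)
      moreover have "e ^ 3 \<le> 1" using e by (intro power_le_one) auto
      ultimately have "e ^ 3 * (1 + x\<^sup>2) \<le> 11" by (simp add: algebra_simps)
      thus ?thesis using x1 by (simp add: pos_le_divide_eq)
    qed
    hence "C * (fact (\<kappa> + 4) * 100 ^ (\<kappa> + 4)) * e ^ 3 \<le> C * (fact (\<kappa> + 4) * 100 ^ (\<kappa> + 4)) * (11 * (1 / (1 + x\<^sup>2)))"
      using C fpos by (intro mult_left_mono mult_nonneg_nonneg) auto
    also have "\<dots> = C * (11 * (fact (\<kappa> + 4) * 100 ^ (\<kappa> + 4))) * (1 / (1 + x\<^sup>2))" by simp
    also have "\<dots> \<le> C * (100 + 11 * (fact (\<kappa> + 4) * 100 ^ (\<kappa> + 4))) * (1 / (1 + x\<^sup>2))"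
      using C x1 by (intro mult_right_mono mult_left_mono) auto
    finally show ?thesis unfolding N_def .
  qed
qed

text \<open>With \<open>n = \<pi>\<^sup>2/(6\<eta>\<^sup>2)\<close> the exponent \<open>n (t - \<eta>) + \<pi>\<^sup>2/6 (1/t - 1/\<eta>)\<close> equals \<open>\<pi>\<^sup>2/6 (t - \<eta>)\<^sup>2/(\<eta>\<^sup>2 t)\<close>, which is
  why imaginary parts of the order \<open>\<eta>\<^bsup>3/2\<^esup>\<close> contribute a Gaussian.\<close>
lemma integrand_tendsto:
  fixes F :: "complex \<Rightarrow> complex" and c C x :: real and \<kappa> :: nat
  defines "\<eta> \<equiv> (\<lambda>n. pi / sqrt (6 * real n))"
  assumes A: "\<And>t. 0 < Re t \<Longrightarrow> Re t \<le> 1 \<Longrightarrow> \<bar>Im t\<bar> \<le> Re t \<Longrightarrow>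
      norm (F t - of_real c * t ^ \<kappa>) \<le> C * Re t ^ \<kappa> * sqrt (Re t)"
  defines "T \<equiv> (\<lambda>n. of_real (\<eta> n) + \<i> * of_real (\<eta> n * sqrt (\<eta> n) * x))"
  shows "(\<lambda>n. saddle_factor n (\<eta> n) (T n) * F (T n) / of_real (\<eta> n) ^ \<kappa>)
     \<longlonglongrightarrow> of_real (c * exp (- (pi\<^sup>2 / 6) * x\<^sup>2))"
proof -
  define g where "g = - (pi\<^sup>2 / 6) * x\<^sup>2"
  have elim0: "\<eta> \<longlonglongrightarrow> 0" unfolding \<eta>_def by real_asymp
  have slim: "(\<lambda>n. sqrt (\<eta> n)) \<longlonglongrightarrow> 0" using tendsto_real_sqrt[OF elim0] by simp
  have epos: "\<forall>\<^sub>F n in sequentially. \<eta> n > 0"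
    using eventually_gt_at_top[of 0] by eventually_elim (simp add: \<eta>_def)
  have e1: "\<forall>\<^sub>F n in sequentially. \<eta> n < 1" using order_tendstoD(2)[OF elim0, of 1] by simp
  have sx: "\<forall>\<^sub>F n in sequentially. sqrt (\<eta> n) * \<bar>x\<bar> < 1"
    using order_tendstoD(2)[OF tendsto_mult_right[OF slim, of "\<bar>x\<bar>"], of 1] by simp
  define \<rho> where "\<rho> = (\<lambda>n. 1 + \<i> * of_real (sqrt (\<eta> n) * x))"
  have rlim: "\<rho> \<longlonglongrightarrow> 1"
  proof -
    have "\<rho> \<longlonglongrightarrow> 1 + \<i> * of_real (0 * x)" unfolding \<rho>_def by (intro tendsto_intros slim)
    thus ?thesis by simp
  qed
  have T\<rho>: "T n = of_real (\<eta> n) * \<rho> n" for n unfolding T_def \<rho>_def by (simp add: algebra_simps)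
  have good: "\<forall>\<^sub>F n in sequentially. n > 0 \<and> \<eta> n > 0 \<and> \<eta> n < 1 \<and> sqrt (\<eta> n) * \<bar>x\<bar> < 1"
    using eventually_gt_at_top[of 0] epos e1 sx by eventually_elim simp
  have ReT: "Re (T n) = \<eta> n" "Im (T n) = \<eta> n * sqrt (\<eta> n) * x" for n by (simp_all add: T_def)
  have cone: "\<bar>Im (T n)\<bar> \<le> Re (T n)" if "\<eta> n > 0" "sqrt (\<eta> n) * \<bar>x\<bar> < 1" for n
  proof -
    have "\<bar>Im (T n)\<bar> = \<eta> n * (sqrt (\<eta> n) * \<bar>x\<bar>)" using that by (simp add: ReT abs_mult)
    also have "\<dots> \<le> \<eta> n * 1" using that by (intro mult_left_mono) auto
    finally show ?thesis by (simp add: ReT)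
  qed
  define D where "D = (\<lambda>n. log_partition_gf (T n) - log_partition_gf (of_real (\<eta> n)) - pi\<^sup>2 / 6 * (1 / T n - 1 / of_real (\<eta> n)))"
  have Dlim: "D \<longlonglongrightarrow> 0"
  proof (rule Lim_null_comparison)
    show "\<forall>\<^sub>F n in sequentially. norm (D n) \<le> 45 * (sqrt (\<eta> n) * \<bar>x\<bar>)"
      using good
    proof eventually_elim
      case (elim n)
      have "norm (D n) \<le> 45 * \<bar>Im (T n)\<bar> / Re (T n)"
        unfolding D_def using log_partition_gf_diff[of "T n"] cone[of n] elim ReT by simp
      also have "\<dots> = 45 * (sqrt (\<eta> n) * \<bar>x\<bar>)" using elim by (simp add: ReT abs_mult)
      finally show ?case .
    qed
    have "(\<lambda>n. 45 * (sqrt (\<eta> n) * \<bar>x\<bar>)) \<longlonglongrightarrow> 45 * (0 * \<bar>x\<bar>)" by (intro tendsto_intros slim)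
    thus "(\<lambda>n. 45 * (sqrt (\<eta> n) * \<bar>x\<bar>)) \<longlonglongrightarrow> 0" by simp
  qed
  have expo: "\<forall>\<^sub>F n in sequentially. of_real g / \<rho> n + D n =
      of_nat n * (T n - of_real (\<eta> n)) + (log_partition_gf (T n) - log_partition_gf (of_real (\<eta> n)))"
    using good
  proof eventually_elim
    case (elim n)
    define e where "e = complex_of_real (\<eta> n)"
    have e0: "e \<noteq> 0" using elim by (simp add: e_def)
    have r0: "\<rho> n \<noteq> 0" by (simp add: \<rho>_def complex_eq_iff)
    have n: "of_nat n = of_real (pi\<^sup>2) / (6 * e\<^sup>2)"
    proof -
      have "(\<eta> n)\<^sup>2 = pi\<^sup>2 / (6 * real n)" by (simp add: \<eta>_def power_divide)
      hence "real n = pi\<^sup>2 / (6 * (\<eta> n)\<^sup>2)" using elim by (simp add: field_simps)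
      hence "complex_of_real (real n) = of_real (pi\<^sup>2 / (6 * (\<eta> n)\<^sup>2))" by (simp only:)
      thus ?thesis by (simp add: e_def)
    qed
    have sq: "(\<rho> n - 1)\<^sup>2 = - (e * of_real (x\<^sup>2))"
    proof -
      have "(sqrt (\<eta> n))\<^sup>2 = \<eta> n" using elim by simp
      hence "complex_of_real ((sqrt (\<eta> n))\<^sup>2) = e" unfolding e_def by (simp only:)
      thus ?thesis by (simp add: \<rho>_def power_mult_distrib)
    qed
    have id: "P / (6 * e\<^sup>2) * (e * r - e) + P / 6 * (1 / (e * r) - 1 / e) = P / (6 * e) * ((r - 1)\<^sup>2 / r)"
      if "r \<noteq> 0" for P r :: complex
      using e0 that by (simp add: field_simps power2_eq_square)
    have "of_nat n * (T n - e) + pi\<^sup>2 / 6 * (1 / T n - 1 / e) = of_real (pi\<^sup>2) / (6 * e) * ((\<rho> n - 1)\<^sup>2 / \<rho> n)"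
      unfolding n T\<rho> e_def[symmetric] using id[OF r0, of "of_real (pi\<^sup>2)"] by simp
    also have "\<dots> = of_real g / \<rho> n"
      unfolding sq g_def using e0 r0 by (simp add: field_simps)
    finally show ?case unfolding D_def e_def[symmetric] by (simp add: algebra_simps)
  qed
  have "(\<lambda>n. of_real g / \<rho> n + D n) \<longlonglongrightarrow> of_real g / 1 + 0"
    by (intro tendsto_intros rlim Dlim) simp
  hence "(\<lambda>n. exp (of_real g / \<rho> n + D n)) \<longlonglongrightarrow> exp (of_real g / 1 + 0)"
    by (rule tendsto_exp)
  hence Elim0: "(\<lambda>n. exp (of_real g / \<rho> n + D n)) \<longlonglongrightarrow> of_real (exp g)"
    by (simp only: div_by_1 add_0_right exp_of_real)
  have Elim: "(\<lambda>n. saddle_factor n (\<eta> n) (T n))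
     \<longlonglongrightarrow> of_real (exp g)"
  proof (rule Lim_transform_eventually[OF Elim0])
    show "\<forall>\<^sub>F n in sequentially. exp (of_real g / \<rho> n + D n) =
       saddle_factor n (\<eta> n) (T n)"
      using expo by eventually_elim (simp only: saddle_factor_def)
  qed
  have Flim: "(\<lambda>n. F (T n) / of_real (\<eta> n) ^ \<kappa>) \<longlonglongrightarrow> of_real c"
  proof -
    have "(\<lambda>n. (F (T n) - of_real c * T n ^ \<kappa>) / of_real (\<eta> n) ^ \<kappa>) \<longlonglongrightarrow> 0"
    proof (rule Lim_null_comparison)
      show "\<forall>\<^sub>F n in sequentially. norm ((F (T n) - of_real c * T n ^ \<kappa>) / of_real (\<eta> n) ^ \<kappa>) \<le> C * sqrt (\<eta> n)"
        using good
      proof eventually_elim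
        case (elim n)
        have "norm (F (T n) - of_real c * T n ^ \<kappa>) \<le> C * \<eta> n ^ \<kappa> * sqrt (\<eta> n)"
          using A[of "T n"] cone[of n] elim ReT by simp
        thus ?case using elim by (simp add: norm_divide norm_power divide_le_eq mult_ac)
      qed
      show "(\<lambda>n. C * sqrt (\<eta> n)) \<longlonglongrightarrow> 0" using tendsto_mult_left[OF slim, of C] by simp
    qed
    moreover have "(\<lambda>n. of_real c * \<rho> n ^ \<kappa>) \<longlonglongrightarrow> of_real c * 1 ^ \<kappa>" by (intro tendsto_intros rlim)
    ultimately have "(\<lambda>n. (F (T n) - of_real c * T n ^ \<kappa>) / of_real (\<eta> n) ^ \<kappa> + of_real c * \<rho> n ^ \<kappa>) \<longlonglongrightarrow> 0 + of_real c * 1 ^ \<kappa>"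
      by (rule tendsto_add)
    hence "(\<lambda>n. (F (T n) - of_real c * T n ^ \<kappa>) / of_real (\<eta> n) ^ \<kappa> + of_real c * \<rho> n ^ \<kappa>) \<longlonglongrightarrow> of_real c" by simp
    thus ?thesis
    proof (rule Lim_transform_eventually)
      show "\<forall>\<^sub>F n in sequentially. (F (T n) - of_real c * T n ^ \<kappa>) / of_real (\<eta> n) ^ \<kappa> + of_real c * \<rho> n ^ \<kappa> = F (T n) / of_real (\<eta> n) ^ \<kappa>"
        using good by eventually_elim (simp add: T\<rho> power_mult_distrib field_simps)
    qed
  qed
  from tendsto_mult[OF Elim Flim] show ?thesis by (simp add: g_def mult.commute)
qed

text \<open>The substitution Im t = \<eta>^(3/2) x and dominated convergence reduce Cauchy's
  integral to a Gaussian one. Of the two extra powers of \<eta>, 3/2 stem from the substitution and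
  1/2 from the partition generating function at \<eta>. The constant is c sqrt (6/pi) / (2 pi sqrt
  (2 pi)), from the Gaussian, Cauchy's formula and Stirling's constant.\<close>

theorem coefficient_asymp:
  fixes F :: "complex \<Rightarrow> complex" and a :: "nat \<Rightarrow> real" and c C C' :: real and \<kappa> :: nat
  defines "\<eta> \<equiv> (\<lambda>n. pi / sqrt (6 * real n))"
  assumes sm: "\<And>e. e > 0 \<Longrightarrow> summable (\<lambda>k. \<bar>a k\<bar> * exp (- e) ^ k)"
    and gf: "\<And>t. Re t > 0 \<Longrightarrow> (\<Sum>k. of_real (a k) * exp (- t) ^ k) = partition_gf (exp (- t)) * F t"
    and A: "\<And>t. 0 < Re t \<Longrightarrow> Re t \<le> 1 \<Longrightarrow> \<bar>Im t\<bar> \<le> Re t \<Longrightarrow>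
      norm (F t - of_real c * t ^ \<kappa>) \<le> C * Re t ^ \<kappa> * sqrt (Re t)"
    and B: "\<And>t. 0 < Re t \<Longrightarrow> Re t \<le> 1 \<Longrightarrow> norm (F t) \<le> C' / Re t"
  shows "(\<lambda>n. a n / (\<eta> n ^ (\<kappa> + 2) * exp (pi * sqrt (2 * real n / 3)))) \<longlonglongrightarrow> c * sqrt 3 / (2 * pi\<^sup>2)"
proof -
  define L where "L = (\<lambda>n. Re (log_partition_gf (of_real (\<eta> n))))"
  define T where "T = (\<lambda>n x. complex_of_real (\<eta> n) + \<i> * of_real (\<eta> n * sqrt (\<eta> n) * x))"
  define K where "K = (\<lambda>n x. saddle_factor n (\<eta> n) (T n x) * F (T n x) / of_real (\<eta> n) ^ \<kappa>)"
  \<comment> \<open>Extension by 0 puts the integrals for all n on the whole line, as dominated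
    convergence requires.\<close>
  define h where "h = (\<lambda>n x. indicator {- pi..pi} (\<eta> n * sqrt (\<eta> n) * x) *\<^sub>R K n x)"
  \<comment> \<open>The first entry bounds F in the cone, where |t| <= 2 \<eta>; the second is for
    the crude bound valid everywhere.\<close>
  define CC where "CC = max (\<bar>c\<bar> * 2 ^ \<kappa> + \<bar>C\<bar>) \<bar>C'\<bar>"
  define W where "W = CC * (100 + 11 * (fact (\<kappa> + 4) * 100 ^ (\<kappa> + 4)))"
  have CC: "CC \<ge> 0" by (simp add: CC_def)
  \<comment> \<open>From n = 7 on \<eta> is at most 1/2, the range in which
    \<open>norm_integrand_le\<close> applies; pi <= 3.2 and sqrt 42 >= 6.4 just suffice.\<close>
  have \<eta>half: "0 < \<eta> n" "\<eta> n \<le> 1 / 2" if "n \<ge> 7" for n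
  proof -
    show "0 < \<eta> n" using that by (simp add: \<eta>_def)
    have "sqrt 42 \<le> sqrt (6 * real n)" using that by simp
    moreover have "6.4 \<le> sqrt (42 :: real)" by (rule real_le_rsqrt) (simp add: power2_eq_square)
    moreover have "pi \<le> 3.2" using pi_approx by simp
    ultimately have "pi \<le> 1 / 2 * sqrt (6 * real n)" by linarith
    thus "\<eta> n \<le> 1 / 2" unfolding \<eta>_def using that by (subst pos_divide_le_eq) auto
  qed
  have bound: "norm (h n x) \<le> W * (1 / (1 + x\<^sup>2))" if n: "n \<ge> 7" for n x
  proof (cases "\<eta> n * sqrt (\<eta> n) * x \<in> {- pi..pi}")
    case True
    have e: "0 < \<eta> n" "\<eta> n \<le> 1 / 2" using \<eta>half[OF n] by auto
    have Tr: "Re (T n x) = \<eta> n" by (simp add: T_def)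
    have "norm (K n x) \<le> CC * (100 + 11 * (fact (\<kappa> + 4) * 100 ^ (\<kappa> + 4))) * (1 / (1 + x\<^sup>2))"
      unfolding K_def
    proof (rule norm_integrand_le[OF e _ _ CC])
      show "T n x = of_real (\<eta> n) + \<i> * of_real (\<eta> n * sqrt (\<eta> n) * x)" by (simp add: T_def)
      show "\<bar>\<eta> n * sqrt (\<eta> n) * x\<bar> \<le> pi" using True by auto
      show "norm (F (T n x)) \<le> CC / \<eta> n"
      proof -
        have "norm (F (T n x)) \<le> C' / \<eta> n" using B[of "T n x"] Tr e by simp
        also have "\<dots> \<le> CC / \<eta> n" using e by (intro divide_right_mono) (auto simp: CC_def)
        finally show ?thesis .
      qed
      assume cone: "\<bar>Im (T n x)\<bar> \<le> Re (T n x)"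
      have nT: "norm (T n x) \<le> 2 * \<eta> n" using cmod_le[of "T n x"] cone Tr e by simp
      have "norm (F (T n x)) \<le> norm (F (T n x) - of_real c * T n x ^ \<kappa>) + norm (of_real c * T n x ^ \<kappa>)"
        using norm_triangle_ineq[of "F (T n x) - of_real c * T n x ^ \<kappa>" "of_real c * T n x ^ \<kappa>"] by simp
      also have "norm (F (T n x) - of_real c * T n x ^ \<kappa>) \<le> C * \<eta> n ^ \<kappa> * sqrt (\<eta> n)"
        using A[of "T n x"] cone Tr e by simp
      also have "C * \<eta> n ^ \<kappa> * sqrt (\<eta> n) \<le> \<bar>C\<bar> * \<eta> n ^ \<kappa> * 1"
        using e by (intro mult_mono) (auto intro!: mult_right_mono)
      also have "norm (of_real c * T n x ^ \<kappa>) \<le> \<bar>c\<bar> * (2 * \<eta> n) ^ \<kappa>"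
        unfolding norm_mult norm_power using nT by (intro mult_mono power_mono) auto
      finally have "norm (F (T n x)) \<le> (\<bar>c\<bar> * 2 ^ \<kappa> + \<bar>C\<bar>) * \<eta> n ^ \<kappa>"
        by (simp add: power_mult_distrib algebra_simps)
      also have "\<dots> \<le> CC * \<eta> n ^ \<kappa>" using e by (intro mult_right_mono) (auto simp: CC_def)
      finally show "norm (F (T n x)) \<le> CC * \<eta> n ^ \<kappa>" .
    qed
    thus ?thesis using True by (simp add: h_def W_def)
  next
    case False
    thus ?thesis using CC by (simp add: h_def W_def)
  qed
  have plim: "(\<lambda>n. h n x) \<longlonglongrightarrow> of_real (c * exp (- (pi\<^sup>2 / 6) * x\<^sup>2))" for x
  proof (rule Lim_transform_eventually)
    show "(\<lambda>n. K n x) \<longlonglongrightarrow> of_real (c * exp (- (pi\<^sup>2 / 6) * x\<^sup>2))"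
      unfolding K_def T_def \<eta>_def by (rule integrand_tendsto[OF A])
    have "(\<lambda>n. \<eta> n * sqrt (\<eta> n) * x) \<longlonglongrightarrow> 0" unfolding \<eta>_def by real_asymp
    hence "(\<lambda>n. \<bar>\<eta> n * sqrt (\<eta> n) * x\<bar>) \<longlonglongrightarrow> 0" by (rule tendsto_rabs_zero)
    hence "\<forall>\<^sub>F n in sequentially. \<bar>\<eta> n * sqrt (\<eta> n) * x\<bar> < pi" using order_tendstoD(2) pi_gt_zero by blast
    thus "\<forall>\<^sub>F n in sequentially. K n x = h n x"
      by eventually_elim (auto simp: h_def indicator_def)
  qed
  have main: "integrable lborel (h n) \<and> 2 * of_real pi * of_real (a n) =
      of_real (\<eta> n * sqrt (\<eta> n) * (exp (real n * \<eta> n + L n) * \<eta> n ^ \<kappa>)) * (\<integral>x. h n x \<partial>lborel)" if n: "n \<ge> 7" for n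
  proof -
    have e: "0 < \<eta> n" using \<eta>half[OF n] by auto
    define s where "s = \<eta> n * sqrt (\<eta> n)"
    have s: "s > 0" using e by (simp add: s_def)
    define G where "G = (\<lambda>y. (\<Sum>k. of_real (a k) * exp (- (of_real (\<eta> n) + \<i> * of_real y)) ^ k) * exp (of_nat n * (of_real (\<eta> n) + \<i> * of_real y)))"
    note co = coefficient_integral[OF sm[OF e], of n, folded G_def]
    have setint: "set_integrable lborel {- pi..pi} G"
      by (rule borel_integrable_atLeastAtMost'[OF co(2)])
    have "(LINT y:{- pi..pi}|lborel. G y) = integral {- pi..pi} G"
      by (rule set_borel_integral_eq_integral(2)[OF setint])
    also have "\<dots> = 2 * of_real pi * of_real (a n)" by (rule integral_unique[OF co(1)])
    finally have "2 * of_real pi * of_real (a n) = (\<integral>y. indicator {- pi..pi} y *\<^sub>R G y \<partial>lborel)"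
      by (simp add: set_lebesgue_integral_def)
    also have "\<dots> = \<bar>s\<bar> *\<^sub>R (\<integral>x. indicator {- pi..pi} (0 + s * x) *\<^sub>R G (0 + s * x) \<partial>lborel)"
      by (rule lborel_integral_real_affine) (use s in simp)
    finally have 1: "2 * of_real pi * of_real (a n) = of_real s * (\<integral>x. indicator {- pi..pi} (s * x) *\<^sub>R G (s * x) \<partial>lborel)"
      using s by (simp add: scaleR_conv_of_real)
    have int1: "integrable lborel (\<lambda>x. indicator {- pi..pi} (s * x) *\<^sub>R G (s * x))"
      using lborel_integrable_real_affine[OF setint[unfolded set_integrable_def], of s 0] s by simp
    define Z where "Z = complex_of_real (exp (real n * \<eta> n + L n) * \<eta> n ^ \<kappa>)"
    have Z0: "Z \<noteq> 0" using e by (simp add: Z_def)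
    have GK: "G (s * x) = Z * K n x" for x
    proof -
      have t: "of_real (\<eta> n) + \<i> * of_real (s * x) = T n x" by (simp add: T_def s_def)
      have ReT: "Re (T n x) > 0" using e by (simp add: T_def)
      have Lc: "log_partition_gf (of_real (\<eta> n)) = of_real (L n)"
        using Im_log_partition_gf_real[OF e] by (simp add: L_def complex_eq_iff)
      have "G (s * x) = exp (log_partition_gf (T n x)) * F (T n x) * exp (of_nat n * T n x)"
        unfolding G_def t gf[OF ReT] partition_gf_eq_exp[OF ReT] ..
      also have "exp (of_nat n * T n x) = exp (of_nat n * of_real (\<eta> n)) * exp (of_nat n * (T n x - of_real (\<eta> n)))"
        by (simp add: algebra_simps flip: exp_add)
      also have "exp (log_partition_gf (T n x)) = exp (of_real (L n)) * exp (log_partition_gf (T n x) - log_partition_gf (of_real (\<eta> n)))"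
        unfolding Lc by (simp flip: exp_add)
      finally show ?thesis
        unfolding K_def saddle_factor_def exp_add Z_def using e by (simp add: exp_add exp_of_real[symmetric])
    qed
    have ih: "(\<lambda>x. indicator {- pi..pi} (s * x) *\<^sub>R G (s * x)) = (\<lambda>x. Z * h n x)"
      unfolding h_def s_def[symmetric] GK by simp
    have "(\<lambda>x. inverse Z * (Z * h n x)) = h n" using Z0 by (intro ext) (simp add: field_simps)
    moreover have "integrable lborel (\<lambda>x. inverse Z * (Z * h n x))"
      by (rule integrable_mult_right) (rule int1[unfolded ih])
    ultimately have inth: "integrable lborel (h n)" by (simp only:)
    have "2 * of_real pi * of_real (a n) = of_real s * (Z * (\<integral>x. h n x \<partial>lborel))"
      unfolding 1 ih by simp
    thus ?thesis using inth by (simp add: s_def Z_def mult_ac)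
  qed
  \<comment> \<open>The shift by 7 makes measurability and the majorant available at every
    index.\<close>
  have Ilim: "(\<lambda>i. \<integral>x. h (i + 7) x \<partial>lborel) \<longlonglongrightarrow> (\<integral>x. complex_of_real (c * exp (- (pi\<^sup>2 / 6) * x\<^sup>2)) \<partial>lborel)"
  proof (rule integral_dominated_convergence[where w = "\<lambda>x. W * (1 / (1 + x\<^sup>2))"])
    show "(\<lambda>x. complex_of_real (c * exp (- (pi\<^sup>2 / 6) * x\<^sup>2))) \<in> borel_measurable lborel" by measurable
    show "h (i + 7) \<in> borel_measurable lborel" for i
      using main[of "i + 7"] by (auto dest: borel_measurable_integrable)
    show "integrable lborel (\<lambda>x. W * (1 / (1 + x\<^sup>2)))" by (rule integrable_inverse_1_plus_square')
    show "AE x in lborel. (\<lambda>i. h (i + 7) x) \<longlonglongrightarrow> complex_of_real (c * exp (- (pi\<^sup>2 / 6) * x\<^sup>2))"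
      by (rule AE_I2, rule LIMSEQ_ignore_initial_segment[OF plim])
    show "AE x in lborel. norm (h (i + 7) x) \<le> W * (1 / (1 + x\<^sup>2))" for i
      using bound[of "i + 7"] by simp
  qed
  have Ival: "(\<integral>x. complex_of_real (c * exp (- (pi\<^sup>2 / 6) * x\<^sup>2)) \<partial>lborel) = of_real (c * sqrt (6 / pi))"
    unfolding integral_complex_of_real using gaussian_integral(2) by simp
  have Ilim': "(\<lambda>n. \<integral>x. h n x \<partial>lborel) \<longlonglongrightarrow> of_real (c * sqrt (6 / pi))"
    by (rule LIMSEQ_offset[of _ 7]) (rule Ilim[unfolded Ival])
  have elim0: "\<eta> \<longlonglongrightarrow> 0" unfolding \<eta>_def by real_asymp
  have Llim: "(\<lambda>n. L n - (pi\<^sup>2 / (6 * \<eta> n) + ln (\<eta> n) / 2 - ln (2 * pi) / 2)) \<longlonglongrightarrow> 0"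
  proof (rule Lim_null_comparison)
    show "\<forall>\<^sub>F n in sequentially. norm (L n - (pi\<^sup>2 / (6 * \<eta> n) + ln (\<eta> n) / 2 - ln (2 * pi) / 2)) \<le> 47 * \<eta> n"
      using eventually_ge_at_top[of 7]
    proof eventually_elim
      case (elim n)
      show ?case using log_partition_gf_real_asymp[OF \<eta>half(1)[OF elim]] by (simp add: L_def)
    qed
    show "(\<lambda>n. 47 * \<eta> n) \<longlonglongrightarrow> 0" using tendsto_mult_left[OF elim0, of 47] by simp
  qed
  define I where "I = (\<lambda>n. \<integral>x. h n x \<partial>lborel)"
  define P where "P = 2 * pi * sqrt (2 * pi)"
  define R where "R = (\<lambda>n. L n - (pi\<^sup>2 / (6 * \<eta> n) + ln (\<eta> n) / 2 - ln (2 * pi) / 2))"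
  have RI: "(\<lambda>n. of_real (exp (R n) / P) * I n) \<longlonglongrightarrow>
     of_real (exp 0 / P) * of_real (c * sqrt (6 / pi))"
    unfolding R_def I_def by (intro tendsto_intros Llim Ilim') (simp add: P_def)
  have "(\<lambda>n. complex_of_real (a n / (\<eta> n ^ (\<kappa> + 2) * exp (pi * sqrt (2 * real n / 3))))) \<longlonglongrightarrow>
     of_real (exp 0 / P * (c * sqrt (6 / pi)))"
  proof (rule Lim_transform_eventually)
    show "(\<lambda>n. of_real (exp (R n) / P) * I n) \<longlonglongrightarrow>
     of_real (exp 0 / P * (c * sqrt (6 / pi)))" using RI by simp
    show "\<forall>\<^sub>F n in sequentially. of_real (exp (R n) / P) * I n =
      complex_of_real (a n / (\<eta> n ^ (\<kappa> + 2) * exp (pi * sqrt (2 * real n / 3))))"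
      using eventually_ge_at_top[of 7]
    proof eventually_elim
      case (elim n)
      define e where "e = \<eta> n"
      have e: "e > 0" using \<eta>half[OF elim] by (simp add: e_def)
      have n0: "real n > 0" using elim by simp
      define X where "X = pi * sqrt (2 * real n / 3)"
      have s6: "sqrt (6 * real n) > 0" using n0 by simp
      have X1: "pi\<^sup>2 / (6 * e) = X / 2"
      proof -
        have "sqrt (2 * real n / 3) = sqrt (6 * real n) / 3"
        proof -
          have "2 * real n / 3 = 6 * real n / 3\<^sup>2" by (simp add: power2_eq_square)
          thus ?thesis by (simp only: real_sqrt_divide real_sqrt_abs)
        qed
        thus ?thesis using s6 by (simp add: X_def e_def \<eta>_def power2_eq_square field_simps)
      qed
      \<comment> \<open>The saddle point condition: \<eta> is chosen so that n \<eta> and pi^2/(6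
        \<eta>) agree, each being half of the final exponent.\<close>
      have X2: "real n * e = X / 2"
      proof -
        have "e\<^sup>2 = pi\<^sup>2 / (6 * real n)" by (simp add: e_def \<eta>_def power_divide)
        hence "real n * e = pi\<^sup>2 / (6 * e)" using e n0 by (simp add: field_simps power2_eq_square)
        thus ?thesis using X1 by simp
      qed
      have "exp (real n * e + L n) = exp X * sqrt e / sqrt (2 * pi) * exp (R n)"
      proof -
        have "real n * e + L n = X + ln e / 2 - ln (2 * pi) / 2 + R n"
          unfolding R_def e_def[symmetric] X1 X2 by simp
        also have "exp \<dots> = exp X * exp (ln e / 2) / exp (ln (2 * pi) / 2) * exp (R n)"
          by (simp add: exp_add exp_diff)
        also have "exp (ln e / 2) = sqrt e" using e by (simp flip: ln_sqrt)
        also have "exp (ln (2 * pi) / 2) = sqrt (2 * pi)" by (simp flip: ln_sqrt)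
        finally show ?thesis .
      qed
      moreover have "2 * of_real pi * of_real (a n) =
        of_real (e * sqrt e * (exp (real n * e + L n) * e ^ \<kappa>)) * I n"
        using main[OF elim] by (simp add: e_def I_def)
      ultimately have "2 * of_real pi * of_real (a n) = 
        of_real (e * sqrt e * (exp X * sqrt e / sqrt (2 * pi) * exp (R n) * e ^ \<kappa>)) * I n" by simp
      also have "e * sqrt e * (exp X * sqrt e / sqrt (2 * pi) * exp (R n) * e ^ \<kappa>) = 
         (e ^ (\<kappa> + 2) * exp X) * 2 * pi * (exp (R n) / P)"
      proof -
        have "sqrt e * sqrt e = e" using e by simp
        hence "e * sqrt e * (exp X * sqrt e / sqrt (2 * pi) * exp (R n) * e ^ \<kappa>) = e * e * e ^ \<kappa> * exp X * exp (R n) / sqrt (2 * pi)"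
          by (simp add: mult_ac)
        also have "\<dots> = (e ^ (\<kappa> + 2) * exp X) * 2 * pi * (exp (R n) / P)"
          by (simp add: P_def power_add power2_eq_square)
        finally show ?thesis .
      qed
      finally have fin: "complex_of_real (2 * pi) * of_real (a n) = of_real (2 * pi) * (of_real (e ^ (\<kappa> + 2) * exp X) * 
         (of_real (exp (R n) / P) * I n))"
        by (simp add: mult_ac)
      hence an: "complex_of_real (a n) = of_real (e ^ (\<kappa> + 2) * exp X) * 
         (of_real (exp (R n) / P) * I n)"
        by (rule mult_left_cancel[THEN iffD1, rotated]) simp
      have nz: "complex_of_real (e ^ (\<kappa> + 2) * exp X) \<noteq> 0" using e by simp
      have "complex_of_real (a n / (e ^ (\<kappa> + 2) * exp X)) = of_real (a n) / of_real (e ^ (\<kappa> + 2) * exp X)"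
        by (rule of_real_divide)
      also have "\<dots> = of_real (exp (R n) / P) * I n"
        unfolding an by (rule nonzero_mult_div_cancel_left[OF nz])
      finally show ?case unfolding X_def e_def by (rule sym)
    qed
  qed
  hence "(\<lambda>n. a n / (\<eta> n ^ (\<kappa> + 2) * exp (pi * sqrt (2 * real n / 3)))) \<longlonglongrightarrow> exp 0 / P * (c * sqrt (6 / pi))"
    by (simp only: tendsto_of_real_iff)
  moreover have "exp 0 / P * (c * sqrt (6 / pi)) = c * sqrt 3 / (2 * pi\<^sup>2)"
  proof -
    have "sqrt (6 / pi) / sqrt (2 * pi) = sqrt 3 / pi"
    proof -
      have "sqrt (6 / pi) / sqrt (2 * pi) = sqrt ((6 / pi) / (2 * pi))" by (simp only: real_sqrt_divide)
      also have "(6 / pi) / (2 * pi) = 3 / pi\<^sup>2" by (simp add: power2_eq_square)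
      also have "sqrt (3 / pi\<^sup>2) = sqrt 3 / pi" by (simp add: real_sqrt_divide)
      finally show ?thesis .
    qed
    hence "c / (2 * pi) * (sqrt (6 / pi) / sqrt (2 * pi)) = c / (2 * pi) * (sqrt 3 / pi)" by (simp only:)
    thus ?thesis by (simp add: P_def power2_eq_square)
  qed
  ultimately show ?thesis by simp
qed

section \<open>Asymptotics of the rank counts\<close>

lemma u_gf:
  assumes t: "Re t > 0"
  shows "(\<lambda>k. of_real (real (u (int m) k)) * exp (- t) ^ k) sums (partition_gf (exp (- t)) * false_theta (exp (- t)) m)"
proof -
  have q: "norm (exp (- t)) < 1" "exp (- t) \<noteq> 0" using t by auto
  show ?thesis using has_sum_imp_sums[OF u_has_sum[OF q, of "int m"]] rank_gf_eq_false_theta(1)[OF q, of m] by simp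
qed

lemma summable_u:
  assumes e: "e > 0"
  shows "summable (\<lambda>k. real (u m k) * exp (- e) ^ k)"
proof -
  define q where "q = complex_of_real (exp (- e))"
  have q: "norm q < 1" "q \<noteq> 0" using e by (auto simp: q_def)
  have "(\<lambda>k. of_nat (u m k) * q ^ k) summable_on UNIV"
    using u_has_sum[OF q, of m] by (auto simp: summable_on_def)
  hence "(\<lambda>k. norm (of_nat (u m k) * q ^ k)) summable_on UNIV"
    by (simp only: summable_on_iff_abs_summable_on_complex)
  hence "summable (\<lambda>k. norm (of_nat (u m k) * q ^ k))" by (rule summable_on_imp_summable)
  thus ?thesis by (simp add: norm_mult norm_power q_def)
qed

lemma sqrt_power_bounds:
  fixes e :: real
  assumes "0 < e" "e \<le> 1"
  shows "e \<le> sqrt e" "sqrt e ^ 3 = e * sqrt e" "sqrt e ^ 3 \<le> sqrt e"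
proof -
  have s: "0 < sqrt e" "sqrt e \<le> 1" "sqrt e * sqrt e = e" using assms by auto
  show 1: "e \<le> sqrt e" using mult_left_le[of "sqrt e" "sqrt e"] s by simp
  show 2: "sqrt e ^ 3 = e * sqrt e" using s by (simp add: power_numeral_reduce)
  show "sqrt e ^ 3 \<le> sqrt e" unfolding 2 using assms s by (simp add: mult_left_le_one_le)
qed

text \<open>\<open>coefficient_asymp\<close> with \<kappa> = 0 and c = 1/4; the linear term of the
  expansion goes into the error, which only has to be O(sqrt (Re t)).\<close>

lemma u_limit:
  "(\<lambda>n. real (u (int m) n) / ((pi / sqrt (6 * real n)) ^ 2 * exp (pi * sqrt (2 * real n / 3)))) \<longlonglongrightarrow> sqrt 3 / (8 * pi\<^sup>2)"
proof -
  obtain C where C: "\<And>t. 0 < Re t \<and> Re t \<le> 1 \<and> \<bar>Im t\<bar> \<le> Re t \<Longrightarrow>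
     norm (false_theta (exp (- t)) m - (1 / 4 - (of_nat m ^ 2 - 1) / 8 * t)) \<le> C * sqrt (Re t) ^ 3"
    using false_theta_asymp[of m] by blast
  define M where "M = norm ((of_nat m ^ 2 - 1) / 8 :: complex)"
  have "(\<lambda>n. real (u (int m) n) / ((pi / sqrt (6 * real n)) ^ (0 + 2) * exp (pi * sqrt (2 * real n / 3)))) \<longlonglongrightarrow> (1 / 4) * sqrt 3 / (2 * pi\<^sup>2)"
  proof (rule coefficient_asymp[where F = "\<lambda>t. false_theta (exp (- t)) m" and C = "\<bar>C\<bar> + M * 2" and C' = "4 * theta_const m"])
    show "summable (\<lambda>k. \<bar>real (u (int m) k)\<bar> * exp (- e) ^ k)" if "e > 0" for e
      using summable_u[OF that, of "int m"] by simp
    show "(\<Sum>k. of_real (real (u (int m) k)) * exp (- t) ^ k) = partition_gf (exp (- t)) * false_theta (exp (- t)) m" if "Re t > 0" for t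
      by (rule sums_unique[symmetric, OF u_gf[OF that]])
    show "norm (false_theta (exp (- t)) m) \<le> 4 * theta_const m / Re t" if "0 < Re t" "Re t \<le> 1" for t
      by (rule norm_false_theta_le[OF that])
    fix t :: complex assume t: "0 < Re t" "Re t \<le> 1" "\<bar>Im t\<bar> \<le> Re t"
    note sp = sqrt_power_bounds[OF t(1,2)]
    define X where "X = false_theta (exp (- t)) m - (1 / 4 - (of_nat m ^ 2 - 1) / 8 * t)"
    have "false_theta (exp (- t)) m - of_real (1 / 4) * t ^ 0 = X - (of_nat m ^ 2 - 1) / 8 * t" by (simp add: X_def)
    also have "norm \<dots> \<le> norm X + M * norm t" unfolding M_def norm_mult[symmetric] by (rule norm_triangle_ineq4)
    also have "norm X \<le> C * sqrt (Re t) ^ 3" unfolding X_def using C[of t] t by simp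
    also have "C * sqrt (Re t) ^ 3 \<le> \<bar>C\<bar> * sqrt (Re t)" using sp t by (intro mult_mono) auto
    also have "norm t \<le> 2 * Re t" using cmod_le[of t] t by simp
    also have "2 * Re t \<le> 2 * sqrt (Re t)" using sp by simp
    finally have "norm (false_theta (exp (- t)) m - of_real (1 / 4) * t ^ 0) \<le> \<bar>C\<bar> * sqrt (Re t) + M * (2 * sqrt (Re t))"
      by (simp add: M_def mult_left_mono)
    thus "norm (false_theta (exp (- t)) m - of_real (1 / 4) * t ^ 0) \<le> (\<bar>C\<bar> + M * 2) * Re t ^ 0 * sqrt (Re t)"
      by (simp add: algebra_simps)
  qed
  thus ?thesis by (simp add: numeral_2_eq_2)
qed

text \<open>\<open>coefficient_asymp\<close> with \<kappa> = 1: the constants 1/4 cancel, and c =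
  ((m+1)^2 - m^2)/8 remains. The error (Re t)^(3/2) is exactly Re t times the factor sqrt (Re t)
  that is asked for.\<close>

lemma u_diff_limit_nat:
  "(\<lambda>n. (real (u (int m) n) - real (u (int m + 1) n)) / ((pi / sqrt (6 * real n)) ^ 3 * exp (pi * sqrt (2 * real n / 3))))
     \<longlonglongrightarrow> (2 * real m + 1) * sqrt 3 / (16 * pi\<^sup>2)"
proof -
  have S: "int m + 1 = int (Suc m)" by simp
  obtain C where C: "\<And>t. 0 < Re t \<and> Re t \<le> 1 \<and> \<bar>Im t\<bar> \<le> Re t \<Longrightarrow>
     norm (false_theta (exp (- t)) m - (1 / 4 - (of_nat m ^ 2 - 1) / 8 * t)) \<le> C * sqrt (Re t) ^ 3"
    using false_theta_asymp[of m] by blast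
  obtain C1 where C1: "\<And>t. 0 < Re t \<and> Re t \<le> 1 \<and> \<bar>Im t\<bar> \<le> Re t \<Longrightarrow>
     norm (false_theta (exp (- t)) (Suc m) - (1 / 4 - (of_nat (Suc m) ^ 2 - 1) / 8 * t)) \<le> C1 * sqrt (Re t) ^ 3"
    using false_theta_asymp[of "Suc m"] by blast
  define c where "c = (2 * real m + 1) / 8"
  have "(\<lambda>n. (real (u (int m) n) - real (u (int (Suc m)) n)) / ((pi / sqrt (6 * real n)) ^ (1 + 2) * exp (pi * sqrt (2 * real n / 3)))) 
     \<longlonglongrightarrow> c * sqrt 3 / (2 * pi\<^sup>2)"
  proof (rule coefficient_asymp[where F = "\<lambda>t. false_theta (exp (- t)) m - false_theta (exp (- t)) (Suc m)" 
        and C = "C + C1" and C' = "4 * theta_const m + 4 * theta_const (Suc m)"])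
    show "summable (\<lambda>k. \<bar>real (u (int m) k) - real (u (int (Suc m)) k)\<bar> * exp (- e) ^ k)" if "e > 0" for e
    proof (rule summable_comparison_test'[OF summable_add[OF summable_u[OF that, of "int m"] summable_u[OF that, of "int (Suc m)"]]])
      fix k :: nat
      have "\<bar>real (u (int m) k) - real (u (int (Suc m)) k)\<bar> * exp (- e) ^ k \<le> (real (u (int m) k) + real (u (int (Suc m)) k)) * exp (- e) ^ k"
        by (intro mult_right_mono) auto
      thus "norm (\<bar>real (u (int m) k) - real (u (int (Suc m)) k)\<bar> * exp (- e) ^ k) \<le> real (u (int m) k) * exp (- e) ^ k + real (u (int (Suc m)) k) * exp (- e) ^ k"
        by (simp add: distrib_right)
    qed
    show "(\<Sum>k. of_real (real (u (int m) k) - real (u (int (Suc m)) k)) * exp (- t) ^ k) = partition_gf (exp (- t)) * (false_theta (exp (- t)) m - false_theta (exp (- t)) (Suc m))"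
      if "Re t > 0" for t
      using sums_unique[OF sums_diff[OF u_gf[OF that, of m] u_gf[OF that, of "Suc m"]]]
      by (simp only: of_real_diff left_diff_distrib right_diff_distrib)
    show "norm (false_theta (exp (- t)) m - false_theta (exp (- t)) (Suc m)) \<le> (4 * theta_const m + 4 * theta_const (Suc m)) / Re t"
      if "0 < Re t" "Re t \<le> 1" for t
      unfolding add_divide_distrib
      by (rule order_trans[OF norm_triangle_ineq4 add_mono[OF norm_false_theta_le[OF that] norm_false_theta_le[OF that]]])
    fix t :: complex assume t: "0 < Re t" "Re t \<le> 1" "\<bar>Im t\<bar> \<le> Re t"
    note sp = sqrt_power_bounds[OF t(1,2)]
    have "false_theta (exp (- t)) m - false_theta (exp (- t)) (Suc m) - of_real c * t ^ 1 = 
       (false_theta (exp (- t)) m - (1 / 4 - (of_nat m ^ 2 - 1) / 8 * t)) - (false_theta (exp (- t)) (Suc m) - (1 / 4 - (of_nat (Suc m) ^ 2 - 1) / 8 * t))"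
      by (simp add: c_def power2_eq_square field_simps)
    also have "norm \<dots> \<le> C * sqrt (Re t) ^ 3 + C1 * sqrt (Re t) ^ 3"
      by (rule order_trans[OF norm_triangle_ineq4]) (intro add_mono C C1; use t in simp)
    also have "\<dots> = (C + C1) * Re t ^ 1 * sqrt (Re t)" unfolding sp(2) by (simp add: algebra_simps)
    finally show "norm (false_theta (exp (- t)) m - false_theta (exp (- t)) (Suc m) - of_real c * t ^ 1) \<le> (C + C1) * Re t ^ 1 * sqrt (Re t)" .
  qed
  moreover have "1 + 2 = (3 :: nat)" by simp
  moreover have "c * sqrt 3 / (2 * pi\<^sup>2) = (2 * real m + 1) * sqrt 3 / (16 * pi\<^sup>2)" by (simp add: c_def)
  ultimately show ?thesis unfolding S by (simp only:)
qed

text \<open>The range includes m = -1, which occurs as m - 1 in the last asymptotic formula. There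
  u(-1) = u(1) turns the difference into the negative of the one at 0, in agreement with 2 (-1) + 1
  = -1.\<close>

lemma u_diff_limit:
  fixes m :: int
  assumes "m \<ge> - 1"
  shows "(\<lambda>n. (real (u m n) - real (u (m + 1) n)) / ((pi / sqrt (6 * real n)) ^ 3 * exp (pi * sqrt (2 * real n / 3))))
     \<longlonglongrightarrow> (2 * real_of_int m + 1) * sqrt 3 / (16 * pi\<^sup>2)"
proof (cases "m = - 1")
  case False
  then obtain k where "m = int k" using assms nonneg_int_cases[of m] by auto
  thus ?thesis using u_diff_limit_nat[of k] by simp
next
  case True
  have "(real (u m n) - real (u (m + 1) n)) / d = - ((real (u (int 0) n) - real (u (int 0 + 1) n)) / d)" for n d
    using u_minus[of 1 n] by (simp add: True minus_divide_left)
  thus ?thesis using tendsto_minus[OF u_diff_limit_nat[of 0]] by (simp add: True)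
qed

lemma asymp_equiv_of_limit:
  fixes f g h :: "nat \<Rightarrow> real"
  assumes "(\<lambda>n. f n / h n) \<longlonglongrightarrow> L" "L \<noteq> 0" "\<forall>\<^sub>F n in at_top. g n = h n * L"
  shows "f \<sim>[at_top] g"
proof (rule asymp_equivI')
  have "(\<lambda>n. f n / h n / L) \<longlonglongrightarrow> L / L" using assms(2) by (intro tendsto_intros assms(1))
  hence "(\<lambda>n. f n / h n / L) \<longlonglongrightarrow> 1" using assms(2) by simp
  thus "(\<lambda>n. f n / g n) \<longlonglongrightarrow> 1"
    by (rule Lim_transform_eventually) (use assms(3) in eventually_elim, simp)
qed

theorem theorem1p5:
  fixes m :: int
  assumes "m \<ge> 0"
  shows "((\<lambda>n. real (u m n)) \<sim>[at_top]
           (\<lambda>n. 1 / (16 * sqrt 3 * real n) * exp (pi * sqrt (2 * real n / 3)))) \<and>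
         ((\<lambda>n. real (u m n) - real (u (m + 1) n)) \<sim>[at_top]
           (\<lambda>n. pi * (2 * real_of_int m + 1) / (96 * sqrt 2 * real n powr (3 / 2)) *
                exp (pi * sqrt (2 * real n / 3)))) \<and>
         ((\<lambda>n. real (u m n) ^ 2 - real (u (m - 1) n) * real (u (m + 1) n)) \<sim>[at_top]
           (\<lambda>n. pi / (768 * sqrt 6 * real n powr (5 / 2)) *
                exp (2 * pi * sqrt (2 * real n / 3)))) \<and>
         (\<forall>\<^sub>F n in at_top. u m n ^ 2 > u (m - 1) n * u (m + 1) n)"
proof -
  define \<eta> where "\<eta> = (\<lambda>n. pi / sqrt (6 * real n))"
  define E where "E = (\<lambda>n. exp (pi * sqrt (2 * real n / 3)))"
  define d where "d = (\<lambda>j n. real (u j n) - real (u (j + 1) n))"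
  define D where "D = (\<lambda>n. real (u m n) ^ 2 - real (u (m - 1) n) * real (u (m + 1) n))"
  define U where "U = (\<lambda>n. real (u m n) / (\<eta> n ^ 2 * E n))"
  define V where "V = (\<lambda>j n. d j n / (\<eta> n ^ 3 * E n))"
  define v where "v = (\<lambda>j. (2 * real_of_int j + 1) * sqrt 3 / (16 * pi\<^sup>2))"
  have lim0: "U \<longlonglongrightarrow> sqrt 3 / (8 * pi\<^sup>2)"
    using u_limit[of "nat m"] assms by (simp add: U_def \<eta>_def E_def)
  have lim1: "V j \<longlonglongrightarrow> v j" if "j \<ge> - 1" for j
    unfolding V_def v_def d_def \<eta>_def E_def by (rule u_diff_limit[OF that])
  have elim0: "\<eta> \<longlonglongrightarrow> 0" unfolding \<eta>_def by real_asymp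
  have D_eq: "D n = real (u m n) * (d m n - d (m - 1) n) + d (m - 1) n * d m n" for n
    unfolding D_def d_def by (simp add: power2_eq_square algebra_simps)
  \<comment> \<open>After division by E^2 the first product in \<open>D_eq\<close> has order
    \<eta>^5 and the second \<eta>^6. The first one prevails since \<open>v m - v (m - 1)\<close> is
    a positive constant independent of m.\<close>
  have lim2: "(\<lambda>n. D n / (\<eta> n ^ 5 * E n ^ 2)) \<longlonglongrightarrow> 3 / (64 * pi ^ 4)"
  proof (rule Lim_transform_eventually)
    have "(\<lambda>n. U n * (V m n - V (m - 1) n) + 
        \<eta> n * (V (m - 1) n) * (V m n)) \<longlonglongrightarrow> 
      sqrt 3 / (8 * pi\<^sup>2) * (v m - v (m - 1)) + 
      0 * (v (m - 1)) * (v m)"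
      by (intro tendsto_intros lim0 lim1 elim0) (use assms in auto)
    also have "sqrt 3 / (8 * pi\<^sup>2) * (v m - v (m - 1)) + 
      0 * (v (m - 1)) * (v m) = 3 / (64 * pi ^ 4)"
    proof -
      have "v m - v (m - 1) = sqrt 3 / (8 * pi\<^sup>2)"
        by (simp add: v_def field_simps)
      moreover have "sqrt 3 / (8 * pi\<^sup>2) * (sqrt 3 / (8 * pi\<^sup>2)) = 3 / (64 * pi ^ 4)" by (simp add: power_numeral_reduce)
      ultimately show ?thesis by simp
    qed
    finally show "(\<lambda>n. U n * (V m n - V (m - 1) n) + 
        \<eta> n * (V (m - 1) n) * (V m n)) \<longlonglongrightarrow> 3 / (64 * pi ^ 4)" .
    show "\<forall>\<^sub>F n in sequentially. U n * (V m n - V (m - 1) n) + 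
        \<eta> n * (V (m - 1) n) * (V m n) = D n / (\<eta> n ^ 5 * E n ^ 2)"
      using eventually_gt_at_top[of 0]
    proof eventually_elim
      case (elim n)
      have pos: "\<eta> n > 0" "E n > 0" using elim by (auto simp: \<eta>_def E_def)
      have "U / (x ^ 2 * y) * (a / (x ^ 3 * y) - b / (x ^ 3 * y)) + x * (b / (x ^ 3 * y)) * (a / (x ^ 3 * y)) =
        (U * (a - b) + b * a) / (x ^ 5 * y ^ 2)" if "x > 0" "y > 0" for U a b x y :: real
        using that by (simp add: power_numeral_reduce field_simps)
      from this[OF pos] show ?case unfolding D_eq U_def V_def by simp
    qed
  qed
  \<comment> \<open>In terms of the square root of n all half-integer powers become integer powers,
    so the constants can be compared by field arithmetic.\<close>
  define y where "y = (\<lambda>n. sqrt (real n))"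
  have good: "\<forall>\<^sub>F n in at_top. y n > 0 \<and> \<eta> n = pi / (sqrt 6 * y n) \<and> real n = y n ^ 2 \<and> real n powr (3 / 2) = y n ^ 3 \<and> real n powr (5 / 2) = y n ^ 5"
    using eventually_gt_at_top[of 0]
  proof eventually_elim
    case (elim n)
    have y: "y n > 0" using elim by (simp add: y_def)
    have p: "real n powr (real k / 2) = y n ^ k" for k
    proof -
      have "y n ^ k = y n powr real k" using y by (simp add: powr_realpow)
      also have "\<dots> = (real n powr (1 / 2)) powr real k" using elim by (simp add: y_def powr_half_sqrt)
      also have "\<dots> = real n powr (real k / 2)" by (simp add: powr_powr)
      finally show ?thesis ..
    qed
    show ?case using y p[of 3] p[of 5] by (simp add: \<eta>_def y_def real_sqrt_mult)
  qed
  have s6: "sqrt 6 = sqrt 2 * sqrt 3" by (simp flip: real_sqrt_mult)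
  have sq: "sqrt 6 * sqrt 6 = (6 :: real)" "sqrt 3 * sqrt 3 = (3 :: real)" "sqrt 2 * sqrt 2 = (2 :: real)" by auto
  have "(\<lambda>n. real (u m n)) \<sim>[at_top] (\<lambda>n. 1 / (16 * sqrt 3 * real n) * E n)"
  proof (rule asymp_equiv_of_limit[OF lim0[unfolded U_def]])
    show "\<forall>\<^sub>F n in at_top. 1 / (16 * sqrt 3 * real n) * E n = \<eta> n ^ 2 * E n * (sqrt 3 / (8 * pi\<^sup>2))"
      using good
    proof eventually_elim
      case (elim n)
      hence \<eta>: "\<eta> n = pi / (sqrt 6 * y n)" and n: "real n = y n ^ 2" and y: "y n > 0" by blast+
      have "1 / (16 * sqrt 3 * y n ^ 2) = (pi / (sqrt 6 * y n)) ^ 2 * (sqrt 3 / (8 * pi\<^sup>2))"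
        using y by (simp add: power_divide power_mult_distrib field_simps)
      thus ?case unfolding \<eta> n by simp
    qed
  qed simp
  moreover have "(\<lambda>n. d m n) \<sim>[at_top] (\<lambda>n. pi * (2 * real_of_int m + 1) / (96 * sqrt 2 * real n powr (3 / 2)) * E n)"
  proof (rule asymp_equiv_of_limit[OF lim1[unfolded V_def v_def]])
    show "\<forall>\<^sub>F n in at_top. pi * (2 * real_of_int m + 1) / (96 * sqrt 2 * real n powr (3 / 2)) * E n = \<eta> n ^ 3 * E n * ((2 * real_of_int m + 1) * sqrt 3 / (16 * pi\<^sup>2))"
      using good
    proof eventually_elim
      case (elim n)
      hence \<eta>: "\<eta> n = pi / (sqrt 6 * y n)" and n: "real n powr (3 / 2) = y n ^ 3" and y: "y n > 0" by blast+
      have "pi * M / (96 * sqrt 2 * y n ^ 3) = (pi / (sqrt 6 * y n)) ^ 3 * (M * sqrt 3 / (16 * pi\<^sup>2))" for M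
      proof -
        have "sqrt 6 ^ 3 = 6 * (sqrt 2 * sqrt 3)" using sq(1) by (simp add: power_numeral_reduce flip: s6)
        thus ?thesis using y by (simp add: power_divide power_mult_distrib power_numeral_reduce field_simps)
      qed
      thus ?case unfolding \<eta> n by simp
    qed
  qed (use assms in auto)
  moreover have "D \<sim>[at_top] (\<lambda>n. pi / (768 * sqrt 6 * real n powr (5 / 2)) * exp (2 * pi * sqrt (2 * real n / 3)))"
  proof (rule asymp_equiv_of_limit[OF lim2])
    show "\<forall>\<^sub>F n in at_top. pi / (768 * sqrt 6 * real n powr (5 / 2)) * exp (2 * pi * sqrt (2 * real n / 3)) = \<eta> n ^ 5 * E n ^ 2 * (3 / (64 * pi ^ 4))"
      using good
    proof eventually_elim
      case (elim n)
      hence \<eta>: "\<eta> n = pi / (sqrt 6 * y n)" and n: "real n powr (5 / 2) = y n ^ 5" and y: "y n > 0" by blast+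
      have E2: "exp (2 * pi * sqrt (2 * real n / 3)) = E n ^ 2"
        by (simp add: E_def power2_eq_square flip: exp_add)
      have "pi / (768 * sqrt 6 * y n ^ 5) = (pi / (sqrt 6 * y n)) ^ 5 * (3 / (64 * pi ^ 4))"
      proof -
        have "sqrt 6 ^ 5 = 36 * sqrt 6" using sq(1) by (simp add: power_numeral_reduce)
        thus ?thesis using y by (simp add: power_divide power_mult_distrib power_numeral_reduce field_simps)
      qed
      thus ?case unfolding \<eta> n E2 by simp
    qed
  qed simp
  moreover have "\<forall>\<^sub>F n in at_top. u m n ^ 2 > u (m - 1) n * u (m + 1) n"
  proof -
    have "\<forall>\<^sub>F n in at_top. D n / (\<eta> n ^ 5 * E n ^ 2) > 0"
      by (rule order_tendstoD(1)[OF lim2]) simp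
    thus ?thesis using eventually_gt_at_top[of 0]
    proof eventually_elim
      case (elim n)
      have "\<eta> n ^ 5 * E n ^ 2 > 0" using elim by (simp add: \<eta>_def E_def)
      hence "D n > 0" using elim(1) by (simp add: zero_less_divide_iff)
      hence "real (u (m - 1) n * u (m + 1) n) < real (u m n ^ 2)" by (simp add: D_def)
      thus ?case by (simp only: of_nat_less_iff)
    qed
  qed
  ultimately show ?thesis unfolding D_def d_def E_def by blast
qed

end
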